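(* Up to translations and reflection with respect to the $x$-axis, the solutions of the equation $$\left\langle\begin{pmatrix}0&0\\0&1\end{pmatrix}Y+\begin{pmatrix}1\\0\end{pmatrix},N_Y\right\rangle=k_Y^{1/3}$$ for curves $Y$ in $\mathbb{R}^2$ are the following five kinds of curves: (1) The line $y=0$. (2) A curve formed by the graphs of two functions $y=f_1(x)$ and $y=f_2(x)$ with $x\in[0,+\infty)$, where $f_1$ and $f_2$ satisfy: (a) $f_1(0)=f_2(0)>0$, $f_1'(0)=+\infty$ and $f_2'(0)=-\infty$; (b) $f_1(x)>f_2(x)$ for any $x\in(0,+\infty)$; (c) $f_1$ is increasing with only one inflection point; (d) $f_2$ is a convex function with only one minimum point, with positive minimum. (3) A curve formed by the graphs of two functions $y=f_1(x)$ and $y=f_2(x)$ with $x\in[0,+\infty)$, where $f_1$ and $f_2$ satisfy: (a) $f_1(0)=f_2(0)>0$, $f_1'(0)=+\infty$ and $f_2'(0)=-\infty$; (b) $f_1$ is increasing with only one inflection point; (c) $f_2$ is a decreasing convex function and $f_2(x)\to0$ as $x\to+\infty$. (4) A curve formed by the graphs of two functions $y=f_1(x)$ and $y=f_2(x)$ with $x\in[0,+\infty)$, where $f_1$ and $f_2$ satisfy: (a) $f_1(0)=f_2(0)\ge0$, $f_1'(0)=+\infty$ and $f_2'(0)=-\infty$; (b) $f_1$ is increasing with only one inflection point; (c) $f_2$ is decreasing with only one inflection point. Moreover, when $f_1(0)=f_2(0)=0$, the curve is symmetric with respect to the $x$-axis, that is, $f_2=-f_1$. (5) The graph of an increasing convex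 function $f$ on $(-\infty,\infty)$ with $f(x)\to0$ as $x\to-\infty$.
   Context: Points of $\mathbb{R}^2$ are written as $(x,y)$. Curves are smooth immersed curves. For a curve $Y=Y(u)$, put $T=Y_u/\|Y_u\|$, $N_Y=JT$ with $J=\begin{pmatrix}0&-1\\1&0\end{pmatrix}$ (unit normal), and $k_Y=\det(Y_u,Y_{uu})/\|Y_u\|^3$ (curvature with respect to $N_Y$). $\langle\cdot,\cdot\rangle$ is the Euclidean inner product and $k^{1/3}$ is the real (odd) cube root. Solutions are regarded as geometric curves (up to reparametrization), connected and maximally extended. An infinite derivative at $0$ means that the one-sided derivative tends to $\pm\infty$ as $x\to0^+$, i.e. the curve has a vertical tangent there. Reflection with respect to the $x$-axis is the map $(x,y)\mapsto(x,-y)$. *)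

theory Defs
  imports "HOL-Analysis.Analysis"
begin

section \<open>Smooth immersed plane curves\<close>

text \<open>C-infinity on \<open>S\<close>; only used for open \<open>S\<close>, where the full derivatives \<open>at t\<close> are the
  right ones.\<close>

definition smooth_on :: "real set \<Rightarrow> (real \<Rightarrow> 'a::real_normed_vector) \<Rightarrow> bool" where
  "smooth_on S f \<longleftrightarrow>
     (\<forall>n. \<forall>t\<in>S. ((\<lambda>g u. vector_derivative g (at u)) ^^ n) f differentiable (at t))"

definition immersed_curve :: "real set \<Rightarrow> (real \<Rightarrow> real^2) \<Rightarrow> bool" where
  "immersed_curve I Y \<longleftrightarrow>
     open I \<and> is_interval I \<and> I \<noteq> {} \<and> smooth_on I Y \<and>
     (\<forall>u\<in>I. vector_derivative Y (at u) \<noteq> 0)"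

definition rot90 :: "real^2^2" where
  "rot90 = vector [vector [0, -1], vector [1, 0]]"

definition unit_tangent :: "(real \<Rightarrow> real^2) \<Rightarrow> real \<Rightarrow> real^2" where
  "unit_tangent Y u = vector_derivative Y (at u) /\<^sub>R norm (vector_derivative Y (at u))"

definition unit_normal :: "(real \<Rightarrow> real^2) \<Rightarrow> real \<Rightarrow> real^2" where
  "unit_normal Y u = rot90 *v unit_tangent Y u"

text \<open>\<open>vector [a, b]\<close> has rows \<open>a\<close>, \<open>b\<close>; the transpose has them as columns.\<close>

definition curvature :: "(real \<Rightarrow> real^2) \<Rightarrow> real \<Rightarrow> real" where
  "curvature Y u =
     (let Yu = vector_derivative Y (at u);
          Yuu = vector_derivative (\<lambda>t. vector_derivative Y (at t)) (at u)
      in det (transpose (vector [Yu, Yuu]) :: real^2^2) / norm Yu ^ 3)"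


section \<open>Maximal solutions\<close>

text \<open>\<open>root 3\<close> is the odd real cube root, also on negative arguments.\<close>

definition solution :: "real set \<Rightarrow> (real \<Rightarrow> real^2) \<Rightarrow> bool" where
  "solution I Y \<longleftrightarrow>
     immersed_curve I Y \<and>
     (\<forall>u\<in>I. ((vector [vector [0, 0], vector [0, 1]] :: real^2^2) *v Y u + vector [1, 0])
              \<bullet> unit_normal Y u = root 3 (curvature Y u))"

text \<open>Maximality is a property of the geometric curve: if \<open>Y\<close> is, after a regular
  reparametrization \<open>\<phi>\<close>, a piece of a solution \<open>Z\<close> on \<open>K\<close>, then it is all of \<open>Z\<close>. Comparing only
  parametrizations that literally extend each other (\<open>\<phi>\<close> the identity) would not do, since a
  bounded piece of a solution can be parametrized over the whole real line.\<close>

definition maximal_solution :: "real set \<Rightarrow> (real \<Rightarrow> real^2) \<Rightarrow> bool" where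
  "maximal_solution I Y \<longleftrightarrow>
     solution I Y \<and>
     (\<forall>K Z \<phi>. solution K Z \<and> smooth_on I \<phi> \<and> (\<forall>u\<in>I. vector_derivative \<phi> (at u) \<noteq> 0) \<and>
        \<phi> ` I \<subseteq> K \<and> (\<forall>u\<in>I. Y u = Z (\<phi> u)) \<longrightarrow> \<phi> ` I = K)"


section \<open>Translations and reflection\<close>

definition reflect_x :: "real^2 \<Rightarrow> real^2" where
  "reflect_x p = vector [p $ 1, - (p $ 2)]"

text \<open>The group generated by the translations and the reflection in the x-axis.\<close>

definition motions :: "(real^2 \<Rightarrow> real^2) set" where
  "motions = range (\<lambda>v p. p + v) \<union> range (\<lambda>v p. reflect_x p + v)"


section \<open>Curves formed by graphs\<close>

definition fgraph :: "real set \<Rightarrow> (real \<Rightarrow> real) \<Rightarrow> (real^2) set" where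
  "fgraph S f = (\<lambda>x. vector [x, f x]) ` S"

text \<open>In the next two definitions, injectivity says that the trace is run through exactly once.\<close>

definition is_graph :: "real set \<Rightarrow> (real \<Rightarrow> real^2) \<Rightarrow> (real \<Rightarrow> real) \<Rightarrow> bool" where
  "is_graph I Y f \<longleftrightarrow> inj_on Y I \<and> Y ` I = fgraph UNIV f \<and> smooth_on UNIV f"

definition is_two_graphs ::
    "real set \<Rightarrow> (real \<Rightarrow> real^2) \<Rightarrow> (real \<Rightarrow> real) \<Rightarrow> (real \<Rightarrow> real) \<Rightarrow> bool" where
  "is_two_graphs I Y f1 f2 \<longleftrightarrow>
     inj_on Y I \<and> Y ` I = fgraph {0..} f1 \<union> fgraph {0..} f2 \<and>
     (\<forall>f\<in>{f1, f2}. continuous_on {0..} f \<and> smooth_on {0<..} f)"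

definition inflection_point :: "(real \<Rightarrow> real) \<Rightarrow> real \<Rightarrow> bool" where
  "inflection_point f a \<longleftrightarrow>
     (\<exists>\<sigma>\<in>{-1, 1}. (\<forall>\<^sub>F x in at_left a. \<sigma> * deriv (deriv f) x < 0) \<and>
                 (\<forall>\<^sub>F x in at_right a. \<sigma> * deriv (deriv f) x > 0))"

definition one_inflection :: "(real \<Rightarrow> real) \<Rightarrow> bool" where
  "one_inflection f \<longleftrightarrow> (\<exists>!a. 0 < a \<and> inflection_point f a)"

text \<open>The two branches meet on the y-axis, where the curve has a vertical tangent.\<close>

definition vertical_start :: "(real \<Rightarrow> real) \<Rightarrow> (real \<Rightarrow> real) \<Rightarrow> bool" where
  "vertical_start f1 f2 \<longleftrightarrow>
     f1 0 = f2 0 \<and> filterlim (deriv f1) at_top (at_right 0) \<and>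
     filterlim (deriv f2) at_bot (at_right 0)"

text \<open>The profiles of the two-branch curves, named after the behaviour of the lower branch
  \<open>f2\<close>.\<close>

definition turning_profile :: "(real \<Rightarrow> real) \<Rightarrow> (real \<Rightarrow> real) \<Rightarrow> bool" where
  "turning_profile f1 f2 \<longleftrightarrow>
     vertical_start f1 f2 \<and> f1 0 > 0 \<and>
     (\<forall>x>0. f1 x > f2 x) \<and>
     strict_mono_on {0..} f1 \<and> one_inflection f1 \<and>
     convex_on {0..} f2 \<and>
     (\<exists>!m. is_arg_min f2 (\<lambda>x. 0 \<le> x) m) \<and>
     (\<forall>m. is_arg_min f2 (\<lambda>x. 0 \<le> x) m \<longrightarrow> f2 m > 0)"

definition asymptotic_profile :: "(real \<Rightarrow> real) \<Rightarrow> (real \<Rightarrow> real) \<Rightarrow> bool" where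
  "asymptotic_profile f1 f2 \<longleftrightarrow>
     vertical_start f1 f2 \<and> f1 0 > 0 \<and>
     strict_mono_on {0..} f1 \<and> one_inflection f1 \<and>
     strict_antimono_on {0..} f2 \<and> convex_on {0..} f2 \<and> (f2 \<longlongrightarrow> 0) at_top"

definition crossing_profile :: "(real \<Rightarrow> real) \<Rightarrow> (real \<Rightarrow> real) \<Rightarrow> bool" where
  "crossing_profile f1 f2 \<longleftrightarrow>
     vertical_start f1 f2 \<and> f1 0 \<ge> 0 \<and>
     strict_mono_on {0..} f1 \<and> one_inflection f1 \<and>
     strict_antimono_on {0..} f2 \<and> one_inflection f2 \<and>
     (f1 0 = 0 \<longrightarrow> (\<forall>x\<ge>0. f2 x = - f1 x))"

definition entire_profile :: "(real \<Rightarrow> real) \<Rightarrow> bool" where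
  "entire_profile f \<longleftrightarrow> strict_mono f \<and> convex_on UNIV f \<and> (f \<longlongrightarrow> 0) at_bot"

end

theory Submission
  imports Defs
begin

text \<open>Let \<open>(c, s)\<close> be the unit tangent of a curve parametrized by arclength. The equation says that the
curvature is the cube of \<open>v = y c - s\<close>, so the solutions are the trajectories of

  \<open>x' = c\<close>,  \<open>y' = s\<close>,  \<open>c' = - v^3 s\<close>,  \<open>s' = v^3 c\<close>,  \<open>c^2 + s^2 = 1\<close>

(locale \<open>soliton\<close>). Because \<open>\<bar>y'\<bar> \<le> 1\<close>, no trajectory escapes in finite time: every initial value has a
trajectory defined for all time (\<open>soliton_exists\<close>). Parametrizing by arclength identifies any solution with
a piece of such a trajectory (\<open>solution_reparametrized\<close>), and a complete trajectory has infinite length in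
both directions, so it is not part of anything longer (\<open>soliton.maximal\<close>). The maximal solutions are
therefore the complete trajectories, and what remains is to read off the phase portrait.

Three facts organize it. Where \<open>c = 0\<close> one has \<open>c' = 1\<close>; so a trajectory has at most one vertical tangent, and
\<open>x\<close> is smallest there. The region \<open>y > 0\<close>, \<open>s > 0\<close> is forward invariant and, by reversal of time, the region
\<open>y > 0\<close>, \<open>s < 0\<close> is backward invariant. Where \<open>v = 0\<close> one has \<open>v' = s c\<close>, so that inflection points are simple
and on a rising piece the curve passes only from concave to convex. Moreover a trajectory that is somewhere
in \<open>y > 0\<close>, \<open>s < 0\<close> had a vertical tangent before, because in backward time its direction turns downwards, as long
as \<open>c > 0\<close>, at a rate bounded away from zero (\<open>reaches_vertical\<close>).

If there is a vertical tangent, a translation, a reflection and a change of orientation bring it to the y-axis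
at a height \<open>\<ge> 0\<close>, pointing upwards. The two halves of the curve are graphs of solutions of
\<open>f'' = (f - f')^3\<close> on \<open>(0, \<infinity>)\<close>. The upper one stays in \<open>y > 0\<close>, \<open>s > 0\<close> and has exactly one inflection point. The
lower one starts in \<open>y > 0\<close>, \<open>s < 0\<close> (or is the mirror image of the upper one, if the height is 0) and either
becomes horizontal, or reaches the x-axis, or does neither: this gives the turning, crossing and asymptotic
profiles (\<open>vertical_soliton.profiles\<close>). The right hand side of the equation increases with \<open>f\<close>, whence a
maximum principle that keeps the two graphs apart (\<open>graph_comparison\<close>).

If there is no vertical tangent, \<open>reaches_vertical\<close> leaves only the line and, up to reflection and change of
orientation, the curves with \<open>c, y, s > 0\<close> throughout; these have \<open>v > 0\<close> and come from the x-axis (\<open>soliton.entire_graph\<close>).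

For existence, a turning or crossing curve is found by prescribing the lowest point or the point on the
x-axis and following the trajectory back to its vertical tangent. The asymptotic and the entire curves are
the separatrices at the equilibrium \<open>y = s = 0\<close>. They exist because along a segment of initial data the
trajectories leave the relevant region through two different sides at the two ends; leaving through a given
side is an open condition, so some trajectory between does not leave at all (\<open>shooting\<close>).\<close>

section \<open>Real functions of one variable\<close>

lemma first_zero:
  fixes g :: "real \<Rightarrow> real"
  assumes "a < b" "\<And>t. a \<le> t \<Longrightarrow> t \<le> b \<Longrightarrow> isCont g t" "g a > 0" "g b \<le> 0"
  obtains e where "a < e" "e \<le> b" "g e = 0" "\<And>r. a \<le> r \<Longrightarrow> r < e \<Longrightarrow> g r > 0"
proof -
  define Z where "Z = {t \<in> {a..b}. g t \<le> 0}"
  have cont: "continuous_on {a..b} g"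
    using assms(2) by (auto intro!: continuous_at_imp_continuous_on)
  have "Z = {a..b} \<inter> g -` {..0}" by (auto simp: Z_def)
  then have "closed Z"
    using continuous_closed_preimage[OF cont closed_atLeastAtMost closed_atMost[of 0]] by simp
  have "b \<in> Z" using assms by (auto simp: Z_def)
  have bdd: "bdd_below Z" by (rule bdd_belowI[of _ a]) (auto simp: Z_def)
  have eZ: "Inf Z \<in> Z" using closed_contains_Inf[OF _ bdd \<open>closed Z\<close>] \<open>b \<in> Z\<close> by blast
  have pos: "g r > 0" if "a \<le> r" "r < Inf Z" for r
  proof (rule ccontr)
    assume "\<not> g r > 0"
    moreover have "Inf Z \<le> b" using eZ by (auto simp: Z_def)
    ultimately have "r \<in> Z" using that by (auto simp: Z_def)
    then have "Inf Z \<le> r" using bdd by (rule cInf_lower)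
    then show False using that by simp
  qed
  have "a < Inf Z" using eZ \<open>g a > 0\<close> by (auto simp: Z_def less_le)
  moreover have "g (Inf Z) = 0"
  proof (rule ccontr)
    assume "g (Inf Z) \<noteq> 0"
    then have "g (Inf Z) < 0" using eZ by (auto simp: Z_def)
    then obtain r where "a \<le> r" "r \<le> Inf Z" "g r = 0"
      using IVT2[of g "Inf Z" 0 a] assms eZ by (auto simp: Z_def)
    then show False using pos[of r] \<open>g (Inf Z) < 0\<close> by (cases "r = Inf Z") auto
  qed
  ultimately show ?thesis using that[of "Inf Z"] eZ pos by (auto simp: Z_def)
qed

text \<open>A function that is increasing at each of its zeros cannot return to a zero from above. This is the form in
which differential equations are used below to show that regions are invariant: only the sign of the derivative at the zeros enters.\<close>

lemma upcrossing:
  fixes g g' :: "real \<Rightarrow> real"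
  assumes "a < b"
    and der: "\<And>t. a \<le> t \<Longrightarrow> t \<le> b \<Longrightarrow> (g has_real_derivative g' t) (at t)"
    and up: "\<And>t. a \<le> t \<Longrightarrow> t \<le> b \<Longrightarrow> g t = 0 \<Longrightarrow> g' t > 0"
    and "g a \<ge> 0"
  shows "g b > 0"
proof -
  have after: "g b > 0" if q: "a \<le> q" "q < b" "g q > 0" for q
  proof (rule ccontr)
    assume "\<not> g b > 0"
    moreover have "isCont g t" if "q \<le> t" "t \<le> b" for t
      by (rule DERIV_isCont[OF der]) (use that q in auto)
    \<comment> \<open>Just before its first zero after \<open>q\<close>, the function would be negative.\<close>
    ultimately obtain e where e: "q < e" "e \<le> b" "g e = 0" "\<And>r. q \<le> r \<Longrightarrow> r < e \<Longrightarrow> g r > 0"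
      using first_zero[of q b g] q by (auto simp: not_less)
    have "\<exists>d>0. \<forall>h>0. h < d \<longrightarrow> g (e - h) < g e"
      by (rule DERIV_pos_inc_left[OF der up]) (use q e in auto)
    then obtain d where d: "d > 0" "\<And>h. 0 < h \<Longrightarrow> h < d \<Longrightarrow> g (e - h) < g e" by blast
    obtain h where h: "0 < h" "h < min d (e - q)" using dense[of 0 "min d (e - q)"] d(1) e(1) by auto
    then show False using d(2)[of h] e(3) e(4)[of "e - h"] by simp
  qed
  show ?thesis
  proof (cases "g a = 0")
    case True
    have "\<exists>d>0. \<forall>h>0. h < d \<longrightarrow> g a < g (a + h)"
      by (rule DERIV_pos_inc_right[OF der up]) (use True assms in auto)
    then obtain d where d: "d > 0" "\<And>h. 0 < h \<Longrightarrow> h < d \<Longrightarrow> g a < g (a + h)" by blast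
    obtain h where h: "0 < h" "h < min d (b - a)" using dense[of 0 "min d (b - a)"] d(1) \<open>a < b\<close> by auto
    then show ?thesis using after[of "a + h"] d(2)[of h] True by simp
  next
    case False
    then show ?thesis using after[of a] assms by simp
  qed
qed

text \<open>The bound holds in both directions of time, hence the closed segment and the absolute value.\<close>

lemma gronwall:
  fixes E E' :: "real \<Rightarrow> real"
  assumes der: "\<And>t. t \<in> closed_segment a b \<Longrightarrow> (E has_real_derivative E' t) (at t)"
    and bound: "\<And>t. t \<in> closed_segment a b \<Longrightarrow> \<bar>E' t\<bar> \<le> C * E t"
  shows "E b \<le> E a * exp (C * \<bar>b - a\<bar>)"
proof (cases "a \<le> b")
  case True
  then have seg: "closed_segment a b = {a..b}" by (simp add: closed_segment_eq_real_ivl)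
  have "E b * exp (- C * b) \<le> E a * exp (- C * a)"
  proof (rule DERIV_nonpos_imp_nonincreasing[OF True, where f="\<lambda>t. E t * exp (- C * t)"])
    fix t assume t: "a \<le> t" "t \<le> b"
    have "((\<lambda>t. E t * exp (- C * t)) has_real_derivative (E' t - C * E t) * exp (- C * t)) (at t)"
      using der[of t] t seg by (auto intro!: derivative_eq_intros simp: algebra_simps)
    moreover have "E' t - C * E t \<le> 0" using bound[of t] t seg by (simp add: abs_le_iff)
    ultimately show "\<exists>y. ((\<lambda>t. E t * exp (- C * t)) has_real_derivative y) (at t) \<and> y \<le> 0"
      by (meson exp_ge_zero mult_nonpos_nonneg)
  qed
  then have "E b * exp (- C * b) * exp (C * b) \<le> E a * exp (- C * a) * exp (C * b)"
    by (intro mult_right_mono) auto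
  then have "E b \<le> E a * (exp (- C * a) * exp (C * b))"
    by (simp add: mult.assoc flip: exp_add)
  also have "exp (- C * a) * exp (C * b) = exp (C * \<bar>b - a\<bar>)"
    using True by (simp add: algebra_simps flip: exp_add)
  finally show ?thesis .
next
  case False
  then have seg: "closed_segment a b = {b..a}" by (simp add: closed_segment_eq_real_ivl)
  have "E b * exp (C * b) \<le> E a * exp (C * a)"
  proof (rule DERIV_nonneg_imp_nondecreasing[where f="\<lambda>t. E t * exp (C * t)" and a=b and b=a])
    show "b \<le> a" using False by simp
    fix t assume t: "b \<le> t" "t \<le> a"
    have "((\<lambda>t. E t * exp (C * t)) has_real_derivative (E' t + C * E t) * exp (C * t)) (at t)"
      using der[of t] t seg by (auto intro!: derivative_eq_intros simp: algebra_simps)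
    moreover have "E' t + C * E t \<ge> 0" using bound[of t] t seg by (simp add: abs_le_iff)
    ultimately show "\<exists>y. ((\<lambda>t. E t * exp (C * t)) has_real_derivative y) (at t) \<and> y \<ge> 0"
      by (meson exp_ge_zero mult_nonneg_nonneg)
  qed
  then have "E b * exp (C * b) * exp (- C * b) \<le> E a * exp (C * a) * exp (- C * b)"
    by (intro mult_right_mono) auto
  then have "E b \<le> E a * (exp (C * a) * exp (- C * b))"
    by (simp add: mult.assoc flip: exp_add)
  also have "exp (C * a) * exp (- C * b) = exp (C * \<bar>b - a\<bar>)"
    using False by (simp add: algebra_simps flip: exp_add)
  finally show ?thesis .
qed

text \<open>Otherwise the increments of \<open>g\<close> over unit intervals, which are values of \<open>g'\<close>, would not tend to zero.\<close>

lemma tendsto_derivative_zero: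
  fixes g g' :: "real \<Rightarrow> real"
  assumes "\<And>t. (g has_real_derivative g' t) (at t)" "(g \<longlongrightarrow> a) at_top" "(g' \<longlongrightarrow> b) at_top"
  shows "b = 0"
proof -
  have "((\<lambda>t. g (t + 1) - g t) \<longlongrightarrow> a - a) at_top"
    using assms(2) filterlim_compose[OF assms(2) filterlim_tendsto_add_at_top[OF tendsto_const filterlim_ident, of 1]]
    by (intro tendsto_diff) (simp_all add: add.commute)
  moreover have "((\<lambda>t. g (t + 1) - g t) \<longlongrightarrow> b) at_top"
  proof (rule tendstoI)
    fix e :: real assume "e > 0"
    then have "\<forall>\<^sub>F t in at_top. dist (g' t) b < e" using assms(3) tendstoD by blast
    then obtain N where N: "\<And>t. t \<ge> N \<Longrightarrow> dist (g' t) b < e" by (auto simp: eventually_at_top_linorder)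
    have "dist (g (t + 1) - g t) b < e" if t: "t \<ge> N" for t
    proof -
      obtain z where "z > t" "g (t + 1) - g t = (t + 1 - t) * g' z"
        using MVT2[of t "t + 1" g g'] assms(1) by auto
      then show ?thesis using N[of z] t by simp
    qed
    then show "\<forall>\<^sub>F t in at_top. dist (g (t + 1) - g t) b < e" by (auto simp: eventually_at_top_linorder)
  qed
  ultimately show ?thesis
    using tendsto_unique[OF trivial_limit_at_top_linorder] by fastforce
qed

lemma mono_bounded_tendsto:
  fixes g :: "real \<Rightarrow> real"
  assumes "\<And>t u. a \<le> t \<Longrightarrow> t \<le> u \<Longrightarrow> g t \<le> g u" "\<And>t. a \<le> t \<Longrightarrow> g t \<le> B"
  obtains l where "(g \<longlongrightarrow> l) at_top" "\<And>t. a \<le> t \<Longrightarrow> g t \<le> l"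
proof
  have bdd: "bdd_above (g ` {a..})" using assms(2) by (intro bdd_aboveI2) auto
  show le: "g t \<le> (SUP t\<in>{a..}. g t)" if "a \<le> t" for t
    using cSUP_upper[OF _ bdd, of t] that by simp
  show "(g \<longlongrightarrow> (SUP t\<in>{a..}. g t)) at_top"
  proof (rule order_tendstoI)
    fix y assume "y < (SUP t\<in>{a..}. g t)"
    then obtain u where "u \<ge> a" "y < g u" using less_cSUP_iff[OF _ bdd, of y] by auto
    then have "y < g t" if "t \<ge> u" for t using assms(1)[of u t] that by simp
    then show "\<forall>\<^sub>F x in at_top. y < g x" by (auto simp: eventually_at_top_linorder)
  next
    fix y assume "(SUP t\<in>{a..}. g t) < y"
    then show "\<forall>\<^sub>F x in at_top. g x < y" using le
      by (auto simp: eventually_at_top_linorder intro!: exI[of _ a] intro: le_less_trans)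
  qed
qed

section \<open>Smoothness\<close>

abbreviation vderiv :: "nat \<Rightarrow> (real \<Rightarrow> 'a::real_normed_vector) \<Rightarrow> real \<Rightarrow> 'a" where
  "vderiv n f \<equiv> ((\<lambda>g u. vector_derivative g (at u)) ^^ n) f"

lemma smooth_onD:
  assumes "smooth_on S f" "t \<in> S"
  shows "(vderiv n f has_vector_derivative vderiv (Suc n) f t) (at t)"
  using assms unfolding smooth_on_def by (simp add: vector_derivative_works)

text \<open>A sequence of functions each of which is the derivative of the preceding one exhibits all derivatives at
once; it is the convenient way to enter and leave \<open>smooth_on\<close>.\<close>

lemma vderiv_tower:
  fixes F :: "nat \<Rightarrow> real \<Rightarrow> 'a::real_normed_vector"
  assumes "open S" and tower: "\<And>n t. t \<in> S \<Longrightarrow> (F n has_vector_derivative F (Suc n) t) (at t)"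
    and "t \<in> S"
  shows "vderiv n (F 0) t = F n t"
  using \<open>t \<in> S\<close>
proof (induction n arbitrary: t)
  case (Suc n)
  have "(vderiv n (F 0) has_vector_derivative F (Suc n) t) (at t)"
    using has_vector_derivative_transform_within_open[OF tower[OF Suc.prems] \<open>open S\<close> Suc.prems] Suc.IH
    by metis
  then show ?case using vector_derivative_at by simp
qed simp

lemma smooth_on_tower:
  fixes F :: "nat \<Rightarrow> real \<Rightarrow> 'a::real_normed_vector"
  assumes "open S" and tower: "\<And>n t. t \<in> S \<Longrightarrow> (F n has_vector_derivative F (Suc n) t) (at t)"
  shows "smooth_on S (F 0)"
  unfolding smooth_on_def
proof (intro allI ballI)
  fix n t assume t: "t \<in> S"
  have "(vderiv n (F 0) has_vector_derivative F (Suc n) t) (at t)"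
    using has_vector_derivative_transform_within_open[OF tower[OF t] \<open>open S\<close> t]
      vderiv_tower[of S F, OF \<open>open S\<close> tower] by metis
  then show "vderiv n (F 0) differentiable (at t)" by (rule differentiableI_vector)
qed

lemma smooth_on_linear:
  assumes "bounded_linear L" "open S" "smooth_on S f"
  shows "smooth_on S (\<lambda>t. L (f t))"
  using smooth_on_tower[OF \<open>open S\<close>, of "\<lambda>n t. L (vderiv n f t)"]
    bounded_linear.has_vector_derivative[OF assms(1) smooth_onD[OF assms(3)]] by simp

lemma smooth_on_add:
  assumes "open S" "smooth_on S f" "smooth_on S g"
  shows "smooth_on S (\<lambda>t. f t + g t)"
  using smooth_on_tower[OF \<open>open S\<close>, of "\<lambda>n t. vderiv n f t + vderiv n g t"]
    has_vector_derivative_add[OF smooth_onD[OF assms(2)] smooth_onD[OF assms(3)]] by simp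

lemma smooth_on_const: "smooth_on S (\<lambda>t. a)"
proof -
  have "vderiv n (\<lambda>t. a) = (\<lambda>t. if n = 0 then a else 0)" for n
    by (induction n) auto
  then show ?thesis unfolding smooth_on_def by simp
qed

text \<open>If the derivative of each generator is a polynomial in the generators, then the algebra is closed under
differentiation and all its elements are smooth. This gives the smoothness of solutions of polynomial
differential equations without writing down higher derivatives.\<close>

inductive_set polynomials_in :: "(real \<Rightarrow> real) set \<Rightarrow> (real \<Rightarrow> real) set" for G where
  pol_const: "(\<lambda>t. a) \<in> polynomials_in G"
| pol_gen: "g \<in> G \<Longrightarrow> g \<in> polynomials_in G"
| pol_add: "f \<in> polynomials_in G \<Longrightarrow> g \<in> polynomials_in G \<Longrightarrow> (\<lambda>t. f t + g t) \<in> polynomials_in G"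
| pol_mult: "f \<in> polynomials_in G \<Longrightarrow> g \<in> polynomials_in G \<Longrightarrow> (\<lambda>t. f t * g t) \<in> polynomials_in G"

lemma pol_minus: "f \<in> polynomials_in G \<Longrightarrow> (\<lambda>t. - f t) \<in> polynomials_in G"
  using pol_mult[OF pol_const[of "-1"]] by fastforce

lemma pol_diff: "f \<in> polynomials_in G \<Longrightarrow> g \<in> polynomials_in G \<Longrightarrow> (\<lambda>t. f t - g t) \<in> polynomials_in G"
  using pol_add[OF _ pol_minus] by fastforce

lemma pol_power: "f \<in> polynomials_in G \<Longrightarrow> (\<lambda>t. f t ^ n) \<in> polynomials_in G"
proof (induction n)
  case (Suc n)
  then show ?case using pol_mult[of f G "\<lambda>t. f t ^ n"] by simp
qed (simp add: pol_const)

lemma polynomials_in_deriv: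
  assumes gen: "\<And>g. g \<in> G \<Longrightarrow> \<exists>h\<in>polynomials_in G. \<forall>t\<in>S. (g has_real_derivative h t) (at t)"
    and "f \<in> polynomials_in G"
  shows "\<exists>h\<in>polynomials_in G. \<forall>t\<in>S. (f has_real_derivative h t) (at t)"
  using assms(2)
proof induction
  case (pol_const a)
  show ?case by (rule bexI[of _ "\<lambda>t. 0"]) (auto intro: polynomials_in.pol_const)
next
  case (pol_gen g) then show ?case by (rule gen)
next
  case (pol_add f g)
  then obtain f' g' where *: "f' \<in> polynomials_in G" "g' \<in> polynomials_in G"
    "\<forall>t\<in>S. (f has_real_derivative f' t) (at t)" "\<forall>t\<in>S. (g has_real_derivative g' t) (at t)"
    by blast
  then show ?case
    by (intro bexI[of _ "\<lambda>t. f' t + g' t"]) (auto intro!: DERIV_add polynomials_in.pol_add)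
next
  case (pol_mult f g)
  then obtain f' g' where *: "f' \<in> polynomials_in G" "g' \<in> polynomials_in G"
    "\<forall>t\<in>S. (f has_real_derivative f' t) (at t)" "\<forall>t\<in>S. (g has_real_derivative g' t) (at t)"
    by blast
  then show ?case using pol_mult.hyps
    by (intro bexI[of _ "\<lambda>t. f' t * g t + g' t * f t"])
       (auto intro!: DERIV_mult polynomials_in.pol_add polynomials_in.pol_mult)
qed

lemma polynomials_in_smooth:
  assumes "open S"
    and gen: "\<And>g. g \<in> G \<Longrightarrow> \<exists>h\<in>polynomials_in G. \<forall>t\<in>S. (g has_real_derivative h t) (at t)"
    and f: "f \<in> polynomials_in G"
  shows "smooth_on S f"
proof -
  obtain d where d: "\<And>f. f \<in> polynomials_in G \<Longrightarrow> d f \<in> polynomials_in G"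
    "\<And>f t. f \<in> polynomials_in G \<Longrightarrow> t \<in> S \<Longrightarrow> (f has_real_derivative d f t) (at t)"
    using polynomials_in_deriv[OF gen] by metis
  have mem: "(d ^^ n) f \<in> polynomials_in G" for n
    by (induction n) (auto intro: f d(1))
  have "smooth_on S ((d ^^ 0) f)"
    by (rule smooth_on_tower[OF \<open>open S\<close>, of "\<lambda>n. (d ^^ n) f"])
       (use d(2)[OF mem] in \<open>simp flip: has_real_derivative_iff_has_vector_derivative\<close>)
  then show ?thesis by simp
qed

lemma vector2_axis: "(vector [a, b] :: real^2) = a *\<^sub>R axis 1 1 + b *\<^sub>R axis 2 1"
  by (simp add: vec_eq_iff forall_2 axis_def)

lemma vec2_eqI: "p $ 1 = q $ 1 \<Longrightarrow> p $ 2 = q $ 2 \<Longrightarrow> p = (q :: real^2)"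
  by (simp add: vec_eq_iff forall_2)

lemma smooth_on_vector2:
  assumes "open S" "smooth_on S x" "smooth_on S y"
  shows "smooth_on S (\<lambda>t. vector [x t, y t] :: real^2)"
  unfolding vector2_axis
  using assms by (intro smooth_on_add smooth_on_linear[OF bounded_linear_scaleR_left])

lemma has_vector_derivative_vector2:
  assumes "(x has_real_derivative x') (at t)" "(y has_real_derivative y') (at t)"
  shows "((\<lambda>t. vector [x t, y t] :: real^2) has_vector_derivative vector [x', y']) (at t)"
  unfolding vector2_axis using assms
  by (auto intro!: derivative_eq_intros simp: has_real_derivative_iff_has_vector_derivative)

lemma has_vector_derivative_vec_nth:
  fixes Y :: "real \<Rightarrow> real^'n"
  assumes "(Y has_vector_derivative Y') (at t)"
  shows "((\<lambda>t. Y t $ i) has_real_derivative Y' $ i) (at t)"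
  using bounded_linear.has_vector_derivative[OF bounded_linear_vec_nth assms]
  by (simp add: has_real_derivative_iff_has_vector_derivative)

section \<open>The equation in coordinates\<close>

lemma norm_vec2: "norm (a :: real^2) = sqrt ((a $ 1)\<^sup>2 + (a $ 2)\<^sup>2)"
  by (simp add: norm_vec_def L2_set_def sum_2)

text \<open>Both sides are multiplied by the speed and cubed, which is harmless because the real cube root is
bijective. What results is polynomial in the coordinates and no longer contains the speed. Here \<open>q\<close>, \<open>a\<close> and \<open>b\<close>
stand for the position and its first two derivatives.\<close>

lemma soliton_equation_iff:
  fixes a b q :: "real^2"
  assumes "a \<noteq> 0"
  shows "((vector [vector [0, 0], vector [0, 1]] :: real^2^2) *v q + vector [1, 0])
           \<bullet> (rot90 *v (a /\<^sub>R norm a)) = root 3 (det (transpose (vector [a, b]) :: real^2^2) / norm a ^ 3)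
         \<longleftrightarrow> a$1 * b$2 - a$2 * b$1 = (q$2 * a$1 - a$2) ^ 3"
proof -
  have n: "norm a > 0" using assms by simp
  have lhs: "((vector [vector [0, 0], vector [0, 1]] :: real^2^2) *v q + vector [1, 0])
           \<bullet> (rot90 *v (a /\<^sub>R norm a)) = (q$2 * a$1 - a$2) / norm a"
    using n by (simp add: rot90_def matrix_vector_mult_def inner_vec_def sum_2 field_simps)
  have "det (transpose (vector [a, b]) :: real^2^2) = a$1 * b$2 - a$2 * b$1"
    by (simp add: det_2 transpose_def algebra_simps)
  moreover have "r = root 3 w \<longleftrightarrow> r ^ 3 = w" for r w :: real
    using odd_real_root_unique[of 3 r w] odd_real_root_pow[of 3 w] by auto
  ultimately show ?thesis using n lhs by (auto simp: power_divide)
qed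

definition soliton_at :: "(real \<Rightarrow> real^2) \<Rightarrow> real \<Rightarrow> bool" where
  "soliton_at Y u \<longleftrightarrow> vderiv 1 Y u \<noteq> 0 \<and>
     vderiv 1 Y u $ 1 * vderiv 2 Y u $ 2 - vderiv 1 Y u $ 2 * vderiv 2 Y u $ 1
       = (Y u $ 2 * vderiv 1 Y u $ 1 - vderiv 1 Y u $ 2) ^ 3"

lemma solution_iff:
  "solution I Y \<longleftrightarrow> open I \<and> is_interval I \<and> I \<noteq> {} \<and> smooth_on I Y \<and> (\<forall>u\<in>I. soliton_at Y u)"
proof -
  have "(vector_derivative Y (at u) \<noteq> 0 \<and>
      ((vector [vector [0, 0], vector [0, 1]] :: real^2^2) *v Y u + vector [1, 0])
              \<bullet> unit_normal Y u = root 3 (curvature Y u)) \<longleftrightarrow> soliton_at Y u" for u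
  proof (cases "vector_derivative Y (at u) = 0")
    case True
    then show ?thesis by (simp add: soliton_at_def)
  next
    case False
    show ?thesis
      using soliton_equation_iff[OF False, of "Y u" "vector_derivative (\<lambda>t. vector_derivative Y (at t)) (at u)"] False
      by (simp add: soliton_at_def unit_normal_def unit_tangent_def curvature_def Let_def numeral_2_eq_2)
  qed
  then show ?thesis unfolding solution_def immersed_curve_def by blast
qed

section \<open>Global existence for an ordinary differential equation\<close>

text \<open>The derivative of \<open>exp (P t) / 2\<close> is \<open>L t * exp (P t)\<close>, so this is the comparison of \<open>A\<close> with a multiple of
\<open>exp (P t) / 2\<close>. The factor \<open>1/2\<close> makes the Picard operator below a contraction.\<close>

lemma weighted_bound:
  fixes A :: "real \<Rightarrow> 'a::real_normed_vector"
  assumes der: "\<And>t. (A has_vector_derivative h t) (at t)" and "A 0 = 0" and "K \<ge> 0"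
    and P: "\<And>t. t \<ge> 0 \<Longrightarrow> (P has_real_derivative 2 * L t) (at t)"
    and bnd: "\<And>t. norm (h t) \<le> K * (L \<bar>t\<bar> * exp (P \<bar>t\<bar>))"
  shows "norm (A t) \<le> K / 2 * exp (P \<bar>t\<bar>)"
proof -
  have pos: "norm (B r) \<le> K / 2 * exp (P r)"
    if B: "\<And>t. (B has_vector_derivative k t) (at t)" "B 0 = 0" "\<And>t. norm (k t) \<le> K * (L \<bar>t\<bar> * exp (P \<bar>t\<bar>))"
      and r: "r > 0" for B :: "real \<Rightarrow> 'a" and k r
  proof -
    have W: "((\<lambda>t. K / 2 * exp (P t)) has_real_derivative K * (L t * exp (P t))) (at t)" if "t \<ge> 0" for t
      by (rule derivative_eq_intros P that refl | simp)+
    have "norm (B r - B 0) \<le> K / 2 * exp (P r) - K / 2 * exp (P 0)"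
    proof (rule differentiable_bound_general[OF r, where f' = k])
      show "continuous_on {0..r} B"
        using B(1) by (intro continuous_at_imp_continuous_on ballI) (rule has_vector_derivative_continuous)
      show "continuous_on {0..r} (\<lambda>t. K / 2 * exp (P t))"
        using W by (intro continuous_at_imp_continuous_on ballI) (auto intro: DERIV_isCont)
      fix t assume "0 < t" "t < r"
      then show "((\<lambda>t. K / 2 * exp (P t)) has_vector_derivative K * (L t * exp (P t))) (at t)"
        using W[of t] by (simp add: has_real_derivative_iff_has_vector_derivative)
      show "norm (k t) \<le> K * (L t * exp (P t))" using B(3)[of t] \<open>0 < t\<close> by simp
    qed (use B in auto)
    moreover have "K / 2 * exp (P 0) \<ge> 0" using \<open>K \<ge> 0\<close> by simp
    ultimately show ?thesis using B(2) by simp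
  qed
  consider "t > 0" | "t = 0" | "t < 0" by linarith
  then show ?thesis
  proof cases
    case 1
    then show ?thesis using pos[OF der \<open>A 0 = 0\<close> bnd 1] by simp
  next
    case 2
    then show ?thesis using assms by simp
  next
    case 3
    have "((\<lambda>t. A (- t)) has_vector_derivative - h (- t)) (at t)" for t
      using vector_diff_chain_at[of uminus "-1" t A "h (- t)"] der[of "- t"]
      by (simp add: o_def has_vector_derivative_minus[OF has_vector_derivative_id, simplified])
    from pos[of "\<lambda>t. A (- t)", OF this, of "- t"] show ?thesis using 3 \<open>A 0 = 0\<close> bnd[of "- _"] by simp
  qed
qed

lemma antiderivative_real:
  fixes h :: "real \<Rightarrow> 'a::euclidean_space"
  assumes "continuous_on UNIV h"
  obtains A where "\<And>t. (A has_vector_derivative h t) (at t)" "A 0 = 0"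
proof -
  obtain F where F: "\<And>t. (F has_vector_derivative h t) (at t)"
    using einterval_antiderivative[of "-\<infinity>" "\<infinity>" h] assms by (auto simp: continuous_on_eq_continuous_at)
  have "((\<lambda>t. F t - F 0) has_vector_derivative h t) (at t)" for t
    using F[of t] by (auto intro!: derivative_eq_intros)
  from that[OF this] show ?thesis by simp
qed

text \<open>Picard iteration converges globally if the growth of the solutions is put into the norm: in terms of
\<open>v = (z - z0) / exp (P \<bar>t\<bar>)\<close> the integral operator is a contraction with factor \<open>1/2\<close> of the space of bounded
continuous functions on the whole real line. The Lipschitz constant of the field may grow with time.\<close>

lemma ode_global_existence:
  fixes G :: "real \<Rightarrow> 'a::euclidean_space \<Rightarrow> 'a"
  assumes cont: "\<And>z. continuous_on UNIV z \<Longrightarrow> continuous_on UNIV (\<lambda>t. G t (z t))"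
    and P: "\<And>t. t \<ge> 0 \<Longrightarrow> (P has_real_derivative 2 * L t) (at t)" "\<And>t. t \<ge> 0 \<Longrightarrow> P t \<ge> 0"
    and lip: "\<And>t u v. norm (G t u - G t v) \<le> L \<bar>t\<bar> * norm (u - v)"
    and base: "\<And>t. norm (G t z0) \<le> L \<bar>t\<bar>"
  obtains z where "\<And>t. (z has_vector_derivative G t (z t)) (at t)" "z 0 = z0"
proof -
  define W where "W t = exp (P \<bar>t\<bar>)" for t
  have L0: "L \<bar>t\<bar> \<ge> 0" for t using base[of t] norm_ge_zero order_trans by blast
  have W1: "W t \<ge> 1" for t using P(2)[of "\<bar>t\<bar>"] by (simp add: W_def)
  have contW: "continuous_on UNIV W"
  proof -
    have "isCont P \<bar>t\<bar>" for t using P(1)[of "\<bar>t\<bar>"] DERIV_isCont by simp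
    then have "isCont (\<lambda>t. P \<bar>t\<bar>) t" for t
      using isCont_o2[OF continuous_rabs[OF continuous_ident]] by blast
    then show ?thesis unfolding W_def
      by (intro continuous_at_imp_continuous_on ballI isCont_exp') auto
  qed
  define h where "h v t = G t (z0 + W t *\<^sub>R apply_bcontfun v t)" for v :: "real \<Rightarrow>\<^sub>C 'a" and t
  have conth: "continuous_on UNIV (h v)" for v
    unfolding h_def by (intro cont continuous_intros contW) auto
  have "\<exists>A. (\<forall>t. (A has_vector_derivative h v t) (at t)) \<and> A 0 = 0" for v
    using antiderivative_real[OF conth[of v]] by metis
  then obtain A where A: "\<And>v t. (A v has_vector_derivative h v t) (at t)" "\<And>v. A v 0 = 0"
    by metis
  \<comment> \<open>The contraction estimate, and below it the bound that keeps the operator inside the space.\<close>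
  have diff: "norm (A v t - A u t) \<le> dist v u / 2 * W t" for v u t
    unfolding W_def
  proof (rule weighted_bound[where A = "\<lambda>t. A v t - A u t" and h = "\<lambda>t. h v t - h u t" and L = L])
    fix t
    have "norm (h v t - h u t) \<le> L \<bar>t\<bar> * norm (W t *\<^sub>R (apply_bcontfun v t - apply_bcontfun u t))"
      unfolding h_def using lip[of t "z0 + W t *\<^sub>R v t" "z0 + W t *\<^sub>R u t"] by (simp add: scaleR_diff_right)
    also have "norm (W t *\<^sub>R (apply_bcontfun v t - apply_bcontfun u t)) = W t * dist (v t) (u t)"
      using W1[of t] by (simp add: dist_norm)
    also have "L \<bar>t\<bar> * \<dots> \<le> L \<bar>t\<bar> * (W t * dist v u)"
      using W1[of t] L0 by (intro mult_left_mono dist_bounded) auto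
    finally show "norm (h v t - h u t) \<le> dist v u * (L \<bar>t\<bar> * exp (P \<bar>t\<bar>))"
      by (simp add: W_def mult_ac)
  qed (auto intro!: derivative_intros A simp: A P)
  have size: "norm (A v t) \<le> (1 + norm v) / 2 * W t" for v t
    unfolding W_def
  proof (rule weighted_bound[where A = "A v" and h = "h v" and L = L])
    fix t
    have "norm (h v t) \<le> norm (G t z0) + norm (h v t - G t z0)" by (rule norm_triangle_sub)
    also have "\<dots> \<le> L \<bar>t\<bar> + L \<bar>t\<bar> * (W t * norm v)"
    proof (intro add_mono base)
      have "norm (h v t - G t z0) \<le> L \<bar>t\<bar> * norm (W t *\<^sub>R apply_bcontfun v t)"
        unfolding h_def using lip[of t "z0 + W t *\<^sub>R v t" z0] by simp
      also have "\<dots> \<le> L \<bar>t\<bar> * (W t * norm v)"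
        using W1[of t] L0 norm_bounded[of v t] by (intro mult_left_mono) auto
      finally show "norm (h v t - G t z0) \<le> L \<bar>t\<bar> * (W t * norm v)" .
    qed
    also have "\<dots> \<le> L \<bar>t\<bar> * W t + L \<bar>t\<bar> * (W t * norm v)"
      using mult_left_mono[OF W1[of t] L0[of t]] by simp
    finally show "norm (h v t) \<le> (1 + norm v) * (L \<bar>t\<bar> * exp (P \<bar>t\<bar>))"
      by (simp add: W_def algebra_simps)
  qed (auto simp: A P)
  have contA: "continuous_on UNIV (A v)" for v
    using A(1) by (intro continuous_at_imp_continuous_on ballI) (rule has_vector_derivative_continuous)
  have bc: "(\<lambda>t. A v t /\<^sub>R W t) \<in> bcontfun" for v
  proof (rule bcontfun_normI)
    show "continuous_on UNIV (\<lambda>t. A v t /\<^sub>R W t)"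
      using W1 by (intro continuous_intros contA contW) (metis less_numeral_extra(1) not_one_le_zero)
    show "norm (A v t /\<^sub>R W t) \<le> (1 + norm v) / 2" for t
      using size[of v t] W1[of t] by (simp add: field_simps)
  qed
  define T where "T v = Bcontfun (\<lambda>t. A v t /\<^sub>R W t)" for v
  have T: "apply_bcontfun (T v) t = A v t /\<^sub>R W t" for v t
    using bc by (simp add: T_def Bcontfun_inverse)
  have "\<exists>!v. T v = v"
  proof (rule banach_fix_type[of "1/2"])
    show "\<forall>v u. dist (T v) (T u) \<le> 1 / 2 * dist v u"
    proof (intro allI dist_bound)
      fix v u t
      have "dist (T v t) (T u t) = norm (A v t - A u t) / W t"
        using W1[of t] by (simp add: T dist_norm divide_inverse mult.commute flip: scaleR_diff_right)
      also have "\<dots> \<le> 1 / 2 * dist v u" using diff[of v t u] W1[of t] by (simp add: field_simps)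
      finally show "dist (T v t) (T u t) \<le> 1 / 2 * dist v u" .
    qed
  qed auto
  then obtain v where v: "T v = v" by blast
  have AW: "A v t = W t *\<^sub>R v t" for t using T[of v t] W1[of t] v by simp
  show ?thesis
  proof (rule that[of "\<lambda>t. z0 + A v t"])
    show "((\<lambda>t. z0 + A v t) has_vector_derivative G t (z0 + A v t)) (at t)" for t
      using A(1)[of v t] unfolding h_def AW[symmetric] by (auto intro!: derivative_eq_intros)
  qed (simp add: A)
qed

section \<open>Unit speed solutions\<close>

text \<open>The solutions parametrized by arclength: \<open>(c, s)\<close> is the unit tangent and \<open>(y c - s)^3\<close> the curvature. Using the
tangent rather than its angle keeps the equations polynomial and makes them symmetric under a change of
orientation.\<close>

locale soliton =
  fixes x y c s :: "real \<Rightarrow> real"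
  assumes dx: "(x has_real_derivative c t) (at t)"
    and dy: "(y has_real_derivative s t) (at t)"
    and dc: "(c has_real_derivative - ((y t * c t - s t) ^ 3 * s t)) (at t)"
    and ds: "(s has_real_derivative (y t * c t - s t) ^ 3 * c t) (at t)"
    and unit: "(c t)\<^sup>2 + (s t)\<^sup>2 = 1"

lemma cube_diff_bound:
  fixes a b m :: real
  assumes "\<bar>a\<bar> \<le> m" "\<bar>b\<bar> \<le> m"
  shows "\<bar>a ^ 3 - b ^ 3\<bar> \<le> 3 * m\<^sup>2 * \<bar>a - b\<bar>"
proof -
  have sq: "a\<^sup>2 \<le> m\<^sup>2" "b\<^sup>2 \<le> m\<^sup>2" using assms by (auto simp: abs_le_square_iff[symmetric])
  have "\<bar>a * b\<bar> \<le> m\<^sup>2" using mult_mono[OF assms] assms(1) by (simp add: abs_mult power2_eq_square)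
  then have "\<bar>a\<^sup>2 + a * b + b\<^sup>2\<bar> \<le> 3 * m\<^sup>2" using sq by (simp add: abs_le_iff) (smt (verit) zero_le_power2)
  then have "\<bar>a - b\<bar> * \<bar>a\<^sup>2 + a * b + b\<^sup>2\<bar> \<le> \<bar>a - b\<bar> * (3 * m\<^sup>2)" by (intro mult_left_mono) auto
  moreover have "a ^ 3 - b ^ 3 = (a - b) * (a\<^sup>2 + a * b + b\<^sup>2)" by algebra
  ultimately show ?thesis by (simp add: abs_mult mult.commute)
qed

lemma sin_cos_lipschitz: "\<bar>sin a - sin b\<bar> \<le> \<bar>a - b\<bar>" "\<bar>cos a - cos b\<bar> \<le> \<bar>a - b\<bar>" for a b :: real
proof -
  show "\<bar>sin a - sin b\<bar> \<le> \<bar>a - b\<bar>"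
    using field_differentiable_bound[of UNIV sin cos 1 a b] by (auto intro: derivative_intros)
  show "\<bar>cos a - cos b\<bar> \<le> \<bar>a - b\<bar>"
    using field_differentiable_bound[of UNIV cos "\<lambda>x. - sin x" 1 a b] by (auto intro!: derivative_eq_intros)
qed

text \<open>The field is cubic in \<open>y\<close>, hence not globally Lipschitz. Cutting \<open>y\<close> off at the height it can reach by time
\<open>t\<close>, which is at most its initial height plus \<open>\<bar>t\<bar>\<close>, does not change the solution.\<close>

definition clamped :: "real \<Rightarrow> real \<Rightarrow> real" where
  "clamped r w = max (- r) (min r w)"

lemma clamped_lipschitz: "\<bar>clamped r u - clamped r v\<bar> \<le> \<bar>u - v\<bar>"
  by (auto simp: clamped_def max_def min_def abs_if)

lemma clamped_bound: "r \<ge> 0 \<Longrightarrow> \<bar>clamped r u\<bar> \<le> r"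
  by (auto simp: clamped_def max_def min_def abs_if)

lemma clamped_field_lipschitz:
  fixes B y1 y2 t1 t2 n :: real
  assumes B: "B \<ge> 0" and n: "\<bar>y1 - y2\<bar> \<le> n" "\<bar>t1 - t2\<bar> \<le> n"
  shows "\<bar>(clamped B y1 * cos t1 - sin t1) ^ 3 - (clamped B y2 * cos t2 - sin t2) ^ 3\<bar> \<le> 6 * (B + 1) ^ 3 * n"
proof -
  define a where "a = clamped B y1 * cos t1 - sin t1"
  define b where "b = clamped B y2 * cos t2 - sin t2"
  have bnd: "\<bar>clamped B y * cos t - sin t\<bar> \<le> B + 1" for y t
  proof -
    have "\<bar>clamped B y * cos t\<bar> \<le> B * 1" unfolding abs_mult
      by (intro mult_mono clamped_bound) (use B in auto)
    then show ?thesis using abs_sin_le_one[of t] by linarith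
  qed
  have "a - b = (clamped B y1 - clamped B y2) * cos t1 + clamped B y2 * (cos t1 - cos t2) - (sin t1 - sin t2)"
    by (simp add: a_def b_def algebra_simps)
  then have "\<bar>a - b\<bar> \<le> \<bar>clamped B y1 - clamped B y2\<bar> * \<bar>cos t1\<bar> + \<bar>clamped B y2\<bar> * \<bar>cos t1 - cos t2\<bar> + \<bar>sin t1 - sin t2\<bar>"
    by (simp flip: abs_mult)
  also have "\<dots> \<le> n * 1 + B * n + n"
    by (intro add_mono mult_mono clamped_bound)
       (use B n clamped_lipschitz[of B y1 y2] sin_cos_lipschitz[of t1 t2] in auto)
  also have "\<dots> \<le> 2 * (B + 1) * n" using B n by (simp add: algebra_simps)
  finally have ab: "\<bar>a - b\<bar> \<le> 2 * (B + 1) * n" .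
  have "\<bar>a ^ 3 - b ^ 3\<bar> \<le> 3 * (B + 1)\<^sup>2 * \<bar>a - b\<bar>"
    unfolding a_def b_def by (intro cube_diff_bound bnd)
  also have "\<dots> \<le> 3 * (B + 1)\<^sup>2 * (2 * (B + 1) * n)"
    by (intro mult_left_mono ab) auto
  also have "\<dots> = 6 * (B + 1) ^ 3 * n" by (simp add: power2_eq_square power3_eq_cube)
  finally show ?thesis unfolding a_def b_def .
qed

text \<open>The existence theorem is applied to the height and the angle \<open>\<theta>\<close> of the tangent, with a Lipschitz constant that
is cubic in the cutoff height.\<close>

lemma clamped_angle_flow:
  fixes y0 \<theta>0 :: real
  obtains y \<theta> where "\<And>t. (y has_real_derivative sin (\<theta> t)) (at t)"
    "\<And>t. (\<theta> has_real_derivative (clamped (\<bar>y0\<bar> + \<bar>t\<bar>) (y t) * cos (\<theta> t) - sin (\<theta> t)) ^ 3) (at t)"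
    "y 0 = y0" "\<theta> 0 = \<theta>0"
proof -
  define K where "K t w = (clamped (\<bar>y0\<bar> + \<bar>t\<bar>) (fst w) * cos (snd w) - sin (snd w)) ^ 3" for t w
  define G where "G t w = (sin (snd w), K t w)" for t :: real and w :: "real \<times> real"
  \<comment> \<open>The cube contributes 6 to the factor 7, and the sine contributes 1.\<close>
  define L where "L t = 7 * (\<bar>y0\<bar> + t + 1) ^ 3" for t
  define P where "P t = 7 / 2 * (\<bar>y0\<bar> + t + 1) ^ 4" for t :: real
  obtain z where z: "\<And>t. (z has_vector_derivative G t (z t)) (at t)" "z 0 = (y0, \<theta>0)"
  proof (rule ode_global_existence[of G P L "(y0, \<theta>0)"])
    show "continuous_on UNIV (\<lambda>t. G t (z t))" if "continuous_on UNIV z" for z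
      unfolding G_def K_def clamped_def using that by (intro continuous_intros)
    show "(P has_real_derivative 2 * L t) (at t)" for t
      unfolding P_def L_def by (auto intro!: derivative_eq_intros)
    show "P t \<ge> 0" if "t \<ge> 0" for t using that by (simp add: P_def)
    show "norm (G t u - G t v) \<le> L \<bar>t\<bar> * norm (u - v)" for t u v
    proof -
      define B where "B = \<bar>y0\<bar> + \<bar>t\<bar>"
      have B: "B \<ge> 0" by (simp add: B_def)
      have n: "\<bar>fst u - fst v\<bar> \<le> norm (u - v)" "\<bar>snd u - snd v\<bar> \<le> norm (u - v)"
        using norm_fst_le[of "fst u - fst v" "snd u - snd v"] norm_snd_le[of "snd u - snd v" "fst u - fst v"]
        by (simp_all add: minus_prod_def)
      have "norm (G t u - G t v) \<le> \<bar>sin (snd u) - sin (snd v)\<bar> + \<bar>K t u - K t v\<bar>"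
        unfolding G_def using norm_Pair_le by (metis diff_Pair real_norm_def)
      also have "\<dots> \<le> norm (u - v) + 6 * (B + 1) ^ 3 * norm (u - v)"
        using sin_cos_lipschitz(1)[of "snd u" "snd v"] n clamped_field_lipschitz[OF B n]
        unfolding K_def B_def by (intro add_mono) auto
      also have "\<dots> \<le> (B + 1) ^ 3 * norm (u - v) + 6 * (B + 1) ^ 3 * norm (u - v)"
        using B one_le_power[of "B + 1" 3] mult_right_mono[of 1 "(B + 1) ^ 3" "norm (u - v)"] by (simp add: mult.commute)
      also have "\<dots> = L \<bar>t\<bar> * norm (u - v)" by (simp add: L_def B_def algebra_simps)
      finally show ?thesis .
    qed
    show "norm (G t (y0, \<theta>0)) \<le> L \<bar>t\<bar>" for t
    proof -
      define B where "B = \<bar>y0\<bar> + \<bar>t\<bar>"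
      have B: "B \<ge> 0" by (simp add: B_def)
      have "\<bar>clamped B y0 * cos \<theta>0\<bar> \<le> B * 1" unfolding abs_mult
        by (intro mult_mono clamped_bound) (use B in auto)
      then have "\<bar>clamped B y0 * cos \<theta>0 - sin \<theta>0\<bar> \<le> B + 1" using abs_sin_le_one[of \<theta>0] by linarith
      then have "\<bar>K t (y0, \<theta>0)\<bar> \<le> (B + 1) ^ 3"
        unfolding K_def B_def by (simp add: power_abs power_mono)
      moreover have "norm (G t (y0, \<theta>0)) \<le> \<bar>sin \<theta>0\<bar> + \<bar>K t (y0, \<theta>0)\<bar>"
        unfolding G_def using norm_Pair_le by (metis real_norm_def snd_conv)
      ultimately have "norm (G t (y0, \<theta>0)) \<le> 1 + (B + 1) ^ 3" using abs_sin_le_one[of \<theta>0] by linarith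
      also have "\<dots> \<le> 7 * (B + 1) ^ 3" using one_le_power[of "B + 1" 3] B by linarith
      finally show ?thesis by (simp add: L_def B_def add_ac)
    qed
  qed blast
  have zy: "((\<lambda>t. fst (z t)) has_real_derivative sin (snd (z t))) (at t)" for t
    using bounded_linear.has_vector_derivative[OF bounded_linear_fst z(1)[of t]]
    by (simp add: has_real_derivative_iff_has_vector_derivative G_def)
  have zt: "((\<lambda>t. snd (z t)) has_real_derivative K t (z t)) (at t)" for t
    using bounded_linear.has_vector_derivative[OF bounded_linear_snd z(1)[of t]]
    by (simp add: has_real_derivative_iff_has_vector_derivative G_def)
  show ?thesis by (rule that[OF zy zt[unfolded K_def]]) (simp_all add: z)
qed

theorem soliton_exists:
  fixes x0 y0 c0 s0 :: real
  assumes "c0\<^sup>2 + s0\<^sup>2 = 1"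
  obtains x y c s where "soliton x y c s" "x 0 = x0" "y 0 = y0" "c 0 = c0" "s 0 = s0"
proof -
  obtain \<theta>0 where \<theta>0: "c0 = cos \<theta>0" "s0 = sin \<theta>0"
    using sincos_total_2pi[OF assms] by metis
  obtain y \<theta> where dy: "\<And>t. (y has_real_derivative sin (\<theta> t)) (at t)"
    and d\<theta>: "\<And>t. (\<theta> has_real_derivative (clamped (\<bar>y0\<bar> + \<bar>t\<bar>) (y t) * cos (\<theta> t) - sin (\<theta> t)) ^ 3) (at t)"
    and init: "y 0 = y0" "\<theta> 0 = \<theta>0"
    using clamped_angle_flow by blast
  have "\<bar>y t - y 0\<bar> \<le> 1 * \<bar>t - 0\<bar>" for t
    using field_differentiable_bound[of UNIV y "\<lambda>t. sin (\<theta> t)" 1 t 0] dy by (simp add: has_field_derivative_at_within)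
  then have "\<bar>y t\<bar> \<le> \<bar>y0\<bar> + \<bar>t\<bar>" for t using init by (smt (verit))
  then have "clamped (\<bar>y0\<bar> + \<bar>t\<bar>) (y t) = y t" for t
    by (auto simp: clamped_def max_def min_def abs_le_iff) (smt (verit))+
  then have d\<theta>: "(\<theta> has_real_derivative (y t * cos (\<theta> t) - sin (\<theta> t)) ^ 3) (at t)" for t
    using d\<theta>[of t] by simp
  have "continuous_on UNIV \<theta>"
    using d\<theta> by (intro continuous_at_imp_continuous_on ballI) (rule DERIV_isCont)
  then have "continuous_on UNIV (\<lambda>t. cos (\<theta> t))" by (intro continuous_intros)
  then obtain A where A: "\<And>t. (A has_vector_derivative cos (\<theta> t)) (at t)" "A 0 = 0"
    by (rule antiderivative_real) blast
  have "soliton (\<lambda>t. x0 + A t) y (\<lambda>t. cos (\<theta> t)) (\<lambda>t. sin (\<theta> t))"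
  proof
    fix t
    show "((\<lambda>t. x0 + A t) has_real_derivative cos (\<theta> t)) (at t)"
      using A(1)[of t] by (auto intro!: derivative_eq_intros simp flip: has_real_derivative_iff_has_vector_derivative)
    show "((\<lambda>t. cos (\<theta> t)) has_real_derivative - ((y t * cos (\<theta> t) - sin (\<theta> t)) ^ 3 * sin (\<theta> t))) (at t)"
      by (rule derivative_eq_intros d\<theta> refl | simp)+
    show "((\<lambda>t. sin (\<theta> t)) has_real_derivative (y t * cos (\<theta> t) - sin (\<theta> t)) ^ 3 * cos (\<theta> t)) (at t)"
      by (rule derivative_eq_intros d\<theta> refl | simp)+
  qed (auto simp: dy)
  then show ?thesis using that A init \<theta>0 by simp
qed

section \<open>Uniqueness and dependence on initial data\<close>

text \<open>The equations of a solution traversed with speed \<open>\<sigma>\<close>. Solutions in their given parametrization can thus be compared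
with trajectories parametrized by arclength.\<close>

definition moving_frame ::
    "(real \<Rightarrow> real) \<Rightarrow> (real \<Rightarrow> real) \<Rightarrow> (real \<Rightarrow> real) \<Rightarrow> (real \<Rightarrow> real) \<Rightarrow> real \<Rightarrow> bool" where
  "moving_frame \<sigma> y c s t \<longleftrightarrow> (y has_real_derivative \<sigma> t * s t) (at t) \<and>
     (c has_real_derivative - (\<sigma> t * ((y t * c t - s t) ^ 3 * s t))) (at t) \<and>
     (s has_real_derivative \<sigma> t * ((y t * c t - s t) ^ 3 * c t)) (at t) \<and> (c t)\<^sup>2 + (s t)\<^sup>2 = 1"

text \<open>In the derivative of the squared distance \<open>E\<close> the curvature itself drops out, because it only rotates the
tangent; what remains is the difference of the curvatures, which is Lipschitz in the data as long as \<open>y\<close> is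
bounded.\<close>

lemma frame_gronwall:
  fixes \<sigma> y1 c1 s1 y2 c2 s2 :: "real \<Rightarrow> real"
  defines "E \<equiv> \<lambda>t. (y1 t - y2 t)\<^sup>2 + (c1 t - c2 t)\<^sup>2 + (s1 t - s2 t)\<^sup>2"
  assumes frame: "\<And>t. t \<in> closed_segment a b \<Longrightarrow> moving_frame \<sigma> y1 c1 s1 t"
      "\<And>t. t \<in> closed_segment a b \<Longrightarrow> moving_frame \<sigma> y2 c2 s2 t"
    and height: "\<And>t. t \<in> closed_segment a b \<Longrightarrow> \<bar>y1 t\<bar> \<le> M" "\<And>t. t \<in> closed_segment a b \<Longrightarrow> \<bar>y2 t\<bar> \<le> M"
    and \<sigma>: "\<And>t. t \<in> closed_segment a b \<Longrightarrow> \<bar>\<sigma> t\<bar> \<le> S"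
  shows "E b \<le> E a * exp (6 * S * (1 + 3 * (M + 1) ^ 3) * \<bar>b - a\<bar>)"
proof -
  define k1 where "k1 t = (y1 t * c1 t - s1 t) ^ 3" for t
  define k2 where "k2 t = (y2 t * c2 t - s2 t) ^ 3" for t
  define E' where "E' t = 2 * \<sigma> t * ((y1 t - y2 t) * (s1 t - s2 t)
      + (k1 t - k2 t) * ((s1 t - s2 t) * c1 t - (c1 t - c2 t) * s1 t))" for t
  show ?thesis
  proof (rule gronwall[where E' = E'])
    fix t assume t: "t \<in> closed_segment a b"
    note f1 = frame(1)[OF t, unfolded moving_frame_def] and f2 = frame(2)[OF t, unfolded moving_frame_def]
    show "(E has_real_derivative E' t) (at t)"
      unfolding E_def
      apply (rule derivative_eq_intros f1[THEN conjunct1] f1[THEN conjunct2, THEN conjunct1]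
          f1[THEN conjunct2, THEN conjunct2, THEN conjunct1] f2[THEN conjunct1] f2[THEN conjunct2, THEN conjunct1]
          f2[THEN conjunct2, THEN conjunct2, THEN conjunct1] refl)+
      apply (simp add: E'_def flip: k1_def k2_def)
      apply (simp add: algebra_simps)
      done
    have le1: "\<bar>c\<bar> \<le> 1" "\<bar>s\<bar> \<le> 1" if "c\<^sup>2 + s\<^sup>2 = 1" for c s :: real
      using that by (auto intro!: power2_le_imp_le[of "\<bar>_\<bar>" 1] simp: ) (smt (verit) zero_le_power2)+
    have cs: "\<bar>c1 t\<bar> \<le> 1" "\<bar>s1 t\<bar> \<le> 1" "\<bar>c2 t\<bar> \<le> 1" "\<bar>s2 t\<bar> \<le> 1" using f1 f2 le1 by blast+
    have M: "M \<ge> 0" using height(1)[OF t] by linarith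
    \<comment> \<open>All differences are estimated by the sum \<open>m\<close> of the three distances, whose square is at most \<open>3 * E t\<close>.\<close>
    define p q r m where "p = \<bar>y1 t - y2 t\<bar>" and "q = \<bar>c1 t - c2 t\<bar>" and "r = \<bar>s1 t - s2 t\<bar>" and "m = p + q + r"
    have nn: "p \<ge> 0" "q \<ge> 0" "r \<ge> 0" by (auto simp: p_def q_def r_def)
    have "m\<^sup>2 \<le> 3 * (p\<^sup>2 + q\<^sup>2 + r\<^sup>2)"
      using sum_squares_ge_zero[of "p - q" "q - r"] zero_le_power2[of "p - r"] zero_le_power2[of "p - q"] zero_le_power2[of "q - r"]
      by (simp add: m_def power2_eq_square algebra_simps)
    then have mE: "m\<^sup>2 \<le> 3 * E t" by (simp add: E_def p_def q_def r_def)
    have vb: "\<bar>y * c - s\<bar> \<le> M + 1" if "\<bar>y\<bar> \<le> M" "\<bar>c\<bar> \<le> 1" "\<bar>s\<bar> \<le> 1" for y c s :: real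
    proof -
      have "\<bar>y * c\<bar> \<le> M * 1" unfolding abs_mult using that by (intro mult_mono) auto
      then show ?thesis using that by linarith
    qed
    have "(y1 t * c1 t - s1 t) - (y2 t * c2 t - s2 t) = (y1 t - y2 t) * c1 t + y2 t * (c1 t - c2 t) - (s1 t - s2 t)"
      by (simp add: algebra_simps)
    then have "\<bar>(y1 t * c1 t - s1 t) - (y2 t * c2 t - s2 t)\<bar> \<le> p * \<bar>c1 t\<bar> + \<bar>y2 t\<bar> * q + r"
      by (simp add: p_def q_def r_def flip: abs_mult)
    also have "\<dots> \<le> p * 1 + M * q + r"
      using cs nn height(2)[OF t] by (intro add_mono mult_mono) auto
    also have "\<dots> \<le> (M + 1) * m" using nn M by (simp add: m_def algebra_simps)
    finally have v: "\<bar>(y1 t * c1 t - s1 t) - (y2 t * c2 t - s2 t)\<bar> \<le> (M + 1) * m" .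
    have "\<bar>k1 t - k2 t\<bar> \<le> 3 * (M + 1)\<^sup>2 * \<bar>(y1 t * c1 t - s1 t) - (y2 t * c2 t - s2 t)\<bar>"
      unfolding k1_def k2_def using cs height[OF t] by (intro cube_diff_bound vb) auto
    also have "\<dots> \<le> 3 * (M + 1)\<^sup>2 * ((M + 1) * m)" by (intro mult_left_mono v) auto
    finally have k: "\<bar>k1 t - k2 t\<bar> \<le> 3 * (M + 1) ^ 3 * m" by (simp add: power2_eq_square power3_eq_cube)
    have "\<bar>(s1 t - s2 t) * c1 t - (c1 t - c2 t) * s1 t\<bar> \<le> r * \<bar>c1 t\<bar> + q * \<bar>s1 t\<bar>"
      by (simp add: q_def r_def flip: abs_mult)
    also have "\<dots> \<le> r * 1 + q * 1" using cs nn by (intro add_mono mult_mono) auto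
    also have "\<dots> \<le> m" using nn by (simp add: m_def)
    finally have w: "\<bar>(s1 t - s2 t) * c1 t - (c1 t - c2 t) * s1 t\<bar> \<le> m" .
    have pr: "p * r \<le> m * m" using nn by (intro mult_mono) (auto simp: m_def)
    have "\<bar>E' t\<bar> \<le> 2 * \<bar>\<sigma> t\<bar> * (\<bar>(y1 t - y2 t) * (s1 t - s2 t)\<bar>
        + \<bar>(k1 t - k2 t) * ((s1 t - s2 t) * c1 t - (c1 t - c2 t) * s1 t)\<bar>)"
      unfolding E'_def abs_mult[of "2 * \<sigma> t"] abs_mult[of 2] abs_numeral
      by (intro mult_left_mono abs_triangle_ineq) auto
    also have "\<dots> = 2 * \<bar>\<sigma> t\<bar> * (p * r + \<bar>k1 t - k2 t\<bar> * \<bar>(s1 t - s2 t) * c1 t - (c1 t - c2 t) * s1 t\<bar>)"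
      unfolding p_def r_def abs_mult ..
    also have "\<dots> \<le> 2 * S * (m * m + 3 * (M + 1) ^ 3 * m * m)"
      using \<sigma>[OF t] M nn by (intro mult_mono add_mono pr k w) (auto simp: m_def intro!: add_nonneg_nonneg mult_nonneg_nonneg)
    also have "\<dots> = 2 * S * (1 + 3 * (M + 1) ^ 3) * m\<^sup>2" by (simp add: power2_eq_square algebra_simps)
    also have "\<dots> \<le> 2 * S * (1 + 3 * (M + 1) ^ 3) * (3 * E t)"
      using \<sigma>[OF t] M by (intro mult_left_mono mE) auto
    finally show "\<bar>E' t\<bar> \<le> 6 * S * (1 + 3 * (M + 1) ^ 3) * E t" by simp
  qed
qed

context soliton
begin

lemma cs_bound: "\<bar>c t\<bar> \<le> 1" "\<bar>s t\<bar> \<le> 1"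
proof -
  have "(c t)\<^sup>2 \<le> 1\<^sup>2 \<and> (s t)\<^sup>2 \<le> 1\<^sup>2"
    using unit[of t] zero_le_power2[of "c t"] zero_le_power2[of "s t"]
    unfolding one_power2 by (intro conjI) linarith+
  then show "\<bar>c t\<bar> \<le> 1" "\<bar>s t\<bar> \<le> 1" by (auto simp only: abs_le_square_iff[symmetric] abs_one)
qed

lemma y_bound: "\<bar>y t\<bar> \<le> \<bar>y 0\<bar> + \<bar>t\<bar>"
proof -
  have "\<bar>y t - y 0\<bar> \<le> 1 * \<bar>t - 0\<bar>"
    using field_differentiable_bound[of UNIV y s 1 t 0] dy cs_bound by (simp add: has_field_derivative_at_within)
  then have "\<bar>y t - y 0\<bar> \<le> \<bar>t\<bar>" by simp
  then show ?thesis by linarith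
qed

lemma reversed: "soliton (\<lambda>t. x (- t)) (\<lambda>t. y (- t)) (\<lambda>t. - c (- t)) (\<lambda>t. - s (- t))"
proof
  fix t
  have neg: "((\<lambda>t. f (- t)) has_real_derivative - d) (at t)" if "(f has_real_derivative d) (at (- t))" for f d
    using DERIV_chain2[of f d uminus t "-1" UNIV, OF that] DERIV_minus[OF DERIV_ident, of t UNIV] by simp
  have odd: "(a - b) ^ 3 = - ((b - a) ^ 3)" for a b :: real by algebra
  show "((\<lambda>t. x (- t)) has_real_derivative - c (- t)) (at t)" by (rule neg[OF dx])
  show "((\<lambda>t. y (- t)) has_real_derivative - s (- t)) (at t)" by (rule neg[OF dy])
  show "((\<lambda>t. - c (- t)) has_real_derivative - ((y (- t) * - c (- t) - - s (- t)) ^ 3 * - s (- t))) (at t)"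
    using DERIV_minus[OF neg[OF dc]] odd[of "s (- t)" "y (- t) * c (- t)"] by simp
  show "((\<lambda>t. - s (- t)) has_real_derivative (y (- t) * - c (- t) - - s (- t)) ^ 3 * - c (- t)) (at t)"
    using DERIV_minus[OF neg[OF ds]] odd[of "s (- t)" "y (- t) * c (- t)"] by simp
  show "(- c (- t))\<^sup>2 + (- s (- t))\<^sup>2 = 1" using unit[of "- t"] by simp
qed

lemma reflected: "soliton x (\<lambda>t. - y t) c (\<lambda>t. - s t)"
proof
  fix t
  have odd: "(- y t * c t - - s t) ^ 3 = - ((y t * c t - s t) ^ 3)" by algebra
  show "((\<lambda>t. - y t) has_real_derivative - s t) (at t)" by (rule DERIV_minus[OF dy])
  show "(c has_real_derivative - ((- y t * c t - - s t) ^ 3 * - s t)) (at t)"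
    using dc[of t] odd by simp
  show "((\<lambda>t. - s t) has_real_derivative (- y t * c t - - s t) ^ 3 * c t) (at t)"
    using DERIV_minus[OF ds[of t]] odd by simp
qed (use unit dx in auto)

lemma shifted: "soliton (\<lambda>t. x (t + a) + b) (\<lambda>t. y (t + a)) (\<lambda>t. c (t + a)) (\<lambda>t. s (t + a))"
proof -
  have sh: "((\<lambda>t. f (t + a)) has_real_derivative d) (at t)" if "(f has_real_derivative d) (at (t + a))" for f d t
    using that by (simp add: DERIV_shift)
  show ?thesis
  proof
    fix t
    show "((\<lambda>t. x (t + a) + b) has_real_derivative c (t + a)) (at t)"
      using DERIV_add[OF sh[OF dx] DERIV_const] by simp
  qed (rule sh[OF dy] sh[OF dc] sh[OF ds] unit)+
qed

lemma isCont_x [simp]: "isCont x t" and isCont_y [simp]: "isCont y t"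
  and isCont_c [simp]: "isCont c t" and isCont_s [simp]: "isCont s t"
  using dx dy dc ds DERIV_isCont by blast+

end

lemma (in soliton) moving_frame: "moving_frame (\<lambda>_. 1) y c s t"
  by (simp add: moving_frame_def dy dc ds unit)

lemma soliton_gronwall:
  assumes "soliton x1 y1 c1 s1" "soliton x2 y2 c2 s2" "\<bar>y1 0\<bar> \<le> M" "\<bar>y2 0\<bar> \<le> M"
  shows "(y1 t - y2 t)\<^sup>2 + (c1 t - c2 t)\<^sup>2 + (s1 t - s2 t)\<^sup>2
    \<le> ((y1 0 - y2 0)\<^sup>2 + (c1 0 - c2 0)\<^sup>2 + (s1 0 - s2 0)\<^sup>2)
       * exp (6 * (1 + 3 * (M + \<bar>t\<bar> + 1) ^ 3) * \<bar>t\<bar>)"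
proof -
  interpret A: soliton x1 y1 c1 s1 by fact
  interpret B: soliton x2 y2 c2 s2 by fact
  have seg: "\<bar>u\<bar> \<le> \<bar>t\<bar>" if "u \<in> closed_segment 0 t" for u
    using that by (auto simp: closed_segment_eq_real_ivl split: if_splits)
  show ?thesis
    using frame_gronwall[of 0 t "\<lambda>_. 1" y1 c1 s1 y2 c2 s2 "M + \<bar>t\<bar>" 1] A.moving_frame B.moving_frame
      order_trans[OF A.y_bound add_mono[OF assms(3) seg]] order_trans[OF B.y_bound add_mono[OF assms(4) seg]]
    by simp
qed

lemma soliton_unique:
  assumes 1: "soliton x1 y1 c1 s1" and 2: "soliton x2 y2 c2 s2"
    and "y1 0 = y2 0" "c1 0 = c2 0" "s1 0 = s2 0"
  shows "y1 t = y2 t \<and> c1 t = c2 t \<and> s1 t = s2 t \<and> x1 t - x1 0 = x2 t - x2 0"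
proof -
  interpret A: soliton x1 y1 c1 s1 by fact
  interpret B: soliton x2 y2 c2 s2 by fact
  have eq: "y1 t = y2 t \<and> c1 t = c2 t \<and> s1 t = s2 t" for t
  proof -
    have "(y1 t - y2 t)\<^sup>2 + (c1 t - c2 t)\<^sup>2 + (s1 t - s2 t)\<^sup>2 \<le> 0"
      using soliton_gronwall[OF 1 2 order_refl, of t] assms by simp
    then have "(y1 t - y2 t)\<^sup>2 = 0 \<and> (c1 t - c2 t)\<^sup>2 = 0 \<and> (s1 t - s2 t)\<^sup>2 = 0"
      using zero_le_power2[of "y1 t - y2 t"] zero_le_power2[of "c1 t - c2 t"] zero_le_power2[of "s1 t - s2 t"]
      by linarith
    then show ?thesis by simp
  qed
  have "((\<lambda>t. x1 t - x2 t) has_real_derivative 0) (at t)" for t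
    using DERIV_diff[OF A.dx[of t] B.dx[of t]] eq by simp
  then have "x1 t - x2 t = x1 0 - x2 0" by (rule DERIV_isconst_all[rule_format, of "\<lambda>t. x1 t - x2 t"])
  then show ?thesis using eq by simp
qed

text \<open>A trajectory that touches the x-axis is the x-axis: by uniqueness no other trajectory reaches the
equilibrium in finite time.\<close>

lemma (in soliton) equilibrium:
  assumes "y t0 = 0" "s t0 = 0"
  shows "y t = 0" "s t = 0"
proof -
  have c0: "(c t0)\<^sup>2 = 1" using unit[of t0] assms by simp
  have line: "soliton (\<lambda>t. c t0 * t) (\<lambda>t. 0) (\<lambda>t. c t0) (\<lambda>t. 0)"
    by unfold_locales (auto intro!: derivative_eq_intros simp: c0)
  have "y (t - t0 + t0) = 0 \<and> c (t - t0 + t0) = c t0 \<and> s (t - t0 + t0) = 0"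
    using soliton_unique[OF shifted[of t0 0] line, of "t - t0"] assms by simp
  then show "y t = 0" "s t = 0" by simp_all
qed

section \<open>Solutions and unit speed solutions\<close>

definition plane_curve :: "(real \<Rightarrow> real) \<Rightarrow> (real \<Rightarrow> real) \<Rightarrow> real \<Rightarrow> real^2" where
  "plane_curve x y t = vector [x t, y t]"

lemma plane_curve_nth [simp]: "plane_curve x y t $ 1 = x t" "plane_curve x y t $ 2 = y t"
  by (simp_all add: plane_curve_def)

context soliton
begin

lemma smooth: "smooth_on UNIV x" "smooth_on UNIV y" "smooth_on UNIV c" "smooth_on UNIV s"
proof -
  define G where "G = {x, y, c, s}"
  have mem: "x \<in> polynomials_in G" "y \<in> polynomials_in G" "c \<in> polynomials_in G" "s \<in> polynomials_in G"
    by (auto simp: G_def intro: pol_gen)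
  have "\<exists>h\<in>polynomials_in G. \<forall>t\<in>UNIV. (g has_real_derivative h t) (at t)" if "g \<in> G" for g
  proof -
    consider "g = x" | "g = y" | "g = c" | "g = s" using \<open>g \<in> G\<close> by (auto simp: G_def)
    then show ?thesis
    proof cases
      case 1 then show ?thesis using dx mem by (intro bexI[of _ c]) auto
    next
      case 2 then show ?thesis using dy mem by (intro bexI[of _ s]) auto
    next
      case 3 then show ?thesis using dc
        by (intro bexI[of _ "\<lambda>t. - ((y t * c t - s t) ^ 3 * s t)"] pol_minus pol_mult pol_power pol_diff mem) auto
    next
      case 4 then show ?thesis using ds
        by (intro bexI[of _ "\<lambda>t. (y t * c t - s t) ^ 3 * c t"] pol_mult pol_power pol_diff mem) auto
    qed
  qed
  from polynomials_in_smooth[OF open_UNIV this] mem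
  show "smooth_on UNIV x" "smooth_on UNIV y" "smooth_on UNIV c" "smooth_on UNIV s" by blast+
qed

lemma vderiv_plane_curve:
  "vderiv 1 (plane_curve x y) t = vector [c t, s t]"
  "vderiv 2 (plane_curve x y) t = vector [- ((y t * c t - s t) ^ 3 * s t), (y t * c t - s t) ^ 3 * c t]"
proof -
  have 1: "vderiv 1 (plane_curve x y) = (\<lambda>t. vector [c t, s t])"
    using vector_derivative_at[OF has_vector_derivative_vector2[OF dx dy]]
    by (auto simp: plane_curve_def[abs_def])
  then show "vderiv 1 (plane_curve x y) t = vector [c t, s t]" by simp
  show "vderiv 2 (plane_curve x y) t = vector [- ((y t * c t - s t) ^ 3 * s t), (y t * c t - s t) ^ 3 * c t]"
    using vector_derivative_at[OF has_vector_derivative_vector2[OF dc ds]] 1 by (simp add: numeral_2_eq_2)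
qed

lemma solution: "solution UNIV (plane_curve x y)"
proof -
  have "smooth_on UNIV (plane_curve x y)"
    unfolding plane_curve_def by (intro smooth_on_vector2 smooth open_UNIV)
  moreover have "soliton_at (plane_curve x y) u" for u
  proof -
    have "(vector [c u, s u] :: real^2) \<noteq> 0"
      using unit[of u] by (auto simp: vec_eq_iff forall_2)
    moreover have "c u * ((y u * c u - s u) ^ 3 * c u) + s u * ((y u * c u - s u) ^ 3 * s u)
        = (y u * c u - s u) ^ 3 * ((c u)\<^sup>2 + (s u)\<^sup>2)" by algebra
    ultimately show ?thesis
      unfolding soliton_at_def vderiv_plane_curve using unit[of u] by simp
  qed
  ultimately show ?thesis unfolding solution_iff by auto
qed

end

section \<open>Maximal solutions are the unit speed solutions\<close>

lemma open_interval_antiderivative: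
  fixes h :: "real \<Rightarrow> real"
  assumes "open I" "is_interval I" "u0 \<in> I" and cont: "\<And>u. u \<in> I \<Longrightarrow> isCont h u"
  obtains A where "\<And>u. u \<in> I \<Longrightarrow> (A has_real_derivative h u) (at u)" "A u0 = 0"
proof -
  define a where "a = (INF u\<in>I. ereal u)"
  define b where "b = (SUP u\<in>I. ereal u)"
  have bounds: "a < ereal u \<and> ereal u < b" if u: "u \<in> I" for u
  proof -
    obtain e where e: "e > 0" "ball u e \<subseteq> I" using openE[OF \<open>open I\<close> u] by blast
    have "u - e/2 \<in> ball u e" "u + e/2 \<in> ball u e" using e(1) by (simp_all add: dist_real_def)
    then have "u - e/2 \<in> I" "u + e/2 \<in> I" using e(2) by blast+
    then have "a \<le> ereal (u - e/2)" "ereal (u + e/2) \<le> b"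
      by (simp_all add: a_def b_def INF_lower SUP_upper)
    moreover have "ereal (u - e/2) < ereal u" "ereal u < ereal (u + e/2)" using e by auto
    ultimately show ?thesis by (meson le_less_trans less_le_trans)
  qed
  have inside: "u \<in> I" if "a < ereal u" "ereal u < b" for u
  proof -
    obtain v where "v \<in> I" "v < u" using \<open>a < ereal u\<close> by (auto simp: a_def INF_less_iff)
    moreover obtain w where "w \<in> I" "u < w" using \<open>ereal u < b\<close> by (auto simp: b_def less_SUP_iff)
    ultimately show ?thesis using \<open>is_interval I\<close> by (meson is_interval_1 less_imp_le)
  qed
  have "a < b" using bounds[OF \<open>u0 \<in> I\<close>] by (meson less_trans)
  then obtain F where F: "\<And>u. a < ereal u \<Longrightarrow> ereal u < b \<Longrightarrow> (F has_vector_derivative h u) (at u)"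
    using einterval_antiderivative[of a b h] cont inside by blast
  have "((\<lambda>u. F u - F u0) has_real_derivative h u) (at u)" if "u \<in> I" for u
    using DERIV_diff[OF F[folded has_real_derivative_iff_has_vector_derivative] DERIV_const] bounds[OF that] by simp
  from that[OF this] show ?thesis by simp
qed

lemma closed_segment_subset_interval:
  fixes I :: "real set"
  shows "is_interval I \<Longrightarrow> a \<in> I \<Longrightarrow> b \<in> I \<Longrightarrow> closed_segment a b \<subseteq> I"
  by (simp add: closed_segment_subset is_interval_convex)

text \<open>Between \<open>u0\<close> and \<open>u\<close> the heights and the speed are bounded, by compactness, so that the Gronwall estimate applies.\<close>

lemma frame_unique:
  fixes \<sigma> y1 c1 s1 y2 c2 s2 :: "real \<Rightarrow> real"
  assumes I: "is_interval I" "u0 \<in> I" "u \<in> I" and \<sigma>: "continuous_on I \<sigma>"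
    and frame: "\<And>t. t \<in> I \<Longrightarrow> moving_frame \<sigma> y1 c1 s1 t" "\<And>t. t \<in> I \<Longrightarrow> moving_frame \<sigma> y2 c2 s2 t"
    and init: "y1 u0 = y2 u0" "c1 u0 = c2 u0" "s1 u0 = s2 u0"
  shows "y1 u = y2 u \<and> c1 u = c2 u \<and> s1 u = s2 u"
proof -
  have seg: "closed_segment u0 u \<subseteq> I" by (rule closed_segment_subset_interval[OF I])
  have bd: "\<exists>M. \<forall>t\<in>closed_segment u0 u. \<bar>f t\<bar> \<le> M" if "continuous_on I f" for f :: "real \<Rightarrow> real"
    using compact_imp_bounded[OF compact_continuous_image[OF continuous_on_subset[OF that seg] compact_segment]]
    by (auto simp: bounded_iff)
  have "continuous_on I y1" "continuous_on I y2"
    using frame by (auto simp: moving_frame_def intro!: continuous_at_imp_continuous_on DERIV_isCont)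
  then obtain M1 M2 S where M: "\<And>t. t \<in> closed_segment u0 u \<Longrightarrow> \<bar>y1 t\<bar> \<le> M1"
      "\<And>t. t \<in> closed_segment u0 u \<Longrightarrow> \<bar>y2 t\<bar> \<le> M2"
      "\<And>t. t \<in> closed_segment u0 u \<Longrightarrow> \<bar>\<sigma> t\<bar> \<le> S"
    using bd \<sigma> by metis
  have "(y1 u - y2 u)\<^sup>2 + (c1 u - c2 u)\<^sup>2 + (s1 u - s2 u)\<^sup>2 \<le> 0"
    using frame_gronwall[of u0 u \<sigma> y1 c1 s1 y2 c2 s2 "max M1 M2" S] frame M subsetD[OF seg] init
    by (simp add: le_max_iff_disj)
  then have "(y1 u - y2 u)\<^sup>2 = 0 \<and> (c1 u - c2 u)\<^sup>2 = 0 \<and> (s1 u - s2 u)\<^sup>2 = 0"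
    using zero_le_power2[of "y1 u - y2 u"] zero_le_power2[of "c1 u - c2 u"] zero_le_power2[of "s1 u - s2 u"]
    by linarith
  then show ?thesis by simp
qed

text \<open>The reparametrization \<open>\<phi>\<close> is arclength measured from a point \<open>u0\<close>. The tangent of \<open>Y\<close>, as a function of the
original parameter, and that of the complete trajectory with the same data at \<open>u0\<close>, composed with \<open>\<phi>\<close>, satisfy
the same equation with speed \<open>\<sigma>\<close>; so they agree.\<close>

lemma solution_reparametrized:
  assumes sol: "solution I Y"
  obtains x y c s \<phi> where "soliton x y c s" "smooth_on I \<phi>"
    "\<forall>u\<in>I. vector_derivative \<phi> (at u) \<noteq> 0" "\<forall>u\<in>I. Y u = plane_curve x y (\<phi> u)"
proof -
  have I: "open I" "is_interval I" and smooth: "smooth_on I Y" and eq: "\<And>u. u \<in> I \<Longrightarrow> soliton_at Y u"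
    using sol by (auto simp: solution_iff)
  obtain u0 where u0: "u0 \<in> I" using sol by (auto simp: solution_iff)
  define X1 where "X1 n u = vderiv n Y u $ 1" for n u
  define X2 where "X2 n u = vderiv n Y u $ 2" for n u
  have d1: "(X1 n has_real_derivative X1 (Suc n) u) (at u)" if "u \<in> I" for n u
    using has_vector_derivative_vec_nth[OF smooth_onD[OF smooth that]] unfolding X1_def .
  have d2: "(X2 n has_real_derivative X2 (Suc n) u) (at u)" if "u \<in> I" for n u
    using has_vector_derivative_vec_nth[OF smooth_onD[OF smooth that]] unfolding X2_def .
  define \<sigma> where "\<sigma> u = sqrt ((X1 1 u)\<^sup>2 + (X2 1 u)\<^sup>2)" for u
  define \<rho> where "\<rho> u = inverse (\<sigma> u)" for u
  have pos: "\<sigma> u > 0" and sq: "(\<sigma> u)\<^sup>2 = (X1 1 u)\<^sup>2 + (X2 1 u)\<^sup>2" if "u \<in> I" for u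
  proof -
    have "X1 1 u \<noteq> 0 \<or> X2 1 u \<noteq> 0" using eq[OF that] by (auto simp: soliton_at_def X1_def X2_def vec_eq_iff forall_2)
    then show "\<sigma> u > 0" by (auto simp: \<sigma>_def sum_power2_gt_zero_iff)
    show "(\<sigma> u)\<^sup>2 = (X1 1 u)\<^sup>2 + (X2 1 u)\<^sup>2" by (simp add: \<sigma>_def)
  qed
  have d\<sigma>: "(\<sigma> has_real_derivative (X1 1 u * X1 2 u + X2 1 u * X2 2 u) * \<rho> u) (at u)" if u: "u \<in> I" for u
  proof -
    have "(X1 1 u)\<^sup>2 + (X2 1 u)\<^sup>2 > 0" using pos[OF u] sq[OF u] by (metis zero_less_power)
    from DERIV_real_sqrt[OF this]
    have "(\<sigma> has_real_derivative inverse (\<sigma> u) / 2 * (2 * (X1 1 u * X1 2 u + X2 1 u * X2 2 u))) (at u)"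
      unfolding \<sigma>_def
    proof (rule DERIV_chain2)
      show "((\<lambda>u. (X1 1 u)\<^sup>2 + (X2 1 u)\<^sup>2) has_real_derivative 2 * (X1 1 u * X1 2 u + X2 1 u * X2 2 u)) (at u)"
        using DERIV_add[OF DERIV_power[OF d1[OF u, of 1], of 2] DERIV_power[OF d2[OF u, of 1], of 2]]
        by (simp add: numeral_2_eq_2 algebra_simps)
    qed
    moreover have "inverse (\<sigma> u) / 2 * (2 * z) = z * \<rho> u" for z by (simp add: \<rho>_def)
    ultimately show ?thesis by (simp only:)
  qed
  have d\<rho>: "(\<rho> has_real_derivative - ((X1 1 u * X1 2 u + X2 1 u * X2 2 u) * \<rho> u) * (\<rho> u)\<^sup>2) (at u)" if u: "u \<in> I" for u
    unfolding \<rho>_def using DERIV_inverse_fun[OF d\<sigma>[OF u]] pos[OF u]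
    by (simp add: \<rho>_def power2_eq_square mult_ac)
  have cont\<sigma>: "isCont \<sigma> u" if "u \<in> I" for u using d\<sigma>[OF that] by (rule DERIV_isCont)
  obtain \<phi> where \<phi>: "\<And>u. u \<in> I \<Longrightarrow> (\<phi> has_real_derivative \<sigma> u) (at u)" "\<phi> u0 = 0"
    using open_interval_antiderivative[OF I u0 cont\<sigma>] by blast
  \<comment> \<open>The speed \<open>\<sigma>\<close> is a square root; together with its inverse \<open>\<rho>\<close> and the derivatives of \<open>Y\<close> it generates a differential algebra.\<close>
  define G where "G = {\<phi>, \<sigma>, \<rho>} \<union> range X1 \<union> range X2"
  have mem: "\<phi> \<in> polynomials_in G" "\<sigma> \<in> polynomials_in G" "\<rho> \<in> polynomials_in G"
    "X1 n \<in> polynomials_in G" "X2 n \<in> polynomials_in G" for n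
    by (auto simp: G_def intro!: pol_gen)
  have smooth\<phi>: "smooth_on I \<phi>"
  proof (rule polynomials_in_smooth[OF \<open>open I\<close>, of G])
    fix g assume "g \<in> G"
    then consider "g = \<phi>" | "g = \<sigma>" | "g = \<rho>" | n where "g = X1 n" | n where "g = X2 n" by (auto simp: G_def)
    then show "\<exists>h\<in>polynomials_in G. \<forall>t\<in>I. (g has_real_derivative h t) (at t)"
    proof cases
      case 1 then show ?thesis using \<phi>(1) mem by (intro bexI[of _ \<sigma>]) auto
    next
      case 2 then show ?thesis using d\<sigma>
        by (intro bexI[of _ "\<lambda>u. (X1 1 u * X1 2 u + X2 1 u * X2 2 u) * \<rho> u"] pol_add pol_mult mem) auto
    next
      case 3 then show ?thesis using d\<rho>
        by (intro bexI[of _ "\<lambda>u. - ((X1 1 u * X1 2 u + X2 1 u * X2 2 u) * \<rho> u) * (\<rho> u)\<^sup>2"]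
            pol_add pol_mult pol_minus pol_power mem) auto
    next
      case 4 then show ?thesis using d1 mem by (intro bexI[of _ "X1 (Suc n)"]) auto
    next
      case 5 then show ?thesis using d2 mem by (intro bexI[of _ "X2 (Suc n)"]) auto
    qed
  qed (rule mem)
  define c1 where "c1 u = X1 1 u * \<rho> u" for u
  define s1 where "s1 u = X2 1 u * \<rho> u" for u
  have unit1: "(c1 u)\<^sup>2 + (s1 u)\<^sup>2 = 1" if "u \<in> I" for u
  proof -
    have "(c1 u)\<^sup>2 + (s1 u)\<^sup>2 = (\<sigma> u)\<^sup>2 * (\<rho> u)\<^sup>2"
      unfolding c1_def s1_def sq[OF that] by algebra
    then show ?thesis using pos[OF that] by (simp add: \<rho>_def flip: power_mult_distrib)
  qed
  have curv: "X1 1 u * X2 2 u - X2 1 u * X1 2 u = (X2 0 u * X1 1 u - X2 1 u) ^ 3" if "u \<in> I" for u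
    using eq[OF that] by (simp add: soliton_at_def X1_def X2_def)
  have comp: "X1 1 u = \<sigma> u * c1 u" "X2 1 u = \<sigma> u * s1 u" if "u \<in> I" for u
    using pos[OF that] by (simp_all add: c1_def s1_def \<rho>_def)
  \<comment> \<open>The Frenet equations for the normalized tangent; the left hand sides come from differentiating the quotients.\<close>
  have frame: "(X1 2 u * \<rho> u - X1 1 u * ((X1 1 u * X1 2 u + X2 1 u * X2 2 u) * \<rho> u * (\<rho> u)\<^sup>2))
        = - (\<sigma> u * ((X2 0 u * c1 u - s1 u) ^ 3 * s1 u))"
      "(X2 2 u * \<rho> u - X2 1 u * ((X1 1 u * X1 2 u + X2 1 u * X2 2 u) * \<rho> u * (\<rho> u)\<^sup>2))
        = \<sigma> u * ((X2 0 u * c1 u - s1 u) ^ 3 * c1 u)" if u: "u \<in> I" for u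
  proof -
    have r: "\<sigma> u * \<rho> u = 1" using pos[OF u] by (simp add: \<rho>_def)
    have k: "X1 1 u * X2 2 u - X2 1 u * X1 2 u = (\<sigma> u) ^ 3 * (X2 0 u * c1 u - s1 u) ^ 3"
      unfolding curv[OF u] unfolding comp[OF u] by algebra
    show "(X1 2 u * \<rho> u - X1 1 u * ((X1 1 u * X1 2 u + X2 1 u * X2 2 u) * \<rho> u * (\<rho> u)\<^sup>2))
        = - (\<sigma> u * ((X2 0 u * c1 u - s1 u) ^ 3 * s1 u))"
      using k r unit1[OF u] comp[OF u] by algebra
    show "(X2 2 u * \<rho> u - X2 1 u * ((X1 1 u * X1 2 u + X2 1 u * X2 2 u) * \<rho> u * (\<rho> u)\<^sup>2))
        = \<sigma> u * ((X2 0 u * c1 u - s1 u) ^ 3 * c1 u)"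
      using k r unit1[OF u] comp[OF u] by algebra
  qed
  have dc1: "(c1 has_real_derivative - (\<sigma> u * ((X2 0 u * c1 u - s1 u) ^ 3 * s1 u))) (at u)" if u: "u \<in> I" for u
    unfolding c1_def[abs_def] frame(1)[OF u, symmetric, unfolded c1_def]
    using DERIV_mult[OF d1[OF u, of 1] d\<rho>[OF u]] by (simp add: numeral_2_eq_2 c1_def algebra_simps)
  have ds1: "(s1 has_real_derivative \<sigma> u * ((X2 0 u * c1 u - s1 u) ^ 3 * c1 u)) (at u)" if u: "u \<in> I" for u
    using DERIV_mult[OF d2[OF u, of 1] d\<rho>[OF u]] frame(2)[OF u]
    unfolding s1_def[abs_def] by (simp add: numeral_2_eq_2 algebra_simps)
  obtain x y c s where S: "soliton x y c s" and init: "x 0 = X1 0 u0" "y 0 = X2 0 u0" "c 0 = c1 u0" "s 0 = s1 u0"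
    using soliton_exists[OF unit1[OF u0]] by blast
  interpret soliton x y c s by (rule S)
  have chain: "((\<lambda>u. f (\<phi> u)) has_real_derivative \<sigma> u * d) (at u)"
    if "(f has_real_derivative d) (at (\<phi> u))" "u \<in> I" for f d u
    using DERIV_chain2[OF that(1) \<phi>(1)[OF that(2)]] by (simp add: mult.commute)
  have agree: "X2 0 u = y (\<phi> u) \<and> c1 u = c (\<phi> u) \<and> s1 u = s (\<phi> u)" if u: "u \<in> I" for u
  proof (rule frame_unique[OF I(2) u0 u, of \<sigma>])
    show "continuous_on I \<sigma>" using cont\<sigma> by (simp add: continuous_at_imp_continuous_on)
    fix t assume t: "t \<in> I"
    show "moving_frame \<sigma> (X2 0) c1 s1 t"
      using d2[OF t, of 0] comp(2)[OF t] dc1[OF t] ds1[OF t] unit1[OF t] by (simp add: moving_frame_def)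
    show "moving_frame \<sigma> (\<lambda>u. y (\<phi> u)) (\<lambda>u. c (\<phi> u)) (\<lambda>u. s (\<phi> u)) t"
      using chain[OF dy t] chain[OF dc t] chain[OF ds t] unit by (simp add: moving_frame_def)
  qed (use init \<phi>(2) in auto)
  have "X1 0 u = x (\<phi> u)" if u: "u \<in> I" for u
  proof -
    have "\<forall>t\<in>I. ((\<lambda>u. X1 0 u - x (\<phi> u)) has_derivative (\<lambda>_. 0)) (at t within I)"
    proof
      fix t assume t: "t \<in> I"
      have "((\<lambda>u. X1 0 u - x (\<phi> u)) has_real_derivative 0) (at t)"
        using DERIV_diff[OF d1[OF t, of 0] chain[OF dx t]] comp(1)[OF t] agree[OF t] by simp
      then show "((\<lambda>u. X1 0 u - x (\<phi> u)) has_derivative (\<lambda>_. 0)) (at t within I)"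
        by (simp add: has_field_derivative_def has_derivative_at_withinI lambda_zero)
    qed
    then have "\<exists>k. \<forall>t\<in>I. X1 0 t - x (\<phi> t) = k"
      using has_derivative_zero_constant[OF is_interval_convex[OF I(2)], of "\<lambda>u. X1 0 u - x (\<phi> u)"] by blast
    then have "X1 0 u - x (\<phi> u) = X1 0 u0 - x (\<phi> u0)" using u u0 by auto
    then show ?thesis using init \<phi>(2) by simp
  qed
  then have "Y u = plane_curve x y (\<phi> u)" if "u \<in> I" for u
    using agree[OF that] that by (intro vec2_eqI) (auto simp: X1_def X2_def)
  moreover have "vector_derivative \<phi> (at u) \<noteq> 0" if "u \<in> I" for u
    using vector_derivative_at[OF \<phi>(1)[OF that, unfolded has_real_derivative_iff_has_vector_derivative]] pos[OF that] by simp
  ultimately show ?thesis using that[OF S smooth\<phi>] by blast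
qed

lemma continuous_nonzero_sign:
  fixes f :: "real \<Rightarrow> real"
  assumes "continuous_on UNIV f" "\<And>t. f t \<noteq> 0"
  shows "(\<forall>t. f t > 0) \<or> (\<forall>t. f t < 0)"
proof -
  have "\<exists>w. f w = 0" if "f t < 0" "f u > 0" for t u
  proof -
    have "connected (range f)" using assms(1) by (intro connected_continuous_image) auto
    then have "0 \<in> range f" using that by (meson connectedD_interval less_imp_le rangeI)
    then show ?thesis by auto
  qed
  then show ?thesis using assms(2) by (metis linorder_neqE_linordered_idom)
qed

text \<open>Suppose the trajectory were a proper piece of a solution \<open>Z\<close> and \<open>b\<close> a parameter of \<open>Z\<close> that is missed. In one
direction of time \<open>\<phi>\<close> stays between \<open>\<phi> 0\<close> and \<open>b\<close>, where the speed of \<open>Z\<close> is bounded. As the trajectory has unit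
speed, \<open>\<phi>\<close> then moves at a rate bounded below and must pass \<open>b\<close>.\<close>

lemma (in soliton) maximal: "maximal_solution UNIV (plane_curve x y)"
  unfolding maximal_solution_def
proof (intro conjI allI impI)
  show "solution UNIV (plane_curve x y)" by (rule solution)
  fix K Z \<phi>
  assume H: "solution K Z \<and> smooth_on UNIV \<phi> \<and> (\<forall>u\<in>UNIV. vector_derivative \<phi> (at u) \<noteq> 0) \<and>
        \<phi> ` UNIV \<subseteq> K \<and> (\<forall>u\<in>UNIV. plane_curve x y u = Z (\<phi> u))"
  then have K: "is_interval K" "smooth_on K Z" and sub: "\<And>t. \<phi> t \<in> K" and Z: "\<And>t. plane_curve x y t = Z (\<phi> t)"
    by (simp_all add: solution_iff image_subset_iff)
  define d where "d t = vector_derivative \<phi> (at t)" for t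
  have d: "(\<phi> has_real_derivative d t) (at t)" for t
    using smooth_onD[of UNIV \<phi> t 0] H by (simp add: d_def has_real_derivative_iff_has_vector_derivative)
  have "(d has_vector_derivative vderiv 2 \<phi> t) (at t)" for t
    using smooth_onD[of UNIV \<phi> t 1] H by (simp add: d_def[abs_def] numeral_2_eq_2)
  then have "continuous_on UNIV d"
    by (intro continuous_at_imp_continuous_on ballI) (rule has_vector_derivative_continuous)
  then have "(\<forall>t. d t > 0) \<or> (\<forall>t. d t < 0)"
    using continuous_nonzero_sign[of d] H by (auto simp: d_def)
  then obtain e where e: "e \<in> {-1, 1::real}" "\<And>t. e * d t = \<bar>d t\<bar>"
  proof
    assume "\<forall>t. d t > 0" then show ?thesis by (intro that[of 1]) (auto simp: abs_of_pos)
  next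
    assume "\<forall>t. d t < 0" then show ?thesis by (intro that[of "-1"]) (auto simp: abs_of_neg)
  qed
  have speed: "\<bar>d t\<bar> * norm (vderiv 1 Z (\<phi> t)) = 1" for t
  proof -
    have "(Z has_vector_derivative vderiv 1 Z (\<phi> t)) (at (\<phi> t))"
      using smooth_onD[OF K(2) sub[of t], of 0] by simp
    then have "((Z \<circ> \<phi>) has_vector_derivative d t *\<^sub>R vderiv 1 Z (\<phi> t)) (at t)"
      using d[of t] by (intro vector_diff_chain_at) (auto simp: has_real_derivative_iff_has_vector_derivative)
    moreover have "Z \<circ> \<phi> = plane_curve x y" using Z by auto
    ultimately have "vderiv 1 (plane_curve x y) t = d t *\<^sub>R vderiv 1 Z (\<phi> t)"
      by (simp add: vector_derivative_at)
    moreover have "norm (vderiv 1 (plane_curve x y) t) = 1"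
      using unit[of t] by (simp only: vderiv_plane_curve norm_vec2 vector_2 real_sqrt_one)
    ultimately show ?thesis by simp
  qed
  show "\<phi> ` UNIV = K"
  proof (rule ccontr)
    assume "\<phi> ` UNIV \<noteq> K"
    then obtain b where b: "b \<in> K" "b \<notin> range \<phi>" using sub by blast
    have "continuous_on UNIV \<phi>" using d by (intro continuous_at_imp_continuous_on ballI) (rule DERIV_isCont)
    then have conn: "connected (range \<phi>)" by (intro connected_continuous_image) auto
    obtain f where f: "f \<in> {-1, 1::real}" "\<And>t. f * \<phi> t < f * b"
    proof (cases "\<phi> 0 < b")
      case True
      have "\<phi> t < b" for t
      proof (rule ccontr)
        assume "\<not> \<phi> t < b"
        then have "b \<in> range \<phi>" using connectedD_interval[OF conn, of "\<phi> 0" "\<phi> t" b] True by auto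
        then show False using b by simp
      qed
      then show ?thesis using that[of 1] by simp
    next
      case False
      have "b < \<phi> t" for t
      proof (rule ccontr)
        assume "\<not> b < \<phi> t"
        then have "b \<in> range \<phi>" using connectedD_interval[OF conn, of "\<phi> t" "\<phi> 0" b] False by auto
        then show False using b by simp
      qed
      then show ?thesis using that[of "-1"] by simp
    qed
    \<comment> \<open>The signs \<open>e\<close> of \<open>d\<close> and \<open>f\<close> of the side of \<open>b\<close> are chosen to make \<open>\<psi>\<close> an increasing function that runs towards \<open>f * b\<close>.\<close>
    define \<psi> where "\<psi> r = f * \<phi> (e * f * r)" for r
    have d\<psi>: "(\<psi> has_real_derivative \<bar>d (e * f * r)\<bar>) (at r)" for r
    proof -
      have "((\<lambda>r. e * f * r) has_real_derivative e * f) (at r)"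
        using DERIV_cmult[OF DERIV_ident, of "e * f"] by simp
      from DERIV_cmult[OF DERIV_chain2[OF d this], of f]
      have "(\<psi> has_real_derivative f * (d (e * f * r) * (e * f))) (at r)" by (simp add: \<psi>_def[abs_def])
      moreover have "f * (d (e * f * r) * (e * f)) = \<bar>d (e * f * r)\<bar>"
      proof -
        have "f * (d w * (e * f)) = (f * f) * (e * d w)" for w by (simp only: mult_ac)
        moreover have "f * f = 1" using f(1) by auto
        ultimately show ?thesis by (simp only: e(2) mult_1)
      qed
      ultimately show ?thesis by simp
    qed
    let ?J = "closed_segment (\<phi> 0) b"
    have J: "?J \<subseteq> K" by (rule closed_segment_subset_interval[OF K(1) sub b(1)])
    have inJ: "\<phi> (e * f * r) \<in> ?J" if "r \<ge> 0" for r
    proof -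
      have "\<psi> 0 \<le> \<psi> r" using DERIV_nonneg_imp_nondecreasing[OF that] d\<psi> abs_ge_zero by blast
      moreover have "\<psi> r < f * b" unfolding \<psi>_def by (rule f(2))
      ultimately show ?thesis using f(1) by (auto simp: \<psi>_def closed_segment_eq_real_ivl)
    qed
    have "continuous_on ?J (vderiv 1 Z)"
      using smooth_onD[OF K(2), of _ 1] J
      by (intro continuous_at_imp_continuous_on ballI) (meson has_vector_derivative_continuous subsetD)
    then have "bounded (vderiv 1 Z ` ?J)" by (intro compact_imp_bounded compact_continuous_image) auto
    then obtain M where M: "M > 0" "\<And>v. v \<in> ?J \<Longrightarrow> norm (vderiv 1 Z v) \<le> M"
      by (auto simp: bounded_pos)
    have fast: "\<bar>d (e * f * r)\<bar> \<ge> 1 / M" if "r \<ge> 0" for r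
    proof -
      have "1 \<le> \<bar>d (e * f * r)\<bar> * M"
        using speed[of "e * f * r"] mult_left_mono[OF M(2)[OF inJ[OF that]], of "\<bar>d (e * f * r)\<bar>"] by simp
      then show ?thesis using M(1) by (simp add: field_simps)
    qed
    define r where "r = (f * b - \<psi> 0) * M"
    have "\<psi> 0 < f * b" unfolding \<psi>_def by (rule f(2))
    then have r: "r > 0" using M(1) by (simp add: r_def)
    obtain w where w: "w > 0" "\<psi> r - \<psi> 0 = (r - 0) * \<bar>d (e * f * w)\<bar>"
      using MVT2[OF r, of \<psi> "\<lambda>r. \<bar>d (e * f * r)\<bar>"] d\<psi> by blast
    then have "\<psi> r - \<psi> 0 \<ge> r * (1 / M)" using mult_left_mono[OF fast[of w], of r] r by simp
    then have "\<psi> r \<ge> f * b" using M(1) by (simp add: r_def)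
    then show False using f(2)[of "e * f * r"] by (simp add: \<psi>_def)
  qed
qed

lemma maximal_solution_reparametrized:
  assumes "maximal_solution I Y"
  obtains x y c s \<phi> where "soliton x y c s" "\<phi> ` I = UNIV" "inj_on \<phi> I" "\<forall>u\<in>I. Y u = plane_curve x y (\<phi> u)"
proof -
  have sol: "solution I Y" using assms by (simp add: maximal_solution_def)
  from solution_reparametrized[OF this] obtain x y c s \<phi> where 1: "soliton x y c s" "smooth_on I \<phi>"
    "\<forall>u\<in>I. vector_derivative \<phi> (at u) \<noteq> 0" "\<forall>u\<in>I. Y u = plane_curve x y (\<phi> u)" .
  then have onto: "\<phi> ` I = UNIV"
    using assms soliton.solution[OF 1(1)] unfolding maximal_solution_def by blast
  have "inj_on \<phi> I"
  proof (rule inj_onI, rule ccontr)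
    have d: "(\<phi> has_real_derivative vector_derivative \<phi> (at t)) (at t)" if "t \<in> I" for t
      using smooth_onD[OF 1(2) that, of 0] by (simp add: has_real_derivative_iff_has_vector_derivative)
    have no: "\<phi> u \<noteq> \<phi> v" if uv: "u \<in> I" "v \<in> I" "u < v" for u v
    proof
      assume eq: "\<phi> u = \<phi> v"
      have sub: "t \<in> I" if "u \<le> t" "t \<le> v" for t
        using sol uv that unfolding solution_iff is_interval_1 by blast
      obtain z where "u < z" "z < v" "\<phi> v - \<phi> u = (v - u) * vector_derivative \<phi> (at z)"
        using MVT2[OF uv(3), of \<phi> "\<lambda>t. vector_derivative \<phi> (at t)"] d sub by blast
      then show False using eq uv 1(3) sub[of z] by auto
    qed
    fix u v assume "u \<in> I" "v \<in> I" "\<phi> u = \<phi> v" "u \<noteq> v"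
    then show False using no[of u v] no[of v u] by (cases "u < v") auto
  qed
  then show ?thesis using that 1 onto by blast
qed

section \<open>Symmetries\<close>

text \<open>For \<open>e = 1\<close> or \<open>e = -1\<close> these are the motions that respect the equation. The height \<open>y\<close> occurs in the equation, so
vertical translations do not.\<close>

definition symmetry :: "real \<Rightarrow> real \<Rightarrow> real^2 \<Rightarrow> real^2" where
  "symmetry e a p = vector [p $ 1 + a, e * p $ 2]"

lemma symmetry_nth [simp]: "symmetry e a p $ 1 = p $ 1 + a" "symmetry e a p $ 2 = e * p $ 2"
  by (simp_all add: symmetry_def)

lemma symmetry_motion: "e \<in> {-1, 1} \<Longrightarrow> symmetry e a \<in> motions"
proof -
  have "symmetry 1 a = (\<lambda>p. p + vector [a, 0])" "symmetry (-1) a = (\<lambda>p. reflect_x p + vector [a, 0])"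
    by (auto simp: fun_eq_iff reflect_x_def intro!: vec2_eqI)
  then show "e \<in> {-1, 1} \<Longrightarrow> symmetry e a \<in> motions" by (auto simp: motions_def)
qed

lemma symmetry_solution:
  assumes e: "e \<in> {-1, 1}" and sol: "solution I Y"
  shows "solution I (symmetry e a \<circ> Y)"
proof -
  have I: "open I" "smooth_on I Y" using sol by (auto simp: solution_iff)
  define F where "F n t = (vector [vderiv n Y t $ 1 + (if n = 0 then a else 0), e * vderiv n Y t $ 2] :: real^2)" for n t
  have F: "(F n has_vector_derivative F (Suc n) t) (at t)" if "t \<in> I" for n t
  proof -
    note d = has_vector_derivative_vec_nth[OF smooth_onD[OF I(2) that, of n]]
    show ?thesis unfolding F_def
      using DERIV_add[OF d[of 1] DERIV_const] DERIV_cmult[OF d[of 2], of e]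
      by (intro has_vector_derivative_vector2) simp_all
  qed
  have F0: "F 0 = symmetry e a \<circ> Y" by (auto simp: F_def symmetry_def fun_eq_iff)
  have "smooth_on I (symmetry e a \<circ> Y)" using smooth_on_tower[OF I(1), of F, OF F] F0 by simp
  moreover have "soliton_at (symmetry e a \<circ> Y) u" if u: "u \<in> I" for u
  proof -
    have v: "vderiv n (symmetry e a \<circ> Y) u = F n u" for n
      using vderiv_tower[OF I(1), of F u n, OF F u] F0 by simp
    have Yu: "soliton_at Y u" using sol u by (simp add: solution_iff)
    have "F 1 u \<noteq> 0"
      using Yu e by (auto simp: F_def soliton_at_def vec_eq_iff forall_2)
    moreover have "F 1 u $ 1 * F 2 u $ 2 - F 1 u $ 2 * F 2 u $ 1 = ((symmetry e a \<circ> Y) u $ 2 * F 1 u $ 1 - F 1 u $ 2) ^ 3"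
    proof -
      have "F 1 u $ 1 * F 2 u $ 2 - F 1 u $ 2 * F 2 u $ 1
          = e * (vderiv 1 Y u $ 1 * vderiv 2 Y u $ 2 - vderiv 1 Y u $ 2 * vderiv 2 Y u $ 1)"
        by (simp add: F_def algebra_simps)
      also have "\<dots> = e * (Y u $ 2 * vderiv 1 Y u $ 1 - vderiv 1 Y u $ 2) ^ 3"
        using Yu by (simp add: soliton_at_def)
      also have "\<dots> = (e * (Y u $ 2 * vderiv 1 Y u $ 1 - vderiv 1 Y u $ 2)) ^ 3"
        using e by (auto simp: power_mult_distrib)
      finally show ?thesis by (simp add: F_def algebra_simps)
    qed
    ultimately show ?thesis unfolding soliton_at_def v by simp
  qed
  ultimately show ?thesis using sol by (simp add: solution_iff)
qed

lemma symmetry_maximal: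
  assumes e: "e \<in> {-1, 1}" and max: "maximal_solution I Y"
  shows "maximal_solution I (symmetry e a \<circ> Y)"
  unfolding maximal_solution_def
proof (intro conjI allI impI)
  show "solution I (symmetry e a \<circ> Y)" using max symmetry_solution[OF e] by (simp add: maximal_solution_def)
  fix K Z \<phi>
  assume H: "solution K Z \<and> smooth_on I \<phi> \<and> (\<forall>u\<in>I. vector_derivative \<phi> (at u) \<noteq> 0) \<and>
      \<phi> ` I \<subseteq> K \<and> (\<forall>u\<in>I. (symmetry e a \<circ> Y) u = Z (\<phi> u))"
  have inv: "symmetry e (- a) (symmetry e a p) = p" for p
    using e by (intro vec2_eqI) auto
  have "Y u = (symmetry e (- a) \<circ> Z) (\<phi> u)" if "u \<in> I" for u
    using H that inv by (metis comp_apply)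
  moreover have "solution K (symmetry e (- a) \<circ> Z)" using H by (intro symmetry_solution e) auto
  ultimately show "\<phi> ` I = K" using H max unfolding maximal_solution_def by blast
qed

section \<open>The phase portrait\<close>

lemma eventually_right_pos:
  fixes g :: "real \<Rightarrow> real"
  assumes "isCont g a" "g a > 0"
  shows "\<forall>\<^sub>F t in at_right a. g t > 0"
proof -
  have "(g \<longlongrightarrow> g a) (at_right a)" using assms(1) by (simp add: filterlim_at_split isCont_def)
  then show ?thesis using assms(2) by (rule order_tendstoD)
qed

lemma eventually_right_increasing:
  fixes g :: "real \<Rightarrow> real"
  assumes "(g has_real_derivative d) (at a)" "d > 0"
  shows "\<forall>\<^sub>F t in at_right a. g t > g a"
proof -
  obtain e where e: "e > 0" "\<And>h. 0 < h \<Longrightarrow> h < e \<Longrightarrow> g a < g (a + h)"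
    using DERIV_pos_inc_right[OF assms] by blast
  have "g a < g t" if "a < t" "t < a + e" for t using e(2)[of "t - a"] that by simp
  then show ?thesis unfolding eventually_at_right_field using e(1) by (intro exI[of _ "a + e"]) auto
qed

lemma eventually_right_ex:
  assumes "\<forall>\<^sub>F t in at_right (a::real). P t" "a < b"
  obtains t where "a < t" "t < b" "P t"
proof -
  obtain q where q: "q > a" "\<And>t. a < t \<Longrightarrow> t < q \<Longrightarrow> P t"
    using assms(1) unfolding eventually_at_right_field by blast
  obtain t where "a < t" "t < min q b" using dense[of a "min q b"] q(1) assms(2) by auto
  then show ?thesis using that q by auto
qed

text \<open>The function called \<open>c\<close> is the derivative of \<open>x\<close>; the lemma is used for both coordinates of a trajectory.\<close>

lemma linear_growth:
  fixes x c :: "real \<Rightarrow> real"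
  assumes "\<And>t. (x has_real_derivative c t) (at t)" "\<delta> > 0" "\<And>t. t \<ge> b \<Longrightarrow> c t \<ge> \<delta>"
  shows "filterlim x at_top at_top"
proof -
  have ge: "x t \<ge> x b + \<delta> * (t - b)" if "t \<ge> b" for t
  proof (cases "t = b")
    case False
    then have "b < t" using that by simp
    then obtain z where "z > b" "x t - x b = (t - b) * c z" using MVT2[of b t x c] assms(1) by blast
    moreover have "(t - b) * \<delta> \<le> (t - b) * c z" using assms(3)[of z] \<open>z > b\<close> \<open>b < t\<close> by (intro mult_left_mono) auto
    ultimately show ?thesis by (simp only: mult.commute[of \<delta>])
  qed simp
  show ?thesis
    unfolding filterlim_at_top
  proof
    fix Z
    show "\<forall>\<^sub>F t in at_top. Z \<le> x t"
      unfolding eventually_at_top_linorder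
    proof (intro exI[of _ "max b (b + (Z - x b) / \<delta>)"] allI impI)
      fix t assume "max b (b + (Z - x b) / \<delta>) \<le> t"
      then have "t \<ge> b" "(Z - x b) / \<delta> \<le> t - b" by auto
      then have "Z - x b \<le> \<delta> * (t - b)" using \<open>\<delta> > 0\<close> by (simp add: pos_divide_le_eq mult.commute)
      then show "Z \<le> x t" using ge[OF \<open>t \<ge> b\<close>] by simp
    qed
  qed
qed

context soliton
begin

abbreviation v :: "real \<Rightarrow> real" where "v t \<equiv> y t * c t - s t"

lemma dv: "((\<lambda>t. v t) has_real_derivative s t * c t - y t * (v t ^ 3 * s t) - v t ^ 3 * c t) (at t)"
  by (rule derivative_eq_intros dy dc ds refl)+ simp

lemma isCont_v: "isCont (\<lambda>t. v t) t" using dv by (rule DERIV_isCont)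

text \<open>At a vertical tangent \<open>s^2 = 1\<close> and hence \<open>c' = s^4 = 1\<close>: such tangents are passed only from left-going to
right-going.\<close>

lemma vertical_after: "c a \<ge> 0 \<Longrightarrow> a < t \<Longrightarrow> c t > 0"
proof (rule upcrossing[of a t c, OF _ dc])
  fix t assume "c t = 0"
  then have "(s t)\<^sup>2 = 1" using unit[of t] by simp
  then have "- ((y t * c t - s t) ^ 3 * s t) = 1" using \<open>c t = 0\<close> by algebra
  then show "0 < - ((y t * c t - s t) ^ 3 * s t)" by simp
qed

lemma x_strict:
  assumes "c a \<ge> 0" "a \<le> t" "t < u"
  shows "x t < x u"
proof -
  obtain z where "t < z" "x u - x t = (u - t) * c z" using MVT2[OF \<open>t < u\<close>, of x c] dx by blast
  moreover have "c z > 0" using vertical_after[of a z] assms \<open>t < z\<close> by simp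
  then have "0 < (u - t) * c z" using \<open>t < u\<close> by simp
  ultimately show ?thesis by linarith
qed

text \<open>Where \<open>s = 0\<close>, the tangent is horizontal and \<open>s' = y^3\<close>; so \<open>s\<close> stays positive as long as \<open>y\<close> is positive. While \<open>s\<close>
is positive, \<open>y\<close> increases.\<close>

lemma quadrant1_open:
  assumes "y a > 0" "s a \<ge> 0" "a < t"
  shows "y t > 0 \<and> s t > 0"
proof -
  have s_pos: "s r > 0" if "a < r" and pos: "\<And>q. a \<le> q \<Longrightarrow> q \<le> r \<Longrightarrow> y q > 0" for r
  proof (rule upcrossing[OF \<open>a < r\<close> ds _ \<open>s a \<ge> 0\<close>])
    fix q assume q: "a \<le> q" "q \<le> r" "s q = 0"
    then have "(c q)\<^sup>2 = 1" using unit[of q] by simp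
    then have "(y q * c q - s q) ^ 3 * c q = (y q) ^ 3" using q(3) by algebra
    then show "0 < (y q * c q - s q) ^ 3 * c q" using pos q by simp
  qed
  have y_pos: "y r > 0" if "a \<le> r" for r
  proof (rule ccontr)
    assume "\<not> y r > 0"
    then have "a < r" using that assms(1) by (cases "a = r") auto
    obtain e where e: "a < e" "e \<le> r" "y e = 0" "\<And>q. a \<le> q \<Longrightarrow> q < e \<Longrightarrow> y q > 0"
      using first_zero[of a r y] \<open>a < r\<close> \<open>\<not> y r > 0\<close> assms(1) by (auto simp: not_less)
    obtain z where z: "a < z" "z < e" "y e - y a = (e - a) * s z"
      using MVT2[OF \<open>a < e\<close>, of y s] dy by blast
    then have "s z > 0" using s_pos[of z] e by auto
    then have "0 < (e - a) * s z" using e(1) by simp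
    then show False using z(3) e(3) assms(1) by simp
  qed
  show ?thesis using s_pos[OF \<open>a < t\<close>] y_pos assms(3) by auto
qed

lemma quadrant1:
  assumes "y a \<ge> 0" "s a \<ge> 0" "y a \<noteq> 0 \<or> s a \<noteq> 0" "a < t"
  shows "y t > 0 \<and> s t > 0"
proof (cases "y a > 0")
  case True then show ?thesis using quadrant1_open assms by blast
next
  case False
  then have "y a = 0" "s a > 0" using assms by auto
  then have "\<forall>\<^sub>F q in at_right a. y q > 0 \<and> s q > 0"
    using eventually_right_increasing[OF dy[of a]] eventually_right_pos[where g = s and a = a] by (simp add: eventually_conj)
  then obtain q where "a < q" "q < t" "y q > 0 \<and> s q > 0"
    using \<open>a < t\<close> by (rule eventually_right_ex)
  then show ?thesis using quadrant1_open[of q t] by simp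
qed

end

text \<open>The reversal of time and the reflection carry the preceding results to the other parts of the \<open>(y, s)\<close>-plane.\<close>

lemma (in soliton) vertical_before: "c a \<le> 0 \<Longrightarrow> t < a \<Longrightarrow> c t < 0"
  using soliton.vertical_after[OF reversed, of "- a" "- t"] by simp

lemma (in soliton) quadrant3:
  assumes "y a \<le> 0" "s a \<le> 0" "y a \<noteq> 0 \<or> s a \<noteq> 0" "a < t"
  shows "y t < 0 \<and> s t < 0"
  using soliton.quadrant1[OF reflected, of a t] assms by simp

lemma (in soliton) quadrant4:
  assumes "y a \<ge> 0" "s a \<le> 0" "y a \<noteq> 0 \<or> s a \<noteq> 0" "t < a"
  shows "y t > 0 \<and> s t < 0"
  using soliton.quadrant1[OF reversed, of "- a" "- t"] assms by simp

context soliton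
begin

text \<open>At an inflection point the tangent is stationary, \<open>c' = s' = 0\<close>, so that \<open>v' = y' c = s c\<close>.\<close>

lemma v_upcrossing:
  assumes "a < b" "v a \<ge> 0" "\<And>t. a \<le> t \<Longrightarrow> t \<le> b \<Longrightarrow> v t = 0 \<Longrightarrow> s t * c t > 0"
  shows "v b > 0"
  by (rule upcrossing[where g = "\<lambda>t. v t", OF assms(1) dv _ assms(2)]) (simp add: assms(3))

lemma c_mono_on:
  assumes "a \<le> b" "\<And>t. a \<le> t \<Longrightarrow> t \<le> b \<Longrightarrow> v t * s t \<le> 0"
  shows "c a \<le> c b"
proof (rule DERIV_nonneg_imp_nondecreasing[OF assms(1)])
  fix t assume "a \<le> t" "t \<le> b"
  then have "v t ^ 2 * (v t * s t) \<le> 0" using assms(2) mult_nonneg_nonpos[OF zero_le_power2] by blast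
  then have "- (v t ^ 3 * s t) \<ge> 0" by (simp add: power3_eq_cube power2_eq_square mult_ac)
  then show "\<exists>d. (c has_real_derivative d) (at t) \<and> 0 \<le> d" using dc by blast
qed

lemma c_antimono_on:
  assumes "a \<le> b" "\<And>t. a \<le> t \<Longrightarrow> t \<le> b \<Longrightarrow> v t * s t \<ge> 0"
  shows "c b \<le> c a"
proof (rule DERIV_nonpos_imp_nonincreasing[OF assms(1)])
  fix t assume "a \<le> t" "t \<le> b"
  then have "v t ^ 2 * (v t * s t) \<ge> 0" using assms(2) mult_nonneg_nonneg[OF zero_le_power2] by blast
  then have "- (v t ^ 3 * s t) \<le> 0" by (simp add: power3_eq_cube power2_eq_square mult_ac)
  then show "\<exists>d. (c has_real_derivative d) (at t) \<and> d \<le> 0" using dc by blast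
qed

lemma s_mono_on:
  assumes "a \<le> b" "\<And>t. a \<le> t \<Longrightarrow> t \<le> b \<Longrightarrow> v t * c t \<ge> 0"
  shows "s a \<le> s b"
proof (rule DERIV_nonneg_imp_nondecreasing[OF assms(1)])
  fix t assume "a \<le> t" "t \<le> b"
  then have "v t ^ 2 * (v t * c t) \<ge> 0" using assms(2) mult_nonneg_nonneg[OF zero_le_power2] by blast
  then have "v t ^ 3 * c t \<ge> 0" by (simp add: power3_eq_cube power2_eq_square mult_ac)
  then show "\<exists>d. (s has_real_derivative d) (at t) \<and> 0 \<le> d" using ds by blast
qed

lemma s_antimono_on:
  assumes "a \<le> b" "\<And>t. a \<le> t \<Longrightarrow> t \<le> b \<Longrightarrow> v t * c t \<le> 0"
  shows "s b \<le> s a"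
  using soliton.s_mono_on[OF reflected assms(1)] assms(2) by (simp add: algebra_simps)

text \<open>If \<open>c\<close> were positive in all the past, then backwards in time \<open>s\<close> would decrease, so \<open>v \<ge> - s \<ge> \<delta>\<close> and
\<open>c' = - v^3 s \<ge> \<delta>^4\<close>, where \<open>\<delta>\<close> is the value of \<open>- s\<close> at some time: then \<open>c\<close> cannot stay positive.\<close>

lemma reaches_vertical:
  assumes "y a \<ge> 0" "s a \<le> 0" "y a \<noteq> 0 \<or> s a \<noteq> 0"
  shows "\<exists>t<a. c t \<le> 0"
proof (rule ccontr)
  assume "\<not> (\<exists>t<a. c t \<le> 0)"
  then have c_pos: "c t > 0" if "t < a" for t using that by (auto simp: not_le)
  define b where "b = a - 1"
  define \<delta> where "\<delta> = - s b"
  have Q: "y t > 0 \<and> s t < 0" if "t \<le> b" for t using quadrant4[OF assms, of t] that by (simp add: b_def)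
  have v_pos: "v t > 0" if "t \<le> b" for t
  proof -
    have "y t * c t > 0" using Q[OF that] c_pos[of t] that by (simp add: b_def)
    then show ?thesis using Q[OF that] by simp
  qed
  have \<delta>: "\<delta> > 0" using Q[of b] by (simp add: \<delta>_def)
  have s_le: "- s t \<ge> \<delta>" if "t \<le> b" for t
    using s_mono_on[OF that] v_pos c_pos that by (simp add: \<delta>_def b_def less_imp_le)
  have "v t ^ 3 * - s t \<ge> \<delta> ^ 3 * \<delta>" if "t \<le> b" for t
  proof -
    have "y t * c t \<ge> 0" using Q[OF that] c_pos[of t] that by (simp add: b_def less_imp_le)
    then have "v t \<ge> \<delta>" using s_le[OF that] by simp
    then show ?thesis using s_le[OF that] \<delta> by (intro mult_mono power_mono) auto
  qed
  then have rate: "- (v t ^ 3 * s t) \<ge> \<delta> ^ 4" if "t \<le> b" for t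
    using that by (simp add: power4_eq_xxxx power3_eq_cube)
  \<comment> \<open>Backwards from \<open>b\<close>, where \<open>c \<le> 1\<close>, the value of \<open>c\<close> would drop by 2 until the time \<open>d\<close>.\<close>
  define d where "d = b - 2 / \<delta> ^ 4"
  have d: "d < b" using \<delta> by (simp add: d_def)
  obtain z where z: "d < z" "z < b" "c b - c d = (b - d) * - (v z ^ 3 * s z)"
    using MVT2[OF d, of c "\<lambda>z. - (v z ^ 3 * s z)"] dc by blast
  have "c b - c d \<ge> (b - d) * \<delta> ^ 4" unfolding z(3) using rate[of z] z d by (intro mult_left_mono) auto
  also have "(b - d) * \<delta> ^ 4 = 2" using \<delta> by (simp add: d_def)
  finally show False using cs_bound(1)[of b] c_pos[of d] d by (simp add: b_def)
qed

text \<open>It suffices to bound the slope under the assumption that \<open>x\<close> is bounded.\<close>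

lemma x_at_top:
  assumes mono: "\<And>t. t \<ge> b \<Longrightarrow> c t > 0"
    and slope: "\<And>B. (\<And>t. t \<ge> b \<Longrightarrow> x t \<le> B) \<Longrightarrow> \<exists>\<delta>>0. \<forall>t\<ge>b. c t \<ge> \<delta>"
  shows "filterlim x at_top at_top"
proof (cases "\<exists>B. \<forall>t\<ge>b. x t \<le> B")
  case True
  then obtain \<delta> where "\<delta> > 0" "\<And>t. t \<ge> b \<Longrightarrow> c t \<ge> \<delta>" using slope by blast
  then show ?thesis using linear_growth[OF dx] by blast
next
  case False
  show ?thesis unfolding filterlim_at_top
  proof
    fix Z
    obtain q where q: "q \<ge> b" "x q > Z" using False by (metis not_le)
    have "Z \<le> x t" if "t \<ge> q" for t
    proof -
      have "x q \<le> x t" using that q mono dx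
        by (intro DERIV_nonneg_imp_nondecreasing[OF that]) (meson less_imp_le order_trans)
      then show ?thesis using q by simp
    qed
    then show "\<forall>\<^sub>F t in at_top. Z \<le> x t" by (auto simp: eventually_at_top_linorder)
  qed
qed

text \<open>As long as \<open>v \<le> 0\<close>, the curve gets flatter. Once \<open>v > 0\<close>, the slope is less than the height, which therefore grows
at most exponentially in \<open>x\<close>; if \<open>x\<close> were bounded, so would be the height and the slope.\<close>

lemma x_at_top_quadrant1:
  assumes Q: "\<And>t. t \<ge> a \<Longrightarrow> c t > 0 \<and> y t > 0 \<and> s t > 0"
  shows "filterlim x at_top at_top"
proof (cases "\<exists>b\<ge>a. v b > 0")
  case False
  have "c a \<le> c t" if "t \<ge> a" for t
  proof (rule c_mono_on[OF that])
    show "v r * s r \<le> 0" if "a \<le> r" for r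
      using Q[OF that] False that by (intro mult_nonpos_nonneg) (auto simp: not_less)
  qed
  then show ?thesis using linear_growth[OF dx, of "c a" a] Q[of a] by simp
next
  case True
  then obtain b where b: "b \<ge> a" "v b > 0" by blast
  have v_pos: "v t > 0" if "t \<ge> b" for t
  proof (cases "t = b")
    case False
    then show ?thesis using that b Q by (intro v_upcrossing[of b t]) auto
  qed (use b in simp)
  show ?thesis
  proof (rule x_at_top[of b])
    show "c t > 0" if "t \<ge> b" for t using Q[of t] b that by simp
    fix B assume B: "\<And>t. t \<ge> b \<Longrightarrow> x t \<le> B"
    define Y where "Y = y b * exp (B - x b)"
    \<comment> \<open>\<open>y * exp (- x)\<close> decreases, its derivative being \<open>- v * exp (- x)\<close>.\<close>
    have Y_bound: "y t \<le> Y" if t: "t \<ge> b" for t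
    proof -
      have "y t * exp (- x t) \<le> y b * exp (- x b)"
      proof (rule DERIV_nonpos_imp_nonincreasing[OF t, where f = "\<lambda>t. y t * exp (- x t)"])
        fix r assume r: "b \<le> r" "r \<le> t"
        have "((\<lambda>t. y t * exp (- x t)) has_real_derivative - v r * exp (- x r)) (at r)"
          by (rule derivative_eq_intros dy dx refl)+ (simp add: algebra_simps)
        moreover have "- v r * exp (- x r) \<le> 0" using v_pos[OF r(1)] by (intro mult_nonpos_nonneg) auto
        ultimately show "\<exists>d. ((\<lambda>t. y t * exp (- x t)) has_real_derivative d) (at r) \<and> d \<le> 0" by blast
      qed
      then have "y t * exp (- x t) * exp (x t) \<le> y b * exp (- x b) * exp (x t)" by (intro mult_right_mono) auto
      then have "y t \<le> y b * exp (x t - x b)" by (simp add: mult.assoc flip: exp_add)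
      also have "\<dots> \<le> Y" unfolding Y_def using B[OF t] Q[of b] b by (intro mult_left_mono) auto
      finally show ?thesis .
    qed
    have Y0: "Y > 0" using Q[of b] b by (simp add: Y_def)
    have "c t \<ge> 1 / (1 + Y)" if t: "t \<ge> b" for t
    proof -
      have c: "c t > 0" "s t > 0" using Q[of t] b t by auto
      have "s t \<le> y t * c t" using v_pos[OF t] by simp
      also have "\<dots> \<le> Y * c t" using Y_bound[OF t] c by (intro mult_right_mono) auto
      finally have "s t \<le> Y * c t" .
      moreover have "1 \<le> c t + s t"
      proof -
        have "1\<^sup>2 \<le> (c t + s t)\<^sup>2" using unit[of t] c by (simp add: power2_sum)
        then show ?thesis using c by (intro power2_le_imp_le[of 1 "c t + s t"]) auto
      qed
      ultimately show ?thesis using Y0 by (simp add: field_simps)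
    qed
    then show "\<exists>\<delta>>0. \<forall>t\<ge>b. c t \<ge> \<delta>" using Y0 by (intro exI[of _ "1 / (1 + Y)"]) auto
  qed
qed

lemma x_at_top_quadrant4:
  assumes Q: "\<And>t. t \<ge> a \<Longrightarrow> c t > 0 \<and> y t > 0 \<and> s t < 0"
  shows "filterlim x at_top at_top"
proof (rule linear_growth[OF dx, of "c a" a])
  show "c a > 0" using Q by simp
  show "c a \<le> c t" if "t \<ge> a" for t
  proof (rule c_mono_on[OF that])
    fix r assume "a \<le> r"
    then have "y r * c r > 0" "s r < 0" using Q by auto
    then show "v r * s r \<le> 0" by (intro mult_nonneg_nonpos) auto
  qed
qed

text \<open>A rising curve with \<open>v \<le> 0\<close> forever gets flatter, so \<open>c\<close> stays above a positive constant. Then the height grows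
linearly, and \<open>s \<ge> y c\<close> grows with it, although \<open>s \<le> 1\<close>.\<close>

lemma inflection_exists:
  assumes Q: "\<And>t. t \<ge> a \<Longrightarrow> c t > 0 \<and> y t > 0 \<and> s t > 0"
  shows "\<exists>b\<ge>a. v b > 0"
proof (rule ccontr)
  assume "\<not> (\<exists>b\<ge>a. v b > 0)"
  then have v_le: "v t \<le> 0" if "t \<ge> a" for t using that by (meson not_less)
  have c_ge: "c a \<le> c t" if "t \<ge> a" for t
    using Q v_le by (intro c_mono_on[OF that] mult_nonpos_nonneg) (auto intro: less_imp_le)
  have y_ge: "y a \<le> y t" if "t \<ge> a" for t
    using Q dy by (intro DERIV_nonneg_imp_nondecreasing[OF that]) (meson less_imp_le)
  have s_ge: "s t \<ge> y t * c a" if "t \<ge> a" for t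
  proof -
    have "y t * c a \<le> y t * c t" using c_ge[OF that] Q[OF that] by (intro mult_left_mono) auto
    then show ?thesis using v_le[OF that] by simp
  qed
  have "s t \<ge> y a * c a" if "t \<ge> a" for t
  proof -
    have "y a * c a \<le> y t * c a" using y_ge[OF that] Q[of a] by (intro mult_right_mono) auto
    then show ?thesis using s_ge[OF that] by simp
  qed
  then have "filterlim y at_top at_top"
    using linear_growth[OF dy, of "y a * c a" a] Q[of a] by simp
  then have "\<forall>\<^sub>F t in at_top. y t \<ge> 2 / c a \<and> t \<ge> a"
    by (intro eventually_conj eventually_ge_at_top) (simp add: filterlim_at_top)
  then obtain t where t: "y t \<ge> 2 / c a" "t \<ge> a" using eventually_happens'[OF trivial_limit_at_top_linorder] by blast
  then have "y t * c a \<ge> 2" using Q[of a] by (simp add: field_simps)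
  then show False using s_ge[OF t(2)] cs_bound(2)[of t] by simp
qed

lemma inflection_time:
  assumes Q: "\<And>t. t > a \<Longrightarrow> c t > 0 \<and> y t > 0 \<and> s t > 0" and "v a < 0"
  obtains b where "a < b" "\<And>t. a < t \<Longrightarrow> t < b \<Longrightarrow> v t < 0" "\<And>t. t > b \<Longrightarrow> v t > 0"
proof -
  obtain d where d: "d \<ge> a + 1" "v d > 0" using inflection_exists[of "a + 1"] Q by auto
  obtain b where b: "a \<le> b" "b \<le> d" "v b = 0"
    using IVT'[of v a 0 d] d \<open>v a < 0\<close> isCont_v by (force intro: continuous_at_imp_continuous_on)
  then have "a < b" using \<open>v a < 0\<close> by (cases "a = b") auto
  have "v t < 0" if "a < t" "t < b" for t
  proof (rule ccontr)
    assume "\<not> v t < 0"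
    then have "v b > 0" using that Q by (intro v_upcrossing[of t b]) auto
    then show False using b by simp
  qed
  moreover have "v t > 0" if "t > b" for t
    using that Q b \<open>a < b\<close> by (intro v_upcrossing[of b t]) auto
  ultimately show ?thesis using that \<open>a < b\<close> by blast
qed

text \<open>If \<open>v \<le> 0\<close> at some time, then also at all earlier times; so the curve was steeper in the past and came from
below the x-axis.\<close>

lemma entire_convex:
  assumes Q: "\<And>t. c t > 0 \<and> y t > 0 \<and> s t > 0"
  shows "v t > 0"
proof (rule ccontr)
  assume "\<not> v t > 0"
  then have t: "v t \<le> 0" by simp
  have v_le: "v r \<le> 0" if "r \<le> t" for r
    using v_upcrossing[of r t] Q t that by (cases "r = t") force+
  have s_ge: "s r \<ge> s t" if "r \<le> t" for r
    using Q v_le by (intro s_antimono_on[OF that] mult_nonpos_nonneg) (auto intro: less_imp_le)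
  define r where "r = t - y t / s t"
  have "s t > 0" "y t > 0" using Q by auto
  then have r: "r < t" by (simp add: r_def)
  obtain z where z: "r < z" "z < t" "y t - y r = (t - r) * s z" using MVT2[OF r, of y s] dy by blast
  have "(t - r) * s t \<le> (t - r) * s z" using z s_ge r by (intro mult_left_mono) auto
  moreover have "(t - r) * s t = y t" using \<open>s t > 0\<close> by (simp add: r_def)
  ultimately show False using z(3) Q[of r] by simp
qed

text \<open>Height and direction are monotone and bounded, so they converge; then \<open>y'\<close> and \<open>s'\<close> converge and their limits must be
0. The limit of \<open>y'\<close> is that of \<open>s\<close>, and the limit of \<open>s'\<close> is the cube of that of \<open>y\<close>. The sign \<open>e\<close> is needed since the
lemma is applied both to trajectories going to the right and to reversed trajectories, going to the left.\<close>

lemma y_decays: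
  assumes e: "e \<in> {-1, 1}"
    and Q: "\<And>t. t \<ge> a \<Longrightarrow> y t > 0 \<and> s t < 0 \<and> e * c t > 0 \<and> e * v t > 0"
  shows "(y \<longlongrightarrow> 0) at_top"
proof -
  have anti: "- y t \<le> - y u" if "a \<le> t" "t \<le> u" for t u
  proof -
    have "y u \<le> y t"
      using dy Q that by (intro DERIV_nonpos_imp_nonincreasing[OF that(2)]) (meson less_imp_le order_trans)
    then show ?thesis by simp
  qed
  obtain l where "((\<lambda>t. - y t) \<longlongrightarrow> l) at_top"
    using mono_bounded_tendsto[of a "\<lambda>t. - y t" 0, OF anti] Q by (metis less_imp_le neg_le_0_iff_le)
  then have l: "(y \<longlongrightarrow> - l) at_top" using tendsto_minus_cancel_left by force
  have mono: "s t \<le> s u" if "a \<le> t" "t \<le> u" for t u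
  proof (rule s_mono_on[OF that(2)])
    fix r assume "t \<le> r"
    then have "0 < (e * v r) * (e * c r)" using Q[of r] that by simp
    moreover have "(e * v r) * (e * c r) = v r * c r" using e by auto
    ultimately show "0 \<le> v r * c r" by simp
  qed
  obtain m where m: "(s \<longlongrightarrow> m) at_top"
    using mono_bounded_tendsto[of a s 0, OF mono] Q by (metis less_imp_le)
  have "m = 0" by (rule tendsto_derivative_zero[OF dy l m])
  then have s0: "(s \<longlongrightarrow> 0) at_top" using m by simp
  have "((\<lambda>t. e * sqrt (1 - (s t)\<^sup>2)) \<longlongrightarrow> e * sqrt (1 - 0\<^sup>2)) at_top"
    by (intro tendsto_intros s0)
  moreover have "\<forall>\<^sub>F t in at_top. e * sqrt (1 - (s t)\<^sup>2) = c t"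
  proof (rule eventually_mono[OF eventually_ge_at_top[of a]])
    fix t assume "a \<le> t"
    have "1 - (s t)\<^sup>2 = (c t)\<^sup>2" using unit[of t] by simp
    then have "sqrt (1 - (s t)\<^sup>2) = \<bar>c t\<bar>" by simp
    then show "e * sqrt (1 - (s t)\<^sup>2) = c t" using Q[OF \<open>a \<le> t\<close>] e by auto
  qed
  ultimately have c: "(c \<longlongrightarrow> e) at_top" using Lim_transform_eventually by fastforce
  have "((\<lambda>t. v t ^ 3 * c t) \<longlongrightarrow> (- l * e - 0) ^ 3 * e) at_top"
    by (intro tendsto_intros l c s0)
  then have "(- l * e - 0) ^ 3 * e = 0" by (rule tendsto_derivative_zero[OF ds s0])
  then have "l = 0" using e by auto
  then show ?thesis using l by simp
qed

end

section \<open>Graphs\<close>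

lemma real_homeomorphism_inverse:
  fixes \<xi> :: "real \<Rightarrow> real"
  assumes "strict_mono \<xi>" "\<And>t. isCont \<xi> t" "surj \<xi>"
  shows "\<xi> (inv \<xi> z) = z" "inv \<xi> (\<xi> t) = t" "isCont (inv \<xi>) z" "strict_mono (inv \<xi>)"
proof -
  show 1: "\<xi> (inv \<xi> z) = z" for z using \<open>surj \<xi>\<close> by (rule surj_f_inv_f)
  show 2: "inv \<xi> (\<xi> t) = t" for t using strict_mono_imp_inj_on[OF assms(1)] by (rule inv_f_f)
  have "isCont (inv \<xi>) (\<xi> (inv \<xi> z))"
    using isCont_inverse_function[of 1 "inv \<xi> z" "inv \<xi>" \<xi>] 2 assms(2) by simp
  then show "isCont (inv \<xi>) z" by (simp add: 1)
  show "strict_mono (inv \<xi>)"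
    by (rule strict_monoI) (metis 1 assms(1) strict_mono_less)
qed

text \<open>The second order equation \<open>f'' = (f - f')^3\<close> as a system, with \<open>p\<close> the slope.\<close>

definition graph_solution :: "real set \<Rightarrow> (real \<Rightarrow> real) \<Rightarrow> (real \<Rightarrow> real) \<Rightarrow> bool" where
  "graph_solution S f p \<longleftrightarrow> (\<forall>z\<in>S. (f has_real_derivative p z) (at z) \<and>
     (p has_real_derivative (f z - p z) ^ 3) (at z))"

lemma graph_solution_smooth:
  assumes "open S" "graph_solution S f p"
  shows "smooth_on S f"
proof (rule polynomials_in_smooth[OF \<open>open S\<close>, of "{f, p}"])
  have mem: "f \<in> polynomials_in {f, p}" "p \<in> polynomials_in {f, p}" by (auto intro: pol_gen)
  then show "f \<in> polynomials_in {f, p}" by simp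
  fix g assume "g \<in> {f, p}"
  then consider "g = f" | "g = p" by auto
  then show "\<exists>h\<in>polynomials_in {f, p}. \<forall>t\<in>S. (g has_real_derivative h t) (at t)"
  proof cases
    case 1 then show ?thesis using assms(2) mem by (intro bexI[of _ p]) (auto simp: graph_solution_def)
  next
    case 2 then show ?thesis using assms(2)
      by (intro bexI[of _ "\<lambda>z. (f z - p z) ^ 3"] pol_power pol_diff mem) (auto simp: graph_solution_def)
  qed
qed

lemma graph_solution_deriv:
  assumes "open S" "graph_solution S f p" "z \<in> S"
  shows "deriv f z = p z" "deriv (deriv f) z = (f z - p z) ^ 3"
proof -
  have 1: "deriv f z = p z" if "z \<in> S" for z
    using assms(2) that by (auto simp: graph_solution_def intro: DERIV_imp_deriv)
  then show "deriv f z = p z" using assms(3) by simp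
  have "(p has_real_derivative (f z - p z) ^ 3) (at z)" using assms by (auto simp: graph_solution_def)
  then have "(deriv f has_real_derivative (f z - p z) ^ 3) (at z)"
    by (rule has_field_derivative_transform_within_open[OF _ assms(1,3)]) (simp add: 1)
  then show "deriv (deriv f) z = (f z - p z) ^ 3" by (rule DERIV_imp_deriv)
qed

text \<open>The slope is \<open>s / c\<close>, the inverse of \<open>x\<close> has derivative \<open>1 / c\<close>, and \<open>f - p = v / c\<close>. The homeomorphism \<open>\<xi>\<close>
replaces \<open>x\<close> outside \<open>T\<close>, because for curves with a vertical tangent \<open>x\<close> itself is injective only on a half line.\<close>

lemma (in soliton) graph_solution_inv:
  assumes \<xi>: "strict_mono \<xi>" "\<And>t. isCont \<xi> t" "surj \<xi>"
    and T: "open T" "\<And>t. t \<in> T \<Longrightarrow> \<xi> t = x t" "\<And>t. t \<in> T \<Longrightarrow> c t > 0"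
  shows "graph_solution (\<xi> ` T) (\<lambda>z. y (inv \<xi> z)) (\<lambda>z. s (inv \<xi> z) / c (inv \<xi> z))"
  unfolding graph_solution_def
proof
  note inv = real_homeomorphism_inverse[OF \<xi>]
  define \<tau> where "\<tau> = inv \<xi>"
  fix z assume "z \<in> \<xi> ` T"
  then have T\<tau>: "\<tau> z \<in> T" using inv(2) by (auto simp: \<tau>_def)
  then have c: "c (\<tau> z) > 0" by (rule T(3))
  have "(\<xi> has_real_derivative c (\<tau> z)) (at (\<tau> z))"
    by (rule has_field_derivative_transform_within_open[OF dx T(1) T\<tau>]) (simp add: T(2))
  then have d: "(\<tau> has_real_derivative inverse (c (\<tau> z))) (at z)"
    by (rule DERIV_inverse_function[where a = "z - 1" and b = "z + 1"])
       (use c inv in \<open>auto simp: \<tau>_def\<close>)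
  have "((\<lambda>z. y (\<tau> z)) has_real_derivative s (\<tau> z) / c (\<tau> z)) (at z)"
    using DERIV_chain2[OF dy d] by (simp add: divide_inverse)
  moreover have "((\<lambda>z. s (\<tau> z) / c (\<tau> z)) has_real_derivative (y (\<tau> z) - s (\<tau> z) / c (\<tau> z)) ^ 3) (at z)"
  proof -
    define w where "w = \<tau> z"
    have cw: "c w \<noteq> 0" using c by (simp add: w_def)
    have "((\<lambda>t. s t / c t) has_real_derivative (v w ^ 3 * c w * c w - s w * - (v w ^ 3 * s w)) / (c w * c w)) (at w)"
      by (rule DERIV_divide[OF ds dc cw])
    from DERIV_chain2[OF this[unfolded w_def] d]
    have "((\<lambda>z. s (\<tau> z) / c (\<tau> z)) has_real_derivative
       (v w ^ 3 * c w * c w - s w * - (v w ^ 3 * s w)) / (c w * c w) * inverse (c w)) (at z)"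
      by (simp add: w_def)
    moreover have "(v w ^ 3 * c w * c w - s w * - (v w ^ 3 * s w)) / (c w * c w) * inverse (c w) = (y w - s w / c w) ^ 3"
    proof -
      have "v w ^ 3 * c w * c w - s w * - (v w ^ 3 * s w) = v w ^ 3 * ((c w)\<^sup>2 + (s w)\<^sup>2)" by algebra
      moreover have "y w - s w / c w = v w / c w" using cw by (simp add: field_simps)
      ultimately show ?thesis using cw unit[of w] by (simp add: power_divide power3_eq_cube field_simps)
    qed
    ultimately show ?thesis by (simp add: w_def)
  qed
  ultimately show "((\<lambda>z. y (inv \<xi> z)) has_real_derivative s (inv \<xi> z) / c (inv \<xi> z)) (at z) \<and>
      ((\<lambda>z. s (inv \<xi> z) / c (inv \<xi> z)) has_real_derivative (y (inv \<xi> z) - s (inv \<xi> z) / c (inv \<xi> z)) ^ 3) (at z)"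
    by (simp add: \<tau>_def)
qed

lemma surj_of_limits:
  fixes \<xi> :: "real \<Rightarrow> real"
  assumes "\<And>t. isCont \<xi> t" "filterlim \<xi> at_top at_top" "filterlim \<xi> at_bot at_bot"
  shows "surj \<xi>"
proof -
  have "\<exists>t. \<xi> t = z" for z
  proof -
    obtain b where b: "\<xi> b \<ge> z" using filterlim_at_top[of \<xi> at_top] assms(2)
      eventually_happens'[OF trivial_limit_at_top_linorder] by metis
    obtain a where a: "\<xi> a \<le> z" using filterlim_at_bot[of \<xi> at_bot] assms(3)
      eventually_happens'[OF trivial_limit_at_bot_linorder] by metis
    have cont: "continuous_on S \<xi>" for S using assms(1) by (simp add: continuous_at_imp_continuous_on)
    show ?thesis
    proof (cases "a \<le> b")
      case True then show ?thesis using IVT'[of \<xi> a z b] a b cont by blast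
    next
      case False then show ?thesis using IVT2'[of \<xi> a z b] a b cont by (metis linear)
    qed
  qed
  then show ?thesis unfolding surj_def by metis
qed

text \<open>For a trajectory with a vertical tangent on the y-axis at time 0: the part after it is the graph of \<open>f\<close>, with slope \<open>p\<close>. It
starts upwards if \<open>s 0 = 1\<close> and downwards if \<open>s 0 = -1\<close>.\<close>

definition (in soliton) right_branch :: "(real \<Rightarrow> real) \<Rightarrow> (real \<Rightarrow> real) \<Rightarrow> bool" where
  "right_branch f p \<longleftrightarrow> graph_solution {0<..} f p \<and> continuous_on {0..} f \<and>
     (\<forall>t\<ge>0. f (x t) = y t) \<and> (\<forall>t>0. p (x t) = s t / c t) \<and> (\<forall>z\<ge>0. \<exists>t\<ge>0. x t = z) \<and>
     (s 0 = 1 \<longrightarrow> filterlim p at_top (at_right 0)) \<and> (s 0 = -1 \<longrightarrow> filterlim p at_bot (at_right 0))"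

lemma (in soliton) right_branch_exists:
  assumes "x 0 = 0" "c 0 = 0" and lim: "filterlim x at_top at_top"
  obtains f p where "right_branch f p"
proof -
  \<comment> \<open>Extending \<open>x\<close> by the identity to negative times gives a homeomorphism of the real line.\<close>
  define \<xi> where "\<xi> t = (if 0 \<le> t then x t else t)" for t
  have c_pos: "c t > 0" if "t > 0" for t using vertical_after[of 0 t] assms that by simp
  have strict: "x t < x u" if "0 \<le> t" "t < u" for t u using x_strict[of 0 t u] assms that by simp
  have x_pos: "x t > 0" if "t > 0" for t using strict[of 0 t] assms that by simp
  have mono: "strict_mono \<xi>"
  proof (rule strict_monoI)
    fix t u :: real assume "t < u"
    show "\<xi> t < \<xi> u"
    proof (cases "t < 0 \<and> 0 \<le> u")
      case True
      then have "x u \<ge> 0" using x_pos[of u] assms(1) by (cases "u = 0") auto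
      then show ?thesis using True by (simp add: \<xi>_def)
    qed (use strict[of t u] \<open>t < u\<close> in \<open>auto simp: \<xi>_def\<close>)
  qed
  have "continuous_on ({0..} \<union> {..0}) (\<lambda>t. if 0 \<le> t then x t else t)"
    using assms(1) by (intro continuous_on_If) (auto intro: continuous_at_imp_continuous_on)
  moreover have "{0..} \<union> {..0} = (UNIV :: real set)" by auto
  ultimately have "continuous_on UNIV \<xi>" by (simp add: \<xi>_def[abs_def])
  then have cont: "isCont \<xi> t" for t by (simp add: continuous_on_eq_continuous_at)
  have "\<forall>\<^sub>F t in at_top. x t = \<xi> t"
    using eventually_ge_at_top[of 0] by eventually_elim (simp add: \<xi>_def)
  then have top: "filterlim \<xi> at_top at_top" using lim by (rule filterlim_cong[OF refl refl, THEN iffD1])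
  have "\<forall>\<^sub>F t in at_bot. t = \<xi> t"
    using eventually_gt_at_bot[of 0] eventually_le_at_bot[of "-1"] by eventually_elim (simp add: \<xi>_def)
  then have bot: "filterlim \<xi> at_bot at_bot" using filterlim_ident by (rule filterlim_cong[OF refl refl, THEN iffD1])
  have surj: "surj \<xi>" by (rule surj_of_limits[OF cont top bot])
  note inv = real_homeomorphism_inverse[OF mono cont surj]
  have \<xi>: "\<xi> t = x t" if "t \<ge> 0" for t using that by (simp add: \<xi>_def)
  have inv0: "inv \<xi> z \<ge> 0 \<longleftrightarrow> z \<ge> 0" "inv \<xi> z > 0 \<longleftrightarrow> z > 0" for z
  proof -
    have "inv \<xi> 0 = 0" using inv(2)[of 0] \<xi>[of 0] assms by simp
    then show "inv \<xi> z \<ge> 0 \<longleftrightarrow> z \<ge> 0" "inv \<xi> z > 0 \<longleftrightarrow> z > 0"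
      using strict_mono_less_eq[OF inv(4), of 0 z] strict_mono_less[OF inv(4), of 0 z] by simp_all
  qed
  have "\<xi> ` {0<..} = {0<..}"
  proof
    show "\<xi> ` {0<..} \<subseteq> {0<..}" using \<xi> x_pos by auto
    show "{0<..} \<subseteq> \<xi> ` {0<..}" using inv0(2) inv(1) by (metis greaterThan_iff image_eqI subsetI)
  qed
  then have gs: "graph_solution {0<..} (\<lambda>z. y (inv \<xi> z)) (\<lambda>z. s (inv \<xi> z) / c (inv \<xi> z))"
    using graph_solution_inv[OF mono cont surj, of "{0<..}"] \<xi> c_pos by simp
  have "filterlim (inv \<xi>) (at_right 0) (at_right 0)"
  proof -
    have "(inv \<xi> \<longlongrightarrow> inv \<xi> 0) (at_right 0)" using inv(3)[of 0] by (simp add: isCont_def filterlim_at_split)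
    moreover have "inv \<xi> 0 = 0" using inv(2)[of 0] \<xi>[of 0] assms by simp
    moreover have "\<forall>\<^sub>F z in at_right 0. inv \<xi> z > 0"
      using eventually_at_right_less[of "0::real"] by eventually_elim (simp add: inv0)
    ultimately show ?thesis by (auto simp: filterlim_at elim: eventually_mono)
  qed
  note slope_lim = filterlim_compose[OF _ this]
  have s0: "(s \<longlongrightarrow> s 0) (at_right 0)" using isCont_s[of 0] by (simp add: isCont_def filterlim_at_split)
  have "filterlim (\<lambda>t. inverse (c t)) at_top (at_right 0)"
  proof (rule filterlim_inverse_at_top)
    show "(c \<longlongrightarrow> 0) (at_right 0)" using isCont_c[of 0] assms by (simp add: isCont_def filterlim_at_split)
    show "\<forall>\<^sub>F t in at_right 0. 0 < c t" using eventually_at_right_less[of "0::real"] by eventually_elim (simp add: c_pos)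
  qed
  then have slope: "s 0 = 1 \<Longrightarrow> filterlim (\<lambda>t. s t / c t) at_top (at_right 0)"
      "s 0 = -1 \<Longrightarrow> filterlim (\<lambda>t. s t / c t) at_bot (at_right 0)"
    using filterlim_tendsto_pos_mult_at_top[OF s0] filterlim_tendsto_neg_mult_at_bot[OF s0]
    by (simp_all add: divide_inverse)
  show ?thesis
  proof (rule that[of "\<lambda>z. y (inv \<xi> z)" "\<lambda>z. s (inv \<xi> z) / c (inv \<xi> z)"], unfold right_branch_def, intro conjI allI impI)
    show "continuous_on {0..} (\<lambda>z. y (inv \<xi> z))"
      using isCont_o2[OF inv(3) isCont_y] by (intro continuous_at_imp_continuous_on ballI)
    show "\<exists>t\<ge>0. x t = z" if "z \<ge> 0" for z using inv(1)[of z] inv0(1)[of z] \<xi> that by metis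
    show "y (inv \<xi> (x t)) = y t" if "t \<ge> 0" for t using inv(2)[of t] \<xi>[OF that] by simp
    show "s (inv \<xi> (x t)) / c (inv \<xi> (x t)) = s t / c t" if "t > 0" for t using inv(2)[of t] \<xi>[of t] that by simp
  qed (use gs slope slope_lim in auto)
qed

lemma mvt_half_line:
  fixes f :: "real \<Rightarrow> real"
  assumes "continuous_on {0..} f" "\<And>z. z > 0 \<Longrightarrow> (f has_real_derivative p z) (at z)" "0 \<le> a" "a < b"
  obtains z where "a < z" "z < b" "f b - f a = (b - a) * p z"
proof -
  have "continuous_on {a..b} f" using assms by (auto intro: continuous_on_subset)
  moreover have "(f has_derivative (\<lambda>h. p z * h)) (at z)" if "a < z" "z < b" for z
    using assms(2)[of z] that assms(3) by (simp add: has_field_derivative_def)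
  ultimately obtain z where "a < z" "z < b" "f b - f a = p z * (b - a)"
    using mvt[OF \<open>a < b\<close>, of f "\<lambda>z h. p z * h"] by blast
  then show ?thesis using that by (simp add: mult.commute)
qed

lemma strict_mono_on_half_line:
  fixes f :: "real \<Rightarrow> real"
  assumes "continuous_on {0..} f" "\<And>z. z > 0 \<Longrightarrow> (f has_real_derivative p z) (at z)" "\<And>z. z > 0 \<Longrightarrow> p z > 0"
  shows "strict_mono_on {0..} f"
proof (rule strict_mono_onI)
  fix a b :: real assume ab: "a \<in> {0..}" "b \<in> {0..}" "a < b"
  obtain z where "a < z" "f b - f a = (b - a) * p z" using mvt_half_line[OF assms(1,2), of a b] ab by auto
  moreover have "p z > 0" using assms(3)[of z] \<open>a < z\<close> ab by simp
  then have "0 < (b - a) * p z" using ab by simp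
  ultimately show "f a < f b" by linarith
qed

lemma strict_antimono_on_half_line:
  fixes f :: "real \<Rightarrow> real"
  assumes "continuous_on {0..} f" "\<And>z. z > 0 \<Longrightarrow> (f has_real_derivative p z) (at z)" "\<And>z. z > 0 \<Longrightarrow> p z < 0"
  shows "strict_antimono_on {0..} f"
proof -
  have "strict_mono_on {0..} (\<lambda>z. - f z)"
    using assms by (intro strict_mono_on_half_line[of _ "\<lambda>z. - p z"] continuous_intros DERIV_minus) auto
  then show ?thesis by (auto simp: monotone_on_def)
qed

lemma convex_on_half_line:
  fixes f :: "real \<Rightarrow> real"
  assumes f: "continuous_on {0..} f" "\<And>z. z > 0 \<Longrightarrow> (f has_real_derivative p z) (at z)"
    and mono: "\<And>a b. 0 < a \<Longrightarrow> a \<le> b \<Longrightarrow> p a \<le> p b"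
  shows "convex_on {0..} f"
proof (rule convex_on_linorderI)
  fix t a b :: real assume t: "0 < t" "t < 1" and ab: "a \<in> {0..}" "b \<in> {0..}" "a < b"
  define m where "m = (1 - t) * a + t * b"
  have ma: "m - a = t * (b - a)" and bm: "b - m = (1 - t) * (b - a)" by (simp_all add: m_def algebra_simps)
  have "0 < m - a" "0 < b - m" unfolding ma bm using t ab by simp_all
  then have am: "a < m" "m < b" by simp_all
  obtain z where z: "a < z" "z < m" "f m - f a = (m - a) * p z" using mvt_half_line[OF f, of a m] ab am by auto
  obtain w where w: "m < w" "w < b" "f b - f m = (b - m) * p w" using mvt_half_line[OF f, of m b] ab am by auto
  have "p z \<le> p w" using mono[of z w] z w ab by simp
  then have "t * (1 - t) * (b - a) * p z \<le> t * (1 - t) * (b - a) * p w"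
    using t ab by (intro mult_left_mono) auto
  moreover have "(1 - t) * (f m - f a) = t * (1 - t) * (b - a) * p z" unfolding z ma by simp
  moreover have "t * (f b - f m) = t * (1 - t) * (b - a) * p w" unfolding w bm by simp
  ultimately have "f m \<le> (1 - t) * f a + t * f b" by (simp add: algebra_simps)
  then show "f ((1 - t) *\<^sub>R a + t *\<^sub>R b) \<le> (1 - t) * f a + t * f b" by (simp add: m_def)
qed simp

text \<open>A single change of sign of the second derivative gives a single inflection point: elsewhere the second
derivative has the same sign on both sides.\<close>

lemma one_inflectionI:
  assumes e: "e \<in> {-1, 1}" and "a > 0"
    and neg: "\<And>z. 0 < z \<Longrightarrow> z < a \<Longrightarrow> e * deriv (deriv f) z < 0"
    and pos: "\<And>z. z > a \<Longrightarrow> e * deriv (deriv f) z > 0"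
  shows "one_inflection f"
  unfolding one_inflection_def
proof (rule ex1I[of _ a])
  show "0 < a \<and> inflection_point f a"
    unfolding inflection_point_def
  proof (intro conjI bexI[OF _ e] \<open>a > 0\<close>)
    show "\<forall>\<^sub>F z in at_left a. e * deriv (deriv f) z < 0"
      unfolding eventually_at_left_field using neg \<open>a > 0\<close> by (intro exI[of _ 0]) auto
    show "\<forall>\<^sub>F z in at_right a. e * deriv (deriv f) z > 0"
      unfolding eventually_at_right_field using pos by (intro exI[of _ "a + 1"]) auto
  qed
  fix b assume b: "0 < b \<and> inflection_point f b"
  then obtain d where d: "d \<in> {-1, 1}" "\<forall>\<^sub>F z in at_left b. d * deriv (deriv f) z < 0"
    "\<forall>\<^sub>F z in at_right b. d * deriv (deriv f) z > 0" unfolding inflection_point_def by blast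
  show "b = a"
  proof (rule ccontr)
    assume "b \<noteq> a"
    obtain l r where lr: "l < b" "b < r" "0 < l" "(r < a \<or> l > a)"
    proof (cases "b < a")
      case True
      then show ?thesis using that[of "b/2" "(a + b)/2"] b by auto
    next
      case False
      then show ?thesis using that[of "(a + b)/2" "b + 1"] b \<open>b \<noteq> a\<close> \<open>a > 0\<close> by auto
    qed
    have same: "(e * deriv (deriv f) z < 0 \<and> e * deriv (deriv f) w < 0) \<or> (e * deriv (deriv f) z > 0 \<and> e * deriv (deriv f) w > 0)"
      if "l < z" "z < r" "l < w" "w < r" for z w
      using that lr neg[of z] neg[of w] pos[of z] pos[of w] by auto
    obtain q where q: "q < b" "\<And>z. q < z \<Longrightarrow> z < b \<Longrightarrow> d * deriv (deriv f) z < 0"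
      using d(2) unfolding eventually_at_left_field by blast
    obtain z where "max q l < z" "z < b" using dense[of "max q l" b] q(1) lr(1) by auto
    then have z: "l < z" "z < b" "d * deriv (deriv f) z < 0" using q(2)[of z] by auto
    obtain w where w: "b < w" "w < r" "d * deriv (deriv f) w > 0"
      using eventually_right_ex[OF d(3) lr(2)] by blast
    show False using same[of z w] z w lr e d(1) by auto
  qed
qed

lemma cube_strict_mono: "a < b \<Longrightarrow> a ^ 3 < (b :: real) ^ 3"
  using real_root_less_iff[of 3 "a ^ 3" "b ^ 3"] odd_real_root_power_cancel[of 3] by simp

text \<open>A maximum principle. If the slopes met for the first time at \<open>e\<close>, then up to there \<open>f1 - f2\<close> would have increased and
so be positive; since \<open>(f - p)^3\<close> increases with \<open>f\<close>, the difference \<open>q\<close> of the slopes would be increasing at \<open>e\<close>,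
although it is positive before.\<close>

lemma graph_comparison:
  assumes 1: "graph_solution {0<..} f1 p1" "continuous_on {0..} f1" "filterlim p1 at_top (at_right 0)"
    and 2: "graph_solution {0<..} f2 p2" "continuous_on {0..} f2" "filterlim p2 at_bot (at_right 0)"
    and "f1 0 = f2 0" "z > 0"
  shows "f1 z > f2 z"
proof -
  have d1: "\<And>z. z > 0 \<Longrightarrow> (f1 has_real_derivative p1 z) (at z)" "\<And>z. z > 0 \<Longrightarrow> (p1 has_real_derivative (f1 z - p1 z) ^ 3) (at z)"
    and d2: "\<And>z. z > 0 \<Longrightarrow> (f2 has_real_derivative p2 z) (at z)" "\<And>z. z > 0 \<Longrightarrow> (p2 has_real_derivative (f2 z - p2 z) ^ 3) (at z)"
    using 1(1) 2(1) by (auto simp: graph_solution_def)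
  define q where "q z = p1 z - p2 z" for z
  have df: "((\<lambda>z. f1 z - f2 z) has_real_derivative q z) (at z)" if "z > 0" for z
    unfolding q_def using d1(1)[OF that] d2(1)[OF that] by (rule DERIV_diff)
  have dq: "(q has_real_derivative (f1 z - p1 z) ^ 3 - (f2 z - p2 z) ^ 3) (at z)" if "z > 0" for z
    unfolding q_def using d1(2)[OF that] d2(2)[OF that] by (rule DERIV_diff)
  have cf: "continuous_on {0..} (\<lambda>z. f1 z - f2 z)" using 1(2) 2(2) by (intro continuous_intros)
  have "\<forall>\<^sub>F z in at_right 0. q z > 0"
    using filterlim_at_top_dense[THEN iffD1, rule_format, OF 1(3), of 0]
      filterlim_at_bot_dense[THEN iffD1, rule_format, OF 2(3), of 0]
    by eventually_elim (simp add: q_def)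
  then obtain \<epsilon> where \<epsilon>: "\<epsilon> > 0" "\<And>z. 0 < z \<Longrightarrow> z < \<epsilon> \<Longrightarrow> q z > 0"
    unfolding eventually_at_right_field by blast
  have diff_pos: "f1 b - f2 b > 0" if "b > 0" "\<And>z. 0 < z \<Longrightarrow> z < b \<Longrightarrow> q z > 0" for b
  proof -
    obtain w where w: "0 < w" "w < b" "(f1 b - f2 b) - (f1 0 - f2 0) = (b - 0) * q w"
      using mvt_half_line[OF cf df, of 0 b] \<open>b > 0\<close> by auto
    then show ?thesis using that(2)[of w] that(1) assms(7) by simp
  qed
  have q_pos: "q b > 0" if "b > 0" for b
  proof (rule ccontr)
    assume nq: "\<not> q b > 0"
    then have "\<epsilon> \<le> b" using \<epsilon>(2)[of b] that by (meson not_less)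
    then have ab: "\<epsilon> / 2 < b" using \<epsilon>(1) by simp
    have half: "q (\<epsilon>/2) > 0" using \<epsilon> by simp
    obtain e where e: "\<epsilon>/2 < e" "e \<le> b" "q e = 0" "\<And>r. \<epsilon>/2 \<le> r \<Longrightarrow> r < e \<Longrightarrow> q r > 0"
    proof (rule first_zero[OF ab, of q])
      show "isCont q t" if "\<epsilon>/2 \<le> t" for t using dq[of t] that \<epsilon>(1) by (intro DERIV_isCont) auto
    qed (use nq half in auto)
    have e0: "e > 0" using e(1) \<epsilon>(1) by simp
    have before: "q r > 0" if "0 < r" "r < e" for r
      using \<epsilon> e(4)[of r] that by (cases "r < \<epsilon>") auto
    have "f1 e > f2 e" using diff_pos[OF e0 before] by simp
    moreover have "p1 e = p2 e" using e(3) by (simp add: q_def)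
    ultimately have "(f2 e - p2 e) ^ 3 < (f1 e - p1 e) ^ 3" by (intro cube_strict_mono) simp
    then have "(f1 e - p1 e) ^ 3 - (f2 e - p2 e) ^ 3 > 0" by simp
    then obtain d where d: "d > 0" "\<And>h. 0 < h \<Longrightarrow> h < d \<Longrightarrow> q (e - h) < q e"
      using DERIV_pos_inc_left[OF dq[OF e0]] by blast
    define h where "h = min (d/2) (e/2)"
    have "0 < h" "h < d" "h < e" using d(1) e0 by (auto simp: h_def min_def)
    then show False using d(2)[of h] before[of "e - h"] e(3) by simp
  qed
  show ?thesis using diff_pos[OF \<open>z > 0\<close>] q_pos by simp
qed

section \<open>Profiles of the branches\<close>

context soliton
begin

lemma right_branch_graph:
  assumes "right_branch f p" "z > 0"
  shows "(f has_real_derivative p z) (at z)" "(p has_real_derivative (f z - p z) ^ 3) (at z)"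
    "deriv f z = p z" "deriv (deriv f) z = (f z - p z) ^ 3"
proof -
  have gs: "graph_solution {0<..} f p" using assms(1) by (simp add: right_branch_def)
  then show "(f has_real_derivative p z) (at z)" "(p has_real_derivative (f z - p z) ^ 3) (at z)"
    using assms(2) by (simp_all add: graph_solution_def)
  show "deriv f z = p z" "deriv (deriv f) z = (f z - p z) ^ 3"
    using graph_solution_deriv[OF open_greaterThan gs, of z] assms(2) by simp_all
qed

lemma x_less_iff: "c 0 = 0 \<Longrightarrow> 0 \<le> t \<Longrightarrow> 0 \<le> u \<Longrightarrow> x t < x u \<longleftrightarrow> t < u"
  using x_strict[of 0 t u] x_strict[of 0 u t] by (cases t u rule: linorder_cases) auto

lemma right_branch_cont: "right_branch f p \<Longrightarrow> continuous_on {0..} f"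
  by (simp add: right_branch_def)

lemma right_branch_at: "right_branch f p \<Longrightarrow> t \<ge> 0 \<Longrightarrow> f (x t) = y t"
  by (simp add: right_branch_def)

lemma right_branch_slope: "right_branch f p \<Longrightarrow> t > 0 \<Longrightarrow> p (x t) = s t / c t"
  by (simp add: right_branch_def)

lemma right_branch_time:
  assumes "right_branch f p" "x 0 = 0" "z > 0"
  obtains t where "t > 0" "x t = z"
proof -
  obtain t where "t \<ge> 0" "x t = z" using assms less_imp_le unfolding right_branch_def by blast
  then show ?thesis using that[of t] assms by (cases "t = 0") auto
qed

lemma right_branch_gap:
  assumes "right_branch f p" "c 0 = 0" "t > 0"
  shows "f (x t) - p (x t) = v t / c t" "c t > 0"
proof -
  show "c t > 0" using vertical_after[of 0 t] assms by simp
  then show "f (x t) - p (x t) = v t / c t"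
    using assms by (simp add: right_branch_at right_branch_slope field_simps)
qed

lemma right_branch_inflection:
  assumes rb: "right_branch f p" "x 0 = 0" "c 0 = 0" and e: "e \<in> {-1, 1}" and "b > 0"
    and neg: "\<And>t. 0 < t \<Longrightarrow> t < b \<Longrightarrow> e * v t < 0" and pos: "\<And>t. t > b \<Longrightarrow> e * v t > 0"
  shows "one_inflection f"
proof (rule one_inflectionI[OF e, of "x b"])
  have strict: "x t < x u" if "0 \<le> t" "t < u" for t u using x_strict[of 0 t u] rb that by simp
  show "x b > 0" using strict[of 0 b] rb \<open>b > 0\<close> by simp
  have D: "e * deriv (deriv f) (x t) = (e * v t / c t) ^ 3" if "t > 0" for t
  proof -
    have "x t > 0" using strict[of 0 t] rb that by simp
    then have "deriv (deriv f) (x t) = (v t / c t) ^ 3"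
      using right_branch_graph(4)[OF rb(1), of "x t"] right_branch_gap(1)[OF rb(1,3) that] by simp
    moreover have "e * w ^ 3 = (e * w) ^ 3" for w using e by auto
    ultimately show ?thesis by (simp only: times_divide_eq_right)
  qed
  fix z :: real
  show "e * deriv (deriv f) z < 0" if z: "0 < z" "z < x b"
  proof -
    obtain t where t: "t > 0" "x t = z" using right_branch_time[OF rb(1,2) z(1)] .
    have "t < b" using x_less_iff[OF rb(3), of t b] t z \<open>b > 0\<close> by simp
    then have "e * v t / c t < 0"
      using neg[OF t(1)] right_branch_gap(2)[OF rb(1,3) t(1)] by (simp add: divide_neg_pos)
    then show ?thesis using D[OF t(1)] t(2) by simp
  qed
  show "e * deriv (deriv f) z > 0" if z: "z > x b"
  proof -
    have "z > 0" using z \<open>x b > 0\<close> by simp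
    then obtain t where t: "t > 0" "x t = z" using right_branch_time[OF rb(1,2)] by blast
    have "t > b" using x_less_iff[OF rb(3), of b t] t z \<open>b > 0\<close> by simp
    then have "e * v t / c t > 0"
      using pos right_branch_gap(2)[OF rb(1,3) t(1)] by simp
    then show ?thesis using D[OF t(1)] t(2) by simp
  qed
qed

text \<open>Along the branch \<open>f'' = (v / c)^3\<close>.\<close>

lemma right_branch_convex:
  assumes rb: "right_branch f p" "x 0 = 0" "c 0 = 0" and v: "\<And>t. t > 0 \<Longrightarrow> v t \<ge> 0"
  shows "convex_on {0..} f"
proof (rule convex_on_half_line[OF right_branch_cont[OF rb(1)] right_branch_graph(1)[OF rb(1)]])
  fix a b :: real assume ab: "0 < a" "a \<le> b"
  show "p a \<le> p b"
  proof (rule DERIV_nonneg_imp_nondecreasing[OF ab(2)])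
    fix z assume "a \<le> z"
    then have z: "z > 0" using ab by simp
    then obtain t where t: "t > 0" "x t = z" using right_branch_time[OF rb(1,2)] by blast
    have "f z - p z \<ge> 0" using right_branch_gap[OF rb(1,3) t(1)] v[OF t(1)] t(2) by simp
    then show "\<exists>d. (p has_real_derivative d) (at z) \<and> 0 \<le> d"
      using right_branch_graph(2)[OF rb(1) z] by (intro exI[of _ "(f z - p z) ^ 3"]) simp
  qed
qed

text \<open>The branch that leaves a vertical tangent upwards.\<close>

lemma upper_sign:
  assumes "s 0 = 1" "c 0 = 0" "y 0 \<ge> 0" "t > 0"
  shows "c t > 0 \<and> y t > 0 \<and> s t > 0"
  using quadrant1[of 0 t] vertical_after[of 0 t] assms by simp

lemma upper_at_top:
  assumes "s 0 = 1" "c 0 = 0" "y 0 \<ge> 0"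
  shows "filterlim x at_top at_top"
  using x_at_top_quadrant1[of 1] upper_sign[OF assms] by simp

lemma upper_inflection_time:
  assumes "s 0 = 1" "c 0 = 0" "y 0 \<ge> 0"
  obtains b where "b > 0" "\<And>t. 0 < t \<Longrightarrow> t < b \<Longrightarrow> v t < 0" "\<And>t. t > b \<Longrightarrow> v t > 0"
  using inflection_time[of 0] upper_sign[OF assms] assms by auto

lemma upper_branch:
  assumes "s 0 = 1" "c 0 = 0" "y 0 \<ge> 0" "x 0 = 0" and rb: "right_branch f p"
  shows "strict_mono_on {0..} f" "one_inflection f"
proof -
  show "strict_mono_on {0..} f"
  proof (rule strict_mono_on_half_line[OF right_branch_cont[OF rb] right_branch_graph(1)[OF rb]])
    fix z :: real assume "z > 0"
    then obtain t where t: "t > 0" "x t = z" using right_branch_time[OF rb \<open>x 0 = 0\<close>] by blast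
    then show "p z > 0" using upper_sign[OF assms(1-3) t(1)] right_branch_slope[OF rb t(1)] by auto
  qed
  obtain b where "b > 0" "\<And>t. 0 < t \<Longrightarrow> t < b \<Longrightarrow> v t < 0" "\<And>t. t > b \<Longrightarrow> v t > 0"
    using upper_inflection_time[OF assms(1-3)] by blast
  then show "one_inflection f" using right_branch_inflection[OF rb assms(4,2), of 1 b] by simp
qed

text \<open>The branch that leaves a vertical tangent downwards, at a positive height. It can leave the region \<open>y > 0\<close>, \<open>s < 0\<close>
only through one of its sides and not through the corner, which is the equilibrium.\<close>

lemma lower_trichotomy:
  assumes "s 0 = -1" "c 0 = 0" "y 0 > 0"
  shows "(\<forall>t>0. y t > 0 \<and> s t < 0) \<or> (\<exists>t>0. y t > 0 \<and> s t = 0) \<or> (\<exists>t>0. y t = 0)"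
proof (rule ccontr)
  assume H: "\<not> ?thesis"
  then obtain b where b: "b > 0" "\<not> (y b > 0 \<and> s b < 0)" by blast
  define g where "g t = min (y t) (- s t)" for t
  have "isCont g t" for t unfolding g_def by (intro continuous_intros) auto
  moreover have "g 0 > 0" "g b \<le> 0" using assms b(2) by (auto simp: g_def min_def)
  ultimately obtain e where e: "0 < e" "g e = 0"
    using first_zero[of 0 b g] b(1) by blast
  then have "y e = 0 \<or> (y e > 0 \<and> s e = 0)" by (auto simp: g_def min_def split: if_splits)
  then show False using H e(1) by blast
qed

lemma lower_turning_sign:
  assumes "s 0 = -1" "c 0 = 0" and m: "m > 0" "y m > 0" "s m = 0"
  shows "t < m \<Longrightarrow> y t > 0 \<and> s t < 0" "t > m \<Longrightarrow> y t > 0 \<and> s t > 0" "t > 0 \<Longrightarrow> v t > 0"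
proof -
  have before: "y t > 0 \<and> s t < 0" if "t < m" for t using quadrant4[of m t] m that by simp
  have after: "y t > 0 \<and> s t > 0" if "t > m" for t using quadrant1[of m t] m that by simp
  have c: "c t > 0" if "t > 0" for t using vertical_after[of 0 t] assms that by simp
  have vm: "v m > 0" using m c by simp
  show "t < m \<Longrightarrow> y t > 0 \<and> s t < 0" "t > m \<Longrightarrow> y t > 0 \<and> s t > 0" using before after by blast+
  assume "t > 0"
  consider "t < m" | "t = m" | "t > m" by linarith
  then show "v t > 0"
  proof cases
    case 1
    then have "y t * c t > 0" "s t < 0" using before c \<open>t > 0\<close> by auto
    then show ?thesis by simp
  next
    case 3
    show ?thesis
    proof (rule v_upcrossing[OF 3])
      fix r assume "m \<le> r" "v r = 0"
      then have "r > m" using vm by (cases "r = m") auto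
      then show "s r * c r > 0" using after[of r] c[of r] m(1) by simp
    qed (use vm in simp)
  qed (use vm in simp)
qed

lemma lower_crossing_sign:
  assumes "s 0 = -1" "c 0 = 0" "y 0 > 0" and m: "m > 0" "y m = 0"
  shows "s m < 0" "t < m \<Longrightarrow> y t > 0 \<and> s t < 0" "t > m \<Longrightarrow> y t < 0 \<and> s t < 0"
proof -
  have "s m \<noteq> 0" using equilibrium[of m 0] m(2) assms(1) by auto
  moreover have "\<not> s m > 0"
    using soliton.quadrant4[OF reflected, of m 0] m assms by auto
  ultimately show sm: "s m < 0" by simp
  show "t < m \<Longrightarrow> y t > 0 \<and> s t < 0" using quadrant4[of m t] m sm by simp
  show "t > m \<Longrightarrow> y t < 0 \<and> s t < 0" using quadrant3[of m t] m sm by simp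
qed

lemma lower_at_top:
  assumes "s 0 = -1" "c 0 = 0" "y 0 > 0"
  shows "filterlim x at_top at_top"
proof -
  have c: "c t > 0" if "t > 0" for t using vertical_after[of 0 t] assms that by simp
  consider "\<forall>t>0. y t > 0 \<and> s t < 0" | m where "m > 0" "y m > 0" "s m = 0" | m where "m > 0" "y m = 0"
    using lower_trichotomy[OF assms] by blast
  then show ?thesis
  proof cases
    case 1
    then show ?thesis using x_at_top_quadrant4[of 1] c by simp
  next
    case 2
    then show ?thesis using x_at_top_quadrant1[of "m + 1"] c lower_turning_sign(2)[OF assms(1,2) 2] by simp
  next
    case 3
    then show ?thesis
      using soliton.x_at_top_quadrant1[OF reflected, of "m + 1"] c lower_crossing_sign(3)[OF assms 3] by simp
  qed
qed

lemma lower_asymptotic: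
  assumes "s 0 = -1" "c 0 = 0" "x 0 = 0" and rb: "right_branch f p"
    and Q: "\<And>t. t > 0 \<Longrightarrow> y t > 0 \<and> s t < 0"
  shows "strict_antimono_on {0..} f" "convex_on {0..} f" "(f \<longlongrightarrow> 0) at_top"
proof -
  have c: "c t > 0" if "t > 0" for t using vertical_after[of 0 t] assms that by simp
  have v: "v t > 0" if "t > 0" for t
  proof -
    have "y t * c t > 0" "s t < 0" using Q c that by auto
    then show ?thesis by simp
  qed
  show "strict_antimono_on {0..} f"
  proof (rule strict_antimono_on_half_line[OF right_branch_cont[OF rb] right_branch_graph(1)[OF rb]])
    fix z :: real assume "z > 0"
    then obtain t where t: "t > 0" "x t = z" using right_branch_time[OF rb \<open>x 0 = 0\<close>] by blast
    then show "p z < 0" using Q[OF t(1)] c[OF t(1)] right_branch_slope[OF rb t(1)] by (auto simp: divide_neg_pos)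
  qed
  show "convex_on {0..} f" using v by (intro right_branch_convex[OF rb assms(3,2)]) (simp add: less_imp_le)
  have lim: "(y \<longlongrightarrow> 0) at_top" using y_decays[of 1 1] Q c v by simp
  show "(f \<longlongrightarrow> 0) at_top"
  proof (rule tendstoI)
    fix \<epsilon> :: real assume "\<epsilon> > 0"
    then obtain N where N: "\<And>t. t \<ge> N \<Longrightarrow> dist (y t) 0 < \<epsilon>"
      using tendstoD[OF lim] by (auto simp: eventually_at_top_linorder)
    define M where "M = max N 1"
    have "dist (f z) 0 < \<epsilon>" if "z \<ge> x M" for z
    proof -
      have "x M > 0" using x_strict[of 0 0 M] assms by (simp add: M_def)
      then have "z > 0" using that by simp
      then obtain t where t: "t > 0" "x t = z" using right_branch_time[OF rb \<open>x 0 = 0\<close>] by blast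
      have "t \<ge> M" using x_strict[of 0 t M] assms t that by (cases "t < M") auto
      then show ?thesis using N[of t] right_branch_at[OF rb, of t] t by (simp add: M_def)
    qed
    then show "\<forall>\<^sub>F z in at_top. dist (f z) 0 < \<epsilon>" by (auto simp: eventually_at_top_linorder)
  qed
qed

text \<open>The branch descends to \<open>x m\<close> and rises afterwards, and it is convex as \<open>v\<close> stays positive.\<close>

lemma lower_turning:
  assumes "s 0 = -1" "c 0 = 0" "x 0 = 0" and rb: "right_branch f p"
    and m: "m > 0" "y m > 0" "s m = 0"
  shows "convex_on {0..} f" "\<exists>!q. is_arg_min f (\<lambda>z. 0 \<le> z) q" "\<forall>q. is_arg_min f (\<lambda>z. 0 \<le> z) q \<longrightarrow> f q > 0"
proof -
  note sign = lower_turning_sign[OF assms(1,2) m]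
  have c: "c t > 0" if "t > 0" for t using vertical_after[of 0 t] assms that by simp
  show "convex_on {0..} f" using sign(3) by (intro right_branch_convex[OF rb assms(3,2)]) (simp add: less_imp_le)
  define b where "b = x m"
  have b: "b > 0" using x_strict[of 0 0 m] assms m by (simp add: b_def)
  have fb: "f b > 0" using right_branch_at[OF rb, of m] m by (simp add: b_def)
  have less: "f b < f z" if z: "z \<ge> 0" "z \<noteq> b" for z
  proof (cases "z < b")
    case True
    obtain w where w: "z < w" "w < b" "f b - f z = (b - z) * p w"
      using mvt_half_line[OF right_branch_cont[OF rb] right_branch_graph(1)[OF rb], of z b] z True by auto
    then have "w > 0" using z by simp
    then obtain t where t: "t > 0" "x t = w" using right_branch_time[OF rb \<open>x 0 = 0\<close>] by blast
    have "t < m" using x_less_iff[OF \<open>c 0 = 0\<close>, of t m] t w m by (simp add: b_def)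
    then have "p w < 0" using sign(1)[of t] c[OF t(1)] right_branch_slope[OF rb t(1)] t by (auto simp: divide_neg_pos)
    then have "(b - z) * p w < 0" using True by (simp add: mult_pos_neg)
    then show ?thesis using w by simp
  next
    case False
    then have "b < z" using z by simp
    then obtain w where w: "b < w" "w < z" "f z - f b = (z - b) * p w"
      using mvt_half_line[OF right_branch_cont[OF rb] right_branch_graph(1)[OF rb], of b z] b by auto
    then have "w > 0" using b by simp
    then obtain t where t: "t > 0" "x t = w" using right_branch_time[OF rb \<open>x 0 = 0\<close>] by blast
    have "t > m" using x_less_iff[OF \<open>c 0 = 0\<close>, of m t] t w m by (simp add: b_def)
    then have "p w > 0" using sign(2)[of t] c[OF t(1)] right_branch_slope[OF rb t(1)] t by auto
    then have "(z - b) * p w > 0" using \<open>b < z\<close> by simp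
    then show ?thesis using w by simp
  qed
  have iff: "is_arg_min f (\<lambda>z. 0 \<le> z) q \<longleftrightarrow> q = b" for q
  proof
    assume "is_arg_min f (\<lambda>z. 0 \<le> z) q"
    then have "q \<ge> 0" "\<not> f b < f q" using b by (auto simp: is_arg_min_def)
    then show "q = b" using less[of q] by blast
  next
    assume "q = b"
    moreover have "\<not> f z < f b" if "z \<ge> 0" for z using less[of z] that by (cases "z = b") auto
    ultimately show "is_arg_min f (\<lambda>z. 0 \<le> z) q" using b by (auto simp: is_arg_min_def)
  qed
  then show "\<exists>!q. is_arg_min f (\<lambda>z. 0 \<le> z) q" "\<forall>q. is_arg_min f (\<lambda>z. 0 \<le> z) q \<longrightarrow> f q > 0"
    using fb by auto
qed

text \<open>Beyond the x-axis the reflected branch rises from height 0, so that it has one inflection point like an upper branch;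
before, the branch is convex.\<close>

lemma lower_crossing:
  assumes "s 0 = -1" "c 0 = 0" "x 0 = 0" "y 0 > 0" and rb: "right_branch f p"
    and m: "m > 0" "y m = 0"
  shows "strict_antimono_on {0..} f" "one_inflection f"
proof -
  note sign = lower_crossing_sign[OF assms(1,2,4) m]
  have c: "c t > 0" if "t > 0" for t using vertical_after[of 0 t] assms that by simp
  have s_neg: "s t < 0" for t using sign by (cases t m rule: linorder_cases) auto
  show "strict_antimono_on {0..} f"
  proof (rule strict_antimono_on_half_line[OF right_branch_cont[OF rb] right_branch_graph(1)[OF rb]])
    fix z :: real assume "z > 0"
    then obtain t where t: "t > 0" "x t = z" using right_branch_time[OF rb \<open>x 0 = 0\<close>] by blast
    then show "p z < 0" using s_neg[of t] c[OF t(1)] right_branch_slope[OF rb t(1)] by (auto simp: divide_neg_pos)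
  qed
  interpret R: soliton x "\<lambda>t. - y t" c "\<lambda>t. - s t" by (rule reflected)
  obtain b where b: "m < b" "\<And>t. m < t \<Longrightarrow> t < b \<Longrightarrow> - y t * c t - - s t < 0"
      "\<And>t. t > b \<Longrightarrow> - y t * c t - - s t > 0"
    using R.inflection_time[of m] sign m c by auto
  show "one_inflection f"
  proof (rule right_branch_inflection[OF rb assms(3,2), of "-1" b])
    show "b > 0" using b(1) m by simp
    show "-1 * v t > 0" if "t > b" for t using b(3)[OF that] by simp
    fix t assume t: "0 < t" "t < b"
    show "-1 * v t < 0"
    proof (cases "m < t")
      case True
      then show ?thesis using b(2)[of t] t by simp
    next
      case False
      then have "y t \<ge> 0" using sign(2)[of t] m by (cases "t = m") (auto intro: less_imp_le)
      then have "y t * c t \<ge> 0" using c[OF t(1)] by simp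
      then show ?thesis using s_neg[of t] by simp
    qed
  qed simp
qed

end

section \<open>The curves with a vertical tangent\<close>

lemma (in soliton) right_branch_vertical:
  assumes "right_branch f p"
  shows "s 0 = 1 \<Longrightarrow> filterlim (deriv f) at_top (at_right 0)"
    "s 0 = -1 \<Longrightarrow> filterlim (deriv f) at_bot (at_right 0)"
proof -
  have "\<forall>\<^sub>F z in at_right 0. p z = deriv f z"
    using eventually_at_right_less[of "0::real"]
    by eventually_elim (simp add: right_branch_graph(3)[OF assms])
  note cong = filterlim_cong[OF refl refl this]
  show "s 0 = 1 \<Longrightarrow> filterlim (deriv f) at_top (at_right 0)"
    "s 0 = -1 \<Longrightarrow> filterlim (deriv f) at_bot (at_right 0)"
    using assms unfolding right_branch_def cong by blast+
qed

lemma (in soliton) right_branch_image: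
  assumes "right_branch f p" "x 0 = 0" "c 0 = 0"
  shows "plane_curve x y ` {0..} = fgraph {0..} f"
proof
  have x0: "x t \<ge> 0" if "t \<ge> 0" for t
    using x_strict[of 0 0 t] assms that by (cases "t = 0") auto
  show "plane_curve x y ` {0..} \<subseteq> fgraph {0..} f"
    using right_branch_at[OF assms(1)] x0 by (force simp: fgraph_def plane_curve_def)
  show "fgraph {0..} f \<subseteq> plane_curve x y ` {0..}"
  proof
    fix q assume "q \<in> fgraph {0..} f"
    then obtain z where z: "z \<ge> 0" "q = vector [z, f z]" by (auto simp: fgraph_def)
    then obtain t where "t \<ge> 0" "x t = z" using assms(1) by (auto simp: right_branch_def)
    then show "q \<in> plane_curve x y ` {0..}" using z right_branch_at[OF assms(1), of t]
      by (auto simp: plane_curve_def)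
  qed
qed

text \<open>The normal form of a curve with a vertical tangent; \<open>L\<close> is the same curve traversed backwards, which describes the
lower branch.\<close>

locale vertical_soliton = soliton +
  assumes x0: "x 0 = 0" and c0: "c 0 = 0" and s0: "s 0 = 1" and y0: "y 0 \<ge> 0"
begin

sublocale L: soliton "\<lambda>t. x (- t)" "\<lambda>t. y (- t)" "\<lambda>t. - c (- t)" "\<lambda>t. - s (- t)"
  by (rule reversed)

text \<open>By uniqueness, since reflecting and reversing the curve does not change its initial data.\<close>

lemma symmetric:
  assumes "y 0 = 0"
  shows "y (- t) = - y t" "x (- t) = x t" "c (- t) = - c t" "s (- t) = s t"
proof -
  have "y t = - y (- t) \<and> c t = - c (- t) \<and> s t = s (- t) \<and> x t = x (- t)"
    using soliton_unique[OF soliton_axioms L.reflected, of t] assms x0 c0 s0 by simp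
  then show "y (- t) = - y t" "x (- t) = x t" "c (- t) = - c t" "s (- t) = s t" by simp_all
qed

lemma left_at_top: "filterlim (\<lambda>t. x (- t)) at_top at_top"
proof (cases "y 0 = 0")
  case True
  then show ?thesis using upper_at_top[OF s0 c0 y0] symmetric(2) by simp
next
  case False
  then show ?thesis using L.lower_at_top s0 c0 y0 by simp
qed

lemma two_graphs:
  assumes 1: "right_branch f1 p1" and 2: "L.right_branch f2 p2"
  shows "is_two_graphs UNIV (plane_curve x y) f1 f2" "vertical_start f1 f2" "z > 0 \<Longrightarrow> f1 z > f2 z"
    "f1 0 = y 0" "f2 0 = y 0"
proof -
  show f0: "f1 0 = y 0" "f2 0 = y 0"
    using right_branch_at[OF 1, of 0] L.right_branch_at[OF 2, of 0] x0 by simp_all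
  have lim: "filterlim p1 at_top (at_right 0)" "filterlim p2 at_bot (at_right 0)"
    using 1 2 s0 by (simp_all add: right_branch_def L.right_branch_def)
  have gs: "graph_solution {0<..} f1 p1" "graph_solution {0<..} f2 p2"
    and cont: "continuous_on {0..} f1" "continuous_on {0..} f2"
    using 1 2 by (simp_all add: right_branch_def L.right_branch_def)
  have above: "f1 z > f2 z" if "z > 0" for z
    using graph_comparison[OF gs(1) cont(1) lim(1) gs(2) cont(2) lim(2) _ that] f0 by simp
  then show "z > 0 \<Longrightarrow> f1 z > f2 z" .
  show "vertical_start f1 f2"
    unfolding vertical_start_def using right_branch_vertical(1)[OF 1 s0] L.right_branch_vertical(2)[OF 2] f0 s0 by simp
  have pc: "plane_curve (\<lambda>t. x (- t)) (\<lambda>t. y (- t)) = (\<lambda>t. plane_curve x y (- t))" by (auto simp: plane_curve_def)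
  have "(\<lambda>t. plane_curve x y (- t)) ` {0..} = plane_curve x y ` {..0}"
    unfolding image_image[symmetric, of "plane_curve x y" uminus] by simp
  then have "plane_curve x y ` {..0} = fgraph {0..} f2"
    using L.right_branch_image[OF 2] x0 c0 by (simp add: pc)
  moreover have "plane_curve x y ` {0..} = fgraph {0..} f1" by (rule right_branch_image[OF 1 x0 c0])
  moreover have "{0..} \<union> {..0} = (UNIV :: real set)" by auto
  ultimately have img: "plane_curve x y ` UNIV = fgraph {0..} f1 \<union> fgraph {0..} f2"
    by (metis image_Un)
  have right: "x t < x u" if "0 \<le> t" "t < u" for t u using x_strict[of 0 t u] c0 that by simp
  have left: "x t > x u" if "t < u" "u \<le> 0" for t u
    using L.x_strict[of 0 "- u" "- t"] c0 that by simp
  have cross: False if "x t = x u" "y t = y u" "t < 0" "0 < u" for t u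
  proof -
    have "x u > 0" using right[of 0 u] x0 that by simp
    then have "f1 (x u) > f2 (x u)" by (rule above)
    moreover have "f1 (x u) = y u" using right_branch_at[OF 1, of u] that by simp
    moreover have "f2 (x u) = y t" using L.right_branch_at[OF 2, of "- t"] that by simp
    ultimately show False using that by simp
  qed
  have no: "\<not> (x t = x u \<and> y t = y u)" if "t < u" for t u
  proof
    assume eq: "x t = x u \<and> y t = y u"
    consider "0 \<le> t" | "u \<le> 0" | "t < 0" "0 < u" by linarith
    then show False
    proof cases
      case 1 then show ?thesis using right[of t u] that eq by simp
    next
      case 2 then show ?thesis using left[of t u] that eq by simp
    next
      case 3 then show ?thesis using cross[of t u] eq by simp
    qed
  qed
  have "inj (plane_curve x y)"
  proof (rule injI, rule ccontr)
    fix t u assume "plane_curve x y t = plane_curve x y u" "t \<noteq> u"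
    then have "x t = x u \<and> y t = y u" by (metis plane_curve_nth)
    then show False using no[of t u] no[of u t] \<open>t \<noteq> u\<close> by (cases "t < u") auto
  qed
  then show "is_two_graphs UNIV (plane_curve x y) f1 f2"
    unfolding is_two_graphs_def using img cont gs graph_solution_smooth[OF open_greaterThan] by blast
qed

text \<open>The hypotheses on the lower branch are stated for negative times of the given trajectory.\<close>

lemma profiles:
  obtains f1 f2 where "is_two_graphs UNIV (plane_curve x y) f1 f2" "f1 0 = y 0"
    "y 0 > 0 \<and> (\<forall>t<0. y t > 0 \<and> s t > 0) \<longrightarrow> asymptotic_profile f1 f2"
    "y 0 > 0 \<and> (\<exists>t<0. y t > 0 \<and> s t = 0) \<longrightarrow> turning_profile f1 f2"
    "(y 0 > 0 \<and> (\<exists>t<0. y t = 0)) \<or> y 0 = 0 \<longrightarrow> crossing_profile f1 f2"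
proof -
  obtain f1 p1 where 1: "right_branch f1 p1"
    using right_branch_exists[OF x0 c0 upper_at_top[OF s0 c0 y0]] .
  obtain f2 p2 where 2: "L.right_branch f2 p2"
    using L.right_branch_exists left_at_top x0 c0 by auto
  note two = two_graphs[OF 1 2]
  note up = upper_branch[OF s0 c0 y0 x0 1]
  have L0: "- s (- 0) = -1" "- c (- 0) = 0" "x (- 0) = 0" using s0 c0 x0 by simp_all
  show ?thesis
  proof (rule that[OF two(1,4)]; rule impI)
    assume H: "y 0 > 0 \<and> (\<forall>t<0. y t > 0 \<and> s t > 0)"
    show "asymptotic_profile f1 f2"
      unfolding asymptotic_profile_def
      using two up L.lower_asymptotic[OF L0 2] H by simp
  next
    assume H: "y 0 > 0 \<and> (\<exists>t<0. y t > 0 \<and> s t = 0)"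
    then obtain t where t: "- t > 0" "y (- (- t)) > 0" "- s (- (- t)) = 0" by auto
    show "turning_profile f1 f2"
      unfolding turning_profile_def
      using two up L.lower_turning[OF L0 2 t] H by simp
  next
    assume "(y 0 > 0 \<and> (\<exists>t<0. y t = 0)) \<or> y 0 = 0"
    then show "crossing_profile f1 f2"
    proof
      assume H: "y 0 > 0 \<and> (\<exists>t<0. y t = 0)"
      then obtain t where t: "- t > 0" "y (- (- t)) = 0" by auto
      show ?thesis
        unfolding crossing_profile_def
        using two up L.lower_crossing[OF L0 _ 2 t] H by simp
    next
      assume y00: "y 0 = 0"
      note sym = symmetric[OF y00]
      have eq: "f2 z = - f1 z" if "z \<ge> 0" for z
      proof -
        obtain t where "t \<ge> 0" "x t = z" using 1 \<open>z \<ge> 0\<close> by (auto simp: right_branch_def)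
        then show ?thesis using right_branch_at[OF 1, of t] L.right_branch_at[OF 2, of t] sym by simp
      qed
      have "strict_antimono_on {0..} f2"
        using up(1) by (auto simp: monotone_on_def eq)
      moreover obtain b where b: "b > 0" "\<And>t. 0 < t \<Longrightarrow> t < b \<Longrightarrow> v t < 0" "\<And>t. t > b \<Longrightarrow> v t > 0"
        using upper_inflection_time[OF s0 c0 y0] by blast
      have "one_inflection f2"
        by (rule L.right_branch_inflection[OF 2 L0(3,2), of "-1" b]) (use b in \<open>auto simp: sym\<close>)
      ultimately show ?thesis
        unfolding crossing_profile_def using two up eq y0 by simp
    qed
  qed
qed

end

section \<open>The curves without a vertical tangent\<close>

text \<open>As \<open>v > 0\<close>, the curve was flatter in the past, so it extends infinitely far to the left. Backwards in time the height
decreases to 0.\<close>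

lemma (in soliton) entire_graph:
  assumes Q: "\<And>t. c t > 0 \<and> y t > 0 \<and> s t > 0"
  obtains f where "is_graph UNIV (plane_curve x y) f" "entire_profile f"
proof -
  have v: "v t > 0" for t using entire_convex Q by blast
  have mono: "strict_mono x" using x_strict Q by (intro strict_monoI) (meson less_imp_le order_refl)
  have top: "filterlim x at_top at_top" using x_at_top_quadrant1[of 0] Q by simp
  have "filterlim (\<lambda>t. - x (- t)) at_top at_top"
  proof (rule linear_growth[where \<delta> = "c 0" and b = 0])
    show "((\<lambda>t. - x (- t)) has_real_derivative c (- t)) (at t)" for t
      using DERIV_minus[OF soliton.dx[OF reversed, of t]] by simp
    show "c 0 \<le> c (- t)" if "t \<ge> 0" for t
      using that v Q by (intro c_antimono_on[of "- t" 0]) (auto intro!: mult_nonneg_nonneg less_imp_le)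
  qed (use Q in simp)
  then have bot: "filterlim x at_bot at_bot"
    by (simp add: filterlim_at_bot_mirror filterlim_uminus_at_top)
  have surj: "surj x" by (rule surj_of_limits[OF isCont_x top bot])
  note inv = real_homeomorphism_inverse[OF mono isCont_x surj]
  define f where "f z = y (inv x z)" for z
  define p where "p z = s (inv x z) / c (inv x z)" for z
  have gs: "graph_solution UNIV f p"
    using graph_solution_inv[OF mono isCont_x surj open_UNIV] Q surj by (simp add: f_def[abs_def] p_def[abs_def])
  then have df: "(f has_real_derivative p z) (at z)" and dp: "(p has_real_derivative (f z - p z) ^ 3) (at z)" for z
    by (auto simp: graph_solution_def)
  have p_pos: "p z > 0" for z using Q by (simp add: p_def)
  have gap: "f z - p z > 0" for z
  proof -
    have "f z - p z = v (inv x z) / c (inv x z)"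
      using Q[of "inv x z"] by (simp add: f_def p_def field_simps)
    then show ?thesis using v Q by simp
  qed
  have smono: "strict_mono f"
  proof (rule strict_monoI)
    fix a b :: real assume "a < b"
    then show "f a < f b" using DERIV_pos_imp_increasing[OF \<open>a < b\<close>] df p_pos by blast
  qed
  have "p a \<le> p b" if "a \<le> b" for a b
    using DERIV_nonneg_imp_nondecreasing[OF that] dp gap by (meson less_imp_le zero_less_power)
  then have convex: "convex_on UNIV f" using df by (intro convex_on_realI[of UNIV f p]) auto
  have "((\<lambda>t. y (- t)) \<longlongrightarrow> 0) at_top"
    using soliton.y_decays[OF reversed, of "-1" 0] Q v by simp
  then have ylim: "(y \<longlongrightarrow> 0) at_bot" by (simp add: filterlim_at_bot_mirror)
  have "filterlim (inv x) at_bot at_bot"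
    unfolding filterlim_at_bot
  proof
    fix Z
    have "inv x z \<le> Z" if "z \<le> x Z" for z
      using that inv(2)[of Z] strict_mono_less_eq[OF inv(4), of z "x Z"] by simp
    then show "\<forall>\<^sub>F z in at_bot. inv x z \<le> Z" by (auto simp: eventually_at_bot_linorder)
  qed
  from filterlim_compose[OF ylim this] have lim: "(f \<longlongrightarrow> 0) at_bot" by (simp add: f_def[abs_def])
  have "inj (plane_curve x y)"
  proof (rule injI)
    fix t u assume "plane_curve x y t = plane_curve x y u"
    then have "x t = x u" by (metis plane_curve_nth(1))
    then show "t = u" using mono strict_mono_eq by blast
  qed
  moreover have "plane_curve x y t = vector [x t, f (x t)]" for t by (simp add: plane_curve_def f_def inv)
  then have "plane_curve x y ` UNIV = (\<lambda>z. vector [z, f z]) ` (x ` UNIV)" unfolding image_image by simp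
  then have "plane_curve x y ` UNIV = fgraph UNIV f" using surj by (simp add: fgraph_def)
  ultimately have "is_graph UNIV (plane_curve x y) f"
    using graph_solution_smooth[OF open_UNIV gs] by (simp add: is_graph_def)
  then show ?thesis using that smono convex lim by (simp add: entire_profile_def)
qed

section \<open>Classification\<close>

definition standard_curve :: "real set \<Rightarrow> (real \<Rightarrow> real^2) \<Rightarrow> bool" where
  "standard_curve I Y \<longleftrightarrow> is_graph I Y (\<lambda>x. 0) \<or>
     (\<exists>f1 f2. is_two_graphs I Y f1 f2 \<and> turning_profile f1 f2) \<or>
     (\<exists>f1 f2. is_two_graphs I Y f1 f2 \<and> asymptotic_profile f1 f2) \<or>
     (\<exists>f1 f2. is_two_graphs I Y f1 f2 \<and> crossing_profile f1 f2) \<or>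
     (\<exists>f. is_graph I Y f \<and> entire_profile f)"

lemma standard_curve_reparametrized:
  assumes "standard_curve UNIV P" "\<phi> ` I = UNIV" "inj_on \<phi> I" "\<And>u. u \<in> I \<Longrightarrow> Y u = P (\<phi> u)"
  shows "standard_curve I Y"
proof -
  have "Y ` I = P ` UNIV"
    using assms(2,4) by (metis (no_types, lifting) image_cong image_image)
  moreover have "inj_on Y I" if "inj P"
    using that assms(3,4) by (auto simp: inj_on_def)
  ultimately have "is_graph UNIV P f \<Longrightarrow> is_graph I Y f" "is_two_graphs UNIV P f1 f2 \<Longrightarrow> is_two_graphs I Y f1 f2" for f f1 f2
    by (simp_all add: is_graph_def is_two_graphs_def)
  then show ?thesis using assms(1) unfolding standard_curve_def by blast
qed

text \<open>It is the property of being in the list up to the motions that respect the equation; as such it is invariant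
under the reductions to a normal form.\<close>

definition standardizable :: "(real \<Rightarrow> real) \<Rightarrow> (real \<Rightarrow> real) \<Rightarrow> bool" where
  "standardizable x y \<longleftrightarrow> (\<exists>e\<in>{-1, 1}. \<exists>a. standard_curve UNIV (symmetry e a \<circ> plane_curve x y))"

lemma standardizable_reversed: "standardizable (\<lambda>t. x (- t)) (\<lambda>t. y (- t)) \<Longrightarrow> standardizable x y"
  unfolding standardizable_def
proof (elim bexE exE)
  fix e a :: real
  assume e: "e \<in> {-1, 1}" and std: "standard_curve UNIV (symmetry e a \<circ> plane_curve (\<lambda>t. x (- t)) (\<lambda>t. y (- t)))"
  have "standard_curve UNIV (symmetry e a \<circ> plane_curve x y)"
    by (rule standard_curve_reparametrized[OF std, of uminus]) (auto simp: plane_curve_def)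
  then show "\<exists>e\<in>{-1, 1}. \<exists>a. standard_curve UNIV (symmetry e a \<circ> plane_curve x y)" using e by blast
qed

lemma standardizable_reflected: "standardizable x (\<lambda>t. - y t) \<Longrightarrow> standardizable x y"
  unfolding standardizable_def
proof (elim bexE exE)
  fix e a :: real
  assume e: "e \<in> {-1, 1}" and std: "standard_curve UNIV (symmetry e a \<circ> plane_curve x (\<lambda>t. - y t))"
  have "symmetry e a \<circ> plane_curve x (\<lambda>t. - y t) = symmetry (- e) a \<circ> plane_curve x y"
    by (auto simp: fun_eq_iff symmetry_def)
  then show "\<exists>e\<in>{-1, 1}. \<exists>a. standard_curve UNIV (symmetry e a \<circ> plane_curve x y)"
    using e std by (intro bexI[of _ "- e"] exI[of _ a]) auto
qed

lemma standardizable_shifted: "standardizable (\<lambda>t. x (t + r) + b) (\<lambda>t. y (t + r)) \<Longrightarrow> standardizable x y"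
  unfolding standardizable_def
proof (elim bexE exE)
  fix e a :: real
  assume e: "e \<in> {-1, 1}" and std: "standard_curve UNIV (symmetry e a \<circ> plane_curve (\<lambda>t. x (t + r) + b) (\<lambda>t. y (t + r)))"
  have "surj (\<lambda>t. t - r)" by (rule surjI[of _ "\<lambda>t. t + r"]) simp
  then have "standard_curve UNIV (symmetry e (a + b) \<circ> plane_curve x y)"
    by (intro standard_curve_reparametrized[OF std, of "\<lambda>t. t - r"])
       (auto simp: inj_on_def symmetry_def plane_curve_def add_ac)
  then show "\<exists>e\<in>{-1, 1}. \<exists>a. standard_curve UNIV (symmetry e a \<circ> plane_curve x y)" using e by blast
qed

lemma standardizableI: "standard_curve UNIV (plane_curve x y) \<Longrightarrow> standardizable x y"
proof -
  have "symmetry 1 0 \<circ> plane_curve x y = plane_curve x y" by (auto simp: fun_eq_iff symmetry_def plane_curve_def)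
  then show "standard_curve UNIV (plane_curve x y) \<Longrightarrow> standardizable x y"
    unfolding standardizable_def by (intro bexI[of _ 1] exI[of _ 0]) auto
qed

lemma (in vertical_soliton) standard: "standard_curve UNIV (plane_curve x y)"
proof -
  obtain f1 f2 where f: "is_two_graphs UNIV (plane_curve x y) f1 f2"
    "y 0 > 0 \<and> (\<forall>t<0. y t > 0 \<and> s t > 0) \<longrightarrow> asymptotic_profile f1 f2"
    "y 0 > 0 \<and> (\<exists>t<0. y t > 0 \<and> s t = 0) \<longrightarrow> turning_profile f1 f2"
    "(y 0 > 0 \<and> (\<exists>t<0. y t = 0)) \<or> y 0 = 0 \<longrightarrow> crossing_profile f1 f2"
    by (rule profiles) blast
  have "asymptotic_profile f1 f2 \<or> turning_profile f1 f2 \<or> crossing_profile f1 f2"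
  proof (cases "y 0 = 0")
    case False
    then have "y 0 > 0" using y0 by simp
    then consider "\<forall>t>0. y (- t) > 0 \<and> - s (- t) < 0" | t where "t > 0" "y (- t) > 0" "- s (- t) = 0" | t where "t > 0" "y (- t) = 0"
      using L.lower_trichotomy s0 c0 by auto
    then show ?thesis
    proof cases
      case 1
      have "\<forall>t<0. y t > 0 \<and> s t > 0" using 1[rule_format, of "- t" for t] by force
      then show ?thesis using f(2) \<open>y 0 > 0\<close> by blast
    next
      case 2
      then have "- t < 0 \<and> y (- t) > 0 \<and> s (- t) = 0" by simp
      then show ?thesis using f(3) \<open>y 0 > 0\<close> by blast
    next
      case 3
      then have "- t < 0 \<and> y (- t) = 0" by simp
      then show ?thesis using f(4) \<open>y 0 > 0\<close> by blast
    qed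
  qed (use f(4) in blast)
  then show ?thesis using f(1) unfolding standard_curve_def by blast
qed

lemma vertical_standardizable:
  assumes "soliton x y c s" "x 0 = 0" "c 0 = 0"
  shows "standardizable x y"
proof -
  have upper: "standardizable x y" if S: "soliton x y c s" and "x 0 = 0" "c 0 = 0" "y 0 \<ge> 0" for x y c s
  proof -
    interpret soliton x y c s by (rule S)
    have "(s 0)\<^sup>2 = 1" using unit[of 0] that by simp
    then consider "s 0 = 1" | "s 0 = -1" by (auto simp: power2_eq_1_iff)
    then show ?thesis
    proof cases
      case 1
      then interpret vertical_soliton x y c s using that by unfold_locales auto
      show ?thesis using standard by (rule standardizableI)
    next
      case 2
      then interpret V: vertical_soliton "\<lambda>t. x (- t)" "\<lambda>t. y (- t)" "\<lambda>t. - c (- t)" "\<lambda>t. - s (- t)"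
        using that reversed by (simp add: vertical_soliton_def vertical_soliton_axioms_def)
      show ?thesis by (rule standardizable_reversed[OF standardizableI[OF V.standard]])
    qed
  qed
  show ?thesis
  proof (cases "y 0 \<ge> 0")
    case True then show ?thesis using upper assms by blast
  next
    case False
    then have "standardizable x (\<lambda>t. - y t)"
      using upper[OF soliton.reflected[OF assms(1)]] assms by simp
    then show ?thesis by (rule standardizable_reflected)
  qed
qed

text \<open>If the curve is not the line, then nowhere \<open>y \<ge> 0 \<ge> s\<close> or \<open>y \<le> 0 \<le> s\<close>, as \<open>reaches_vertical\<close> and its reflection
show; so \<open>y\<close> and \<open>s\<close> have the same constant sign.\<close>

lemma (in soliton) graph_standardizable:
  assumes c: "\<And>t. c t > 0"
  shows "standardizable x y"
proof (cases "\<exists>t. y t = 0 \<and> s t = 0")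
  case True
  then have ys: "y t = 0" "s t = 0" for t using equilibrium by blast+
  have mono: "strict_mono x" using x_strict c by (intro strict_monoI) (meson less_imp_le order_refl)
  have c1: "c t = 1" for t using unit[of t] ys c[of t] by (simp add: power2_eq_1_iff)
  have "x t - x 0 = t" for t
  proof -
    have "soliton (\<lambda>t. t) (\<lambda>t. 0) (\<lambda>t. 1) (\<lambda>t. 0)" by unfold_locales auto
    from soliton_unique[OF soliton_axioms this, of t] show ?thesis using ys c1 by simp
  qed
  then have x: "x t = x 0 + t" for t by (metis add.commute diff_add_cancel)
  have "x (z - x 0) = z" for z by (subst x) simp
  then have "surj x" by (rule surjI)
  moreover have "plane_curve x y ` UNIV = (\<lambda>z. vector [z, 0]) ` (x ` UNIV)"
    unfolding image_image by (simp add: plane_curve_def ys)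
  moreover have "inj (plane_curve x y)"
    using mono by (intro injI) (metis plane_curve_nth(1) strict_mono_eq)
  ultimately have "is_graph UNIV (plane_curve x y) (\<lambda>x. 0)"
    by (simp add: is_graph_def fgraph_def smooth_on_const)
  then have "standard_curve UNIV (plane_curve x y)" by (simp add: standard_curve_def)
  then show ?thesis by (rule standardizableI)
next
  case False
  interpret R: soliton x "\<lambda>t. - y t" c "\<lambda>t. - s t" by (rule reflected)
  have no: "\<not> (\<exists>r<t. c r \<le> 0)" for t using c by (meson not_le)
  have ne: "y t \<noteq> 0 \<or> s t \<noteq> 0" "- y t \<noteq> 0 \<or> - s t \<noteq> 0" for t using False by auto
  have n1: "\<not> (y t \<ge> 0 \<and> s t \<le> 0)" for t using reaches_vertical[OF _ _ ne(1)] no by blast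
  have n2: "\<not> (- y t \<ge> 0 \<and> - s t \<le> 0)" for t using R.reaches_vertical[OF _ _ ne(2)] no by blast
  have same: "(y t > 0 \<and> s t > 0) \<or> (y t < 0 \<and> s t < 0)" for t using n1[of t] n2[of t] by linarith
  have "continuous_on UNIV y" by (simp add: continuous_at_imp_continuous_on)
  moreover have "y t \<noteq> 0" for t using same[of t] by auto
  ultimately consider "\<forall>t. y t > 0" | "\<forall>t. y t < 0" using continuous_nonzero_sign by blast
  then show ?thesis
  proof cases
    case 1
    then have "y t > 0 \<and> s t > 0" for t using same[of t] by (auto dest: spec[of _ t])
    then obtain f where "is_graph UNIV (plane_curve x y) f" "entire_profile f" using entire_graph c by blast
    then have "standard_curve UNIV (plane_curve x y)" by (auto simp: standard_curve_def)
    then show ?thesis by (rule standardizableI)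
  next
    case 2
    then have "- y t > 0 \<and> - s t > 0" for t using same[of t] by (auto dest: spec[of _ t])
    then obtain f where "is_graph UNIV (plane_curve x (\<lambda>t. - y t)) f" "entire_profile f" using R.entire_graph c by blast
    then have "standard_curve UNIV (plane_curve x (\<lambda>t. - y t))" by (auto simp: standard_curve_def)
    then show ?thesis by (rule standardizable_reflected[OF standardizableI])
  qed
qed

theorem soliton_standardizable:
  assumes S: "soliton x y c s"
  shows "standardizable x y"
proof (cases "\<exists>r. c r = 0")
  case True
  then obtain r where r: "c r = 0" by blast
  have "standardizable (\<lambda>t. x (t + r) + - x r) (\<lambda>t. y (t + r))"
    by (rule vertical_standardizable[OF soliton.shifted[OF S]]) (simp_all add: r)
  then show ?thesis by (rule standardizable_shifted)
next
  case False
  interpret soliton x y c s by (rule S)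
  have "continuous_on UNIV c" by (simp add: continuous_at_imp_continuous_on)
  then consider "\<forall>t. c t > 0" | "\<forall>t. c t < 0" using continuous_nonzero_sign[of c] False by blast
  then show ?thesis
  proof cases
    case 1
    then show ?thesis using graph_standardizable by blast
  next
    case 2
    then have "- c (- t) > 0" for t by simp
    then have "standardizable (\<lambda>t. x (- t)) (\<lambda>t. y (- t))" by (rule soliton.graph_standardizable[OF reversed])
    then show ?thesis by (rule standardizable_reversed)
  qed
qed

section \<open>Existence of each kind\<close>

text \<open>The new trajectory starts at the vertical tangent of the given one and runs backwards; \<open>r\<close> is the time at which the
given trajectory has its vertical tangent.\<close>

lemma (in soliton) backward_vertical:
  assumes "c 0 > 0" "y 0 \<ge> 0" "s 0 \<le> 0" "y 0 \<noteq> 0 \<or> s 0 \<noteq> 0"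
  obtains x' y' c' s' r where "vertical_soliton x' y' c' s'" "r < 0" "y' 0 > 0"
    "\<And>t. y' t = y (r - t)" "\<And>t. s' t = - s (r - t)"
proof -
  obtain b where b: "b < 0" "c b \<le> 0" using reaches_vertical[of 0] assms by blast
  then obtain r where r: "b \<le> r" "r \<le> 0" "c r = 0"
    using IVT[of c b 0 0] assms(1) by auto
  then have "r < 0" using assms(1) by (cases "r = 0") auto
  then have Q: "y r > 0 \<and> s r < 0" using quadrant4[of 0 r] assms by simp
  have "(s r)\<^sup>2 = 1" using unit[of r] r by simp
  then have "s r = -1" using Q by (auto simp: power2_eq_1_iff)
  then have "vertical_soliton (\<lambda>t. x (- t + r) + - x r) (\<lambda>t. y (- t + r)) (\<lambda>t. - c (- t + r)) (\<lambda>t. - s (- t + r))"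
    using soliton.reversed[OF shifted[of r "- x r"]] r Q
    by (simp add: vertical_soliton_def vertical_soliton_axioms_def)
  from that[OF this \<open>r < 0\<close>] Q show ?thesis by simp
qed

lemma soliton_family_continuous:
  fixes X Y C S :: "real \<Rightarrow> real \<Rightarrow> real"
  assumes sol: "\<And>l. l \<in> D \<Longrightarrow> soliton (X l) (Y l) (C l) (S l)"
    and M: "\<And>l. l \<in> D \<Longrightarrow> \<bar>Y l 0\<bar> \<le> M"
    and init: "continuous_on D (\<lambda>l. Y l 0)" "continuous_on D (\<lambda>l. C l 0)" "continuous_on D (\<lambda>l. S l 0)"
  shows "continuous_on D (\<lambda>l. (Y l t, C l t, S l t))"
proof -
  define K where "K = exp (6 * (1 + 3 * (M + \<bar>t\<bar> + 1) ^ 3) * \<bar>t\<bar>)"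
  have lim: "((\<lambda>l. F l t) \<longlongrightarrow> F m t) (at m within D)"
    if "F \<in> {Y, C, S}" "m \<in> D" for F m
  proof -
    define E where "E l = ((Y l 0 - Y m 0)\<^sup>2 + (C l 0 - C m 0)\<^sup>2 + (S l 0 - S m 0)\<^sup>2) * K" for l
    have bound: "norm (F l t - F m t) \<le> sqrt (E l)" if "l \<in> D" for l
    proof -
      have "(Y l t - Y m t)\<^sup>2 + (C l t - C m t)\<^sup>2 + (S l t - S m t)\<^sup>2 \<le> E l"
        unfolding E_def K_def using soliton_gronwall[OF sol sol M M] \<open>l \<in> D\<close> \<open>m \<in> D\<close> by blast
      moreover have "(F l t - F m t)\<^sup>2 \<le> (Y l t - Y m t)\<^sup>2 + (C l t - C m t)\<^sup>2 + (S l t - S m t)\<^sup>2"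
        using \<open>F \<in> _\<close> by auto
      ultimately have "(F l t - F m t)\<^sup>2 \<le> E l" by linarith
      then have "sqrt ((F l t - F m t)\<^sup>2) \<le> sqrt (E l)" by (rule real_sqrt_le_mono)
      then show ?thesis by simp
    qed
    have "((\<lambda>l. sqrt (E l)) \<longlongrightarrow> sqrt (((Y m 0 - Y m 0)\<^sup>2 + (C m 0 - C m 0)\<^sup>2 + (S m 0 - S m 0)\<^sup>2) * K)) (at m within D)"
      unfolding E_def using init \<open>m \<in> D\<close> by (intro tendsto_intros) (auto simp: continuous_on)
    then have "((\<lambda>l. sqrt (E l)) \<longlongrightarrow> 0) (at m within D)" by simp
    moreover have "\<forall>\<^sub>F l in at m within D. norm (F l t - F m t) \<le> sqrt (E l)"
      using bound by (auto simp: eventually_at_filter)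
    ultimately have "((\<lambda>l. F l t - F m t) \<longlongrightarrow> 0) (at m within D)"
      by (rule Lim_null_comparison[rotated])
    then show ?thesis by (simp add: LIM_zero_iff)
  qed
  show ?thesis unfolding continuous_on by (intro ballI tendsto_Pair lim) auto
qed

text \<open>The parameters whose trajectories enter \<open>A\<close> and those whose trajectories enter \<open>B\<close> form disjoint nonempty open
subsets of the unit interval, which is connected.\<close>

lemma shooting:
  fixes Z :: "real \<Rightarrow> real \<Rightarrow> 'a::topological_space"
  assumes cont: "\<And>t. t \<ge> 0 \<Longrightarrow> continuous_on {0..1} (\<lambda>l. Z l t)"
    and "open A" "open B"
    and "\<exists>t\<ge>0. Z 0 t \<in> A" "\<exists>t\<ge>0. Z 1 t \<in> B"
    and disjoint: "\<And>l t u. 0 \<le> l \<Longrightarrow> l \<le> 1 \<Longrightarrow> 0 \<le> t \<Longrightarrow> 0 \<le> u \<Longrightarrow> Z l t \<in> A \<Longrightarrow> Z l u \<in> B \<Longrightarrow> False"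
  obtains l where "0 < l" "l < 1" "\<And>t. t \<ge> 0 \<Longrightarrow> Z l t \<notin> A \<and> Z l t \<notin> B"
proof -
  define H where "H U = {l \<in> {0..1}. \<exists>t\<ge>0. Z l t \<in> U}" for U
  have op: "openin (top_of_set {0..1}) (H U)" if "open U" for U
  proof -
    have eq: "H U = \<Union> ((\<lambda>t. {0..1} \<inter> (\<lambda>l. Z l t) -` U) ` {0..})" by (auto simp: H_def)
    show ?thesis unfolding eq
      using continuous_openin_preimage_gen[OF cont \<open>open U\<close>] by (intro openin_Union) auto
  qed
  have ends: "0 \<in> H A" "1 \<in> H B" using assms(4,5) by (auto simp: H_def)
  have "\<not> {0..1} \<subseteq> H A \<union> H B"
  proof
    assume "{0..1} \<subseteq> H A \<union> H B"
    moreover have "H A \<inter> H B = {}" using disjoint by (auto simp: H_def)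
    moreover have "H A \<noteq> {}" "H B \<noteq> {}" using ends by blast+
    moreover have "connected {0..1::real}" by simp
    ultimately show False unfolding connected_openin using op[OF \<open>open A\<close>] op[OF \<open>open B\<close>] by blast
  qed
  then obtain l where l: "l \<in> {0..1}" "l \<notin> H A" "l \<notin> H B" by blast
  have "l \<noteq> 0" "l \<noteq> 1" using l ends by auto
  then show ?thesis using that[of l] l by (auto simp: H_def)
qed

text \<open>Initial data with slope \<open>q l\<close> at height \<open>y0 l\<close>, going to the right or to the left according to the sign \<open>e\<close>.\<close>

lemma soliton_family:
  fixes y0 q :: "real \<Rightarrow> real"
  assumes "e \<in> {-1, 1}"
  obtains X Y C S :: "real \<Rightarrow> real \<Rightarrow> real" where "\<And>l. soliton (X l) (Y l) (C l) (S l)"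
    "\<And>l. Y l 0 = y0 l" "\<And>l. C l 0 = e / sqrt (1 + (q l)\<^sup>2)" "\<And>l. S l 0 = e * q l / sqrt (1 + (q l)\<^sup>2)"
proof -
  have "\<exists>x y c s. soliton x y c s \<and> y 0 = y0 l \<and> c 0 = e / sqrt (1 + (q l)\<^sup>2) \<and> s 0 = e * q l / sqrt (1 + (q l)\<^sup>2)" for l
  proof -
    define w where "w = sqrt (1 + (q l)\<^sup>2)"
    have w: "w\<^sup>2 = 1 + (q l)\<^sup>2" "w \<noteq> 0" by (simp_all add: w_def add_pos_nonneg less_imp_neq[symmetric])
    have "(e / w)\<^sup>2 + (e * q l / w)\<^sup>2 = e\<^sup>2 * (1 + (q l)\<^sup>2) / w\<^sup>2"
      by (simp add: power_divide power_mult_distrib add_divide_distrib distrib_left)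
    also have "\<dots> = 1" using assms w by (auto simp flip: w(1))
    finally obtain x y c s where "soliton x y c s" "x 0 = 0" "y 0 = y0 l" "c 0 = e / w" "s 0 = e * q l / w"
      using soliton_exists[of "e / w" "e * q l / w" 0 "y0 l"] by blast
    then show ?thesis unfolding w_def by blast
  qed
  then show ?thesis using that by metis
qed

text \<open>The initial data run from height 0 and slope \<open>-1\<close> to height 1 and slope 0. At the first end the trajectory crosses the
x-axis, at the second it rises. A trajectory that does neither stays in \<open>y > 0\<close>, \<open>s < 0\<close>.\<close>

lemma descending_separatrix:
  obtains x y c s where "soliton x y c s" "c 0 > 0" "\<And>t. y t > 0 \<and> s t < 0"
proof -
  obtain X Y C S where sol: "\<And>l. soliton (X l) (Y l) (C l) (S l)"
    and init: "\<And>l. Y l 0 = l" "\<And>l. C l 0 = 1 / sqrt (1 + (l - 1)\<^sup>2)" "\<And>l. S l 0 = 1 * (l - 1) / sqrt (1 + (l - 1)\<^sup>2)"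
    by (rule soliton_family[of 1 "\<lambda>l. l" "\<lambda>l. l - 1"]) (simp, blast)
  have pos: "sqrt (1 + (l - 1)\<^sup>2) > 0" for l :: real by (simp add: add_pos_nonneg)
  define A where "A = {w :: real \<times> real \<times> real. fst w < 0 \<and> snd (snd w) < 0}"
  define B where "B = {w :: real \<times> real \<times> real. fst w > 0 \<and> snd (snd w) > 0}"
  have op: "open A" "open B" unfolding A_def B_def
    by (intro open_Collect_conj open_Collect_less continuous_on_fst continuous_on_snd continuous_on_id
        continuous_on_const continuous_on_mult continuous_on_diff)+
  obtain l where l: "0 < l" "l < 1" "\<And>t. t \<ge> 0 \<Longrightarrow> (Y l t, C l t, S l t) \<notin> A \<and> (Y l t, C l t, S l t) \<notin> B"
  proof (rule shooting[of "\<lambda>l t. (Y l t, C l t, S l t)" A B, OF _ op])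
    show "continuous_on {0..1} (\<lambda>l. (Y l t, C l t, S l t))" for t
    proof (rule soliton_family_continuous[where M = 1, OF sol])
      have nz: "sqrt (1 + (l - 1)\<^sup>2) \<noteq> 0" for l :: real using pos[of l] by simp
      show "continuous_on {0..1} (\<lambda>l. Y l 0)" "continuous_on {0..1} (\<lambda>l. C l 0)" "continuous_on {0..1} (\<lambda>l. S l 0)"
        unfolding init using nz by (intro continuous_intros; simp)+
    qed (simp add: init)
    have "S 0 0 < 0" using pos[of 0] by (simp add: init divide_neg_pos)
    then have "Y 0 1 < 0 \<and> S 0 1 < 0" using soliton.quadrant3[OF sol, where a = 0 and t = 1 and l1 = 0] init by simp
    then show "\<exists>t\<ge>0. (Y 0 t, C 0 t, S 0 t) \<in> A" by (intro exI[of _ 1]) (simp add: A_def)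
    have "Y 1 1 > 0 \<and> S 1 1 > 0" using soliton.quadrant1[OF sol, where a = 0 and t = 1 and l1 = 1] init by simp
    then show "\<exists>t\<ge>0. (Y 1 t, C 1 t, S 1 t) \<in> B" by (intro exI[of _ 1]) (simp add: B_def)
    fix l t u
    assume "(Y l t, C l t, S l t) \<in> A" "(Y l u, C l u, S l u) \<in> B"
    then have "Y l t < 0" "S l t < 0" "Y l u > 0" "S l u > 0" by (auto simp: A_def B_def)
    then show False
      using soliton.quadrant3[OF sol, where a = t and t = u and l1 = l] soliton.quadrant1[OF sol, where a = u and t = t and l1 = l]
      by (cases t u rule: linorder_cases) auto
  qed blast
  interpret soliton "X l" "Y l" "C l" "S l" by (rule sol)
  have y0: "Y l 0 > 0" and s0: "S l 0 < 0" and c0: "C l 0 > 0"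
    using l pos[of l] by (auto simp: init divide_neg_pos)
  have fwd: "Y l t > 0 \<and> S l t < 0" if "t \<ge> 0" for t
  proof (rule ccontr)
    assume bad: "\<not> (Y l t > 0 \<and> S l t < 0)"
    then have "t > 0" using that y0 s0 by (cases "t = 0") auto
    define g where "g t = min (Y l t) (- S l t)" for t
    have "isCont g t" for t unfolding g_def by (intro continuous_intros) auto
    moreover have "g 0 > 0" "g t \<le> 0" using y0 s0 bad by (auto simp: g_def min_def)
    ultimately obtain e where e: "0 < e" "g e = 0"
      using first_zero[of 0 t g] \<open>t > 0\<close> by blast
    have nz: "\<not> (Y l e = 0 \<and> S l e = 0)" using equilibrium(1)[of e 0] y0 by auto
    consider "Y l e = 0" "S l e < 0" | "S l e = 0" "Y l e > 0"
      using e(2) nz by (auto simp: g_def min_def split: if_splits)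
    then show False
    proof cases
      case 1
      then have "Y l (e + 1) < 0 \<and> S l (e + 1) < 0" using quadrant3[of e "e + 1"] by simp
      then show ?thesis using l(3)[of "e + 1"] e(1) by (simp add: A_def)
    next
      case 2
      then have "Y l (e + 1) > 0 \<and> S l (e + 1) > 0" using quadrant1[of e "e + 1"] by simp
      then show ?thesis using l(3)[of "e + 1"] e(1) by (simp add: B_def)
    qed
  qed
  have "Y l t > 0 \<and> S l t < 0" for t
    using fwd[of t] quadrant4[of 0 t] y0 s0 by (cases "t \<ge> 0") auto
  then show ?thesis using that sol c0 by blast
qed

text \<open>The trajectories are followed backwards, that is to the left with \<open>c < 0\<close>, from height 1. With the slope increasing from 0 to
1, they go from having a lowest point, after which they are in \<open>A\<close>, to having an inflection point, after which they
are in \<open>B\<close>. A trajectory that has neither stays between the x-axis and the inflection curve \<open>v = 0\<close>.\<close>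

lemma ascending_separatrix:
  obtains x y c s where "soliton x y c s" "\<And>t. c t > 0 \<and> y t > 0 \<and> s t > 0"
proof -
  obtain X Y C S where sol: "\<And>l. soliton (X l) (Y l) (C l) (S l)"
    and init: "\<And>l. Y l 0 = 1" "\<And>l. C l 0 = -1 / sqrt (1 + l\<^sup>2)" "\<And>l. S l 0 = -1 * l / sqrt (1 + l\<^sup>2)"
    by (rule soliton_family[of "-1" "\<lambda>l. 1" "\<lambda>l. l"]) (simp, blast)
  have pos: "sqrt (1 + l\<^sup>2) > 0" for l :: real by (simp add: add_pos_nonneg)
  define A where "A = {w :: real \<times> real \<times> real. fst (snd w) < 0 \<and> fst w > 0 \<and> snd (snd w) > 0}"
  define B where "B = {w :: real \<times> real \<times> real. fst (snd w) < 0 \<and> snd (snd w) < 0 \<and> fst w * fst (snd w) - snd (snd w) > 0}"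
  have op: "open A" "open B" unfolding A_def B_def
    by (intro open_Collect_conj open_Collect_less continuous_on_fst continuous_on_snd continuous_on_id
        continuous_on_const continuous_on_mult continuous_on_diff)+
  obtain l where l: "0 < l" "l < 1" "\<And>t. t \<ge> 0 \<Longrightarrow> (Y l t, C l t, S l t) \<notin> A \<and> (Y l t, C l t, S l t) \<notin> B"
  proof (rule shooting[of "\<lambda>l t. (Y l t, C l t, S l t)" A B, OF _ op])
    show "continuous_on {0..1} (\<lambda>l. (Y l t, C l t, S l t))" for t
    proof (rule soliton_family_continuous[where M = 1, OF sol])
      have nz: "sqrt (1 + l\<^sup>2) \<noteq> 0" for l :: real using pos[of l] by simp
      show "continuous_on {0..1} (\<lambda>l. Y l 0)" "continuous_on {0..1} (\<lambda>l. C l 0)" "continuous_on {0..1} (\<lambda>l. S l 0)"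
        unfolding init using nz by (intro continuous_intros; simp)+
    qed (simp add: init)
    show "\<exists>t\<ge>0. (Y 0 t, C 0 t, S 0 t) \<in> A"
    proof -
      interpret soliton "X 0" "Y 0" "C 0" "S 0" by (rule sol)
      have "isCont (\<lambda>t. - C 0 t) 0" "- C 0 0 > 0" by (auto simp: init)
      then have "\<forall>\<^sub>F t in at_right 0. - C 0 t > 0" by (rule eventually_right_pos)
      then obtain t where t: "0 < t" "- C 0 t > 0" using eventually_right_ex[of _ 0 1] by auto
      then show ?thesis using quadrant1[of 0 t] init by (intro exI[of _ t]) (simp add: A_def)
    qed
    show "\<exists>t\<ge>0. (Y 1 t, C 1 t, S 1 t) \<in> B"
    proof -
      interpret soliton "X 1" "Y 1" "C 1" "S 1" by (rule sol)
      have 0: "- C 1 0 > 0" "- S 1 0 > 0" "v 0 = 0" by (auto simp: init)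
      have "S 1 0 * C 1 0 > 0" using 0 by (simp add: mult_neg_neg)
      then have "\<forall>\<^sub>F t in at_right 0. v t > v 0" using 0
        by (intro eventually_right_increasing[OF dv]) simp
      moreover have "\<forall>\<^sub>F t in at_right 0. - C 1 t > 0" "\<forall>\<^sub>F t in at_right 0. - S 1 t > 0"
        using 0 by (intro eventually_right_pos; simp)+
      ultimately have "\<forall>\<^sub>F t in at_right 0. - C 1 t > 0 \<and> - S 1 t > 0 \<and> v t > v 0" by (intro eventually_conj)
      then obtain t where "0 < t" "- C 1 t > 0 \<and> - S 1 t > 0 \<and> v t > v 0" using eventually_right_ex[of _ 0 1] by auto
      then show ?thesis using 0 by (intro exI[of _ t]) (simp add: B_def)
    qed
    fix l t u
    assume "(Y l t, C l t, S l t) \<in> A" "(Y l u, C l u, S l u) \<in> B"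
    then have t: "C l t < 0" "Y l t > 0" "S l t > 0" and u: "C l u < 0" "S l u < 0" "Y l u * C l u - S l u > 0"
      by (auto simp: A_def B_def)
    interpret soliton "X l" "Y l" "C l" "S l" by (rule sol)
    show False
    proof (cases "t \<le> u")
      case True
      then show ?thesis using quadrant1[of t u] t u by (cases "t = u") auto
    next
      case False
      then have "u < t" by simp
      have c_neg: "C l r < 0" if "r \<le> t" for r
        using vertical_before[of t r] t(1) that by (cases "r = t") auto
      obtain e where e: "u < e" "e \<le> t" "- S l e = 0" "\<And>r. u \<le> r \<Longrightarrow> r < e \<Longrightarrow> - S l r > 0"
        using first_zero[OF \<open>u < t\<close>, of "\<lambda>r. - S l r"] t u by auto
      obtain z where z: "u < z" "z < e" "S l e - S l u = (e - u) * (v z ^ 3 * C l z)"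
        using MVT2[OF e(1), of "S l" "\<lambda>z. v z ^ 3 * C l z"] ds by blast
      have "v z > 0"
        using u e z c_neg by (intro v_upcrossing[OF z(1)]) (auto intro!: mult_neg_neg)
      then have "v z ^ 3 * C l z < 0" using c_neg[of z] z e by (simp add: mult_pos_neg)
      then have "(e - u) * (v z ^ 3 * C l z) < 0" using e(1) by (simp add: mult_pos_neg)
      then show False using z(3) e(3) u(2) by simp
    qed
  qed blast
  interpret soliton "X l" "Y l" "C l" "S l" by (rule sol)
  have init0: "C l 0 < 0" "S l 0 < 0" "v 0 < 0"
    using l(1,2) pos[of l] by (auto simp: init divide_neg_pos field_simps)
  have fwd: "C l t < 0 \<and> S l t < 0 \<and> v t < 0" if "t \<ge> 0" for t
  proof (rule ccontr)
    assume bad: "\<not> (C l t < 0 \<and> S l t < 0 \<and> v t < 0)"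
    then have "t > 0" using that init0 by (cases "t = 0") auto
    define g where "g t = min (- C l t) (min (- S l t) (- v t))" for t
    have "isCont g t" for t unfolding g_def by (intro continuous_intros isCont_v) auto
    moreover have "g 0 > 0" "g t \<le> 0" using init0 bad by (auto simp: g_def min_def)
    ultimately obtain e where e: "0 < e" "g e = 0"
      using first_zero[of 0 t g] \<open>t > 0\<close> by blast
    have "g e \<le> - C l e" "g e \<le> - S l e" "g e \<le> - v e"
      unfolding g_def by (rule min.cobounded1 min.coboundedI2 order_refl)+
    then have le: "C l e \<le> 0" "S l e \<le> 0" "v e \<le> 0" using e(2) by linarith+
    have "g e = - C l e \<or> g e = - S l e \<or> g e = - v e" unfolding g_def by (simp only: min_def) presburger
    then have zero: "C l e = 0 \<or> S l e = 0 \<or> v e = 0" using e(2) by linarith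
    have c_neg: "C l e < 0"
    proof (rule ccontr)
      assume "\<not> C l e < 0"
      then have "C l e = 0" using le by simp
      then have "S l e = 0" using le by simp
      then show False using \<open>C l e = 0\<close> unit[of e] by simp
    qed
    then have "\<forall>\<^sub>F t in at_right e. - C l t > 0" by (intro eventually_right_pos) auto
    show False
    proof (cases "S l e = 0")
      case True
      then have "Y l e \<ge> 0" using le(3) c_neg by (simp add: mult_le_0_iff)
      moreover have "Y l e \<noteq> 0" using equilibrium(1)[of e 0] True init(1)[of l] by auto
      ultimately have "Y l e > 0" by simp
      obtain t where "e < t" "- C l t > 0"
        using \<open>\<forall>\<^sub>F t in at_right e. - C l t > 0\<close> eventually_right_ex[of _ e "e + 1"] by auto
      then show False using quadrant1[of e t] True \<open>Y l e > 0\<close> l(3)[of t] e(1) by (simp add: A_def)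
    next
      case False
      then have s_neg: "S l e < 0" using le by simp
      have "C l e \<noteq> 0" using c_neg by simp
      then have v0: "v e = 0" using zero False by blast
      have "S l e * C l e > 0" using s_neg c_neg by (simp add: mult_neg_neg)
      then have "\<forall>\<^sub>F t in at_right e. v t > v e"
        using v0 by (intro eventually_right_increasing[OF dv]) simp
      moreover have "\<forall>\<^sub>F t in at_right e. - S l t > 0"
        using s_neg by (intro eventually_right_pos) auto
      ultimately have "\<forall>\<^sub>F t in at_right e. - C l t > 0 \<and> - S l t > 0 \<and> v t > v e"
        using \<open>\<forall>\<^sub>F t in at_right e. - C l t > 0\<close> by (intro eventually_conj)
      then obtain t where "e < t" "- C l t > 0 \<and> - S l t > 0 \<and> v t > v e"
        using eventually_right_ex[of _ e "e + 1"] by auto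
      then show False using l(3)[of t] e(1) v0 by (simp add: B_def)
    qed
  qed
  have fwd': "C l t < 0 \<and> S l t < 0 \<and> Y l t > 0" if "t \<ge> 0" for t
  proof -
    have "Y l t * C l t < 0" using fwd[OF that] by simp
    then show ?thesis using fwd[OF that] by (auto simp: mult_less_0_iff)
  qed
  interpret R: soliton "\<lambda>t. X l (- t)" "\<lambda>t. Y l (- t)" "\<lambda>t. - C l (- t)" "\<lambda>t. - S l (- t)" by (rule reversed)
  have "- C l (- t) > 0 \<and> Y l (- t) > 0 \<and> - S l (- t) > 0" for t
  proof (cases "t \<le> 0")
    case True
    then show ?thesis using fwd'[of "- t"] by simp
  next
    case False
    then show ?thesis using R.vertical_after[of 0 t] R.quadrant1[of 0 t] fwd'[of 0] by simp
  qed
  from that[OF reversed this] show ?thesis .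
qed

lemma line_exists: "\<exists>I Y. maximal_solution I Y \<and> is_graph I Y (\<lambda>x. 0)"
proof -
  interpret soliton "\<lambda>t. t" "\<lambda>t. 0" "\<lambda>t. 1" "\<lambda>t. 0" by unfold_locales auto
  have "inj (plane_curve (\<lambda>t. t) (\<lambda>t. 0))" by (rule injI) (metis plane_curve_nth(1))
  moreover have "plane_curve (\<lambda>t. t) (\<lambda>t. 0) ` UNIV = fgraph UNIV (\<lambda>x. 0)"
    by (simp add: fgraph_def plane_curve_def[abs_def])
  ultimately have "is_graph UNIV (plane_curve (\<lambda>t. t) (\<lambda>t. 0)) (\<lambda>x. 0)"
    by (simp add: is_graph_def smooth_on_const)
  then show ?thesis using maximal by blast
qed

lemma turning_exists:
  "\<exists>I Y f1 f2. maximal_solution I Y \<and> is_two_graphs I Y f1 f2 \<and> turning_profile f1 f2"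
proof -
  obtain x y c s :: "real \<Rightarrow> real" where S: "soliton x y c s" "y 0 = 1" "c 0 = 1" "s 0 = 0"
    by (rule soliton_exists[of 1 0 0 1]) (simp, blast)
  then have "c 0 > 0" "y 0 \<ge> 0" "s 0 \<le> 0" "y 0 \<noteq> 0 \<or> s 0 \<noteq> 0" by simp_all
  then obtain x' y' c' s' r where V: "vertical_soliton x' y' c' s'" "r < 0" "y' 0 > 0"
    "\<And>t. y' t = y (r - t)" "\<And>t. s' t = - s (r - t)"
    using soliton.backward_vertical[OF S(1)] by blast
  interpret vertical_soliton x' y' c' s' by (rule V)
  have "y' r > 0 \<and> s' r = 0" using V(4,5)[of r] S by simp
  then show ?thesis using profiles V(2,3) maximal by metis
qed

lemma asymptotic_exists:
  "\<exists>I Y f1 f2. maximal_solution I Y \<and> is_two_graphs I Y f1 f2 \<and> asymptotic_profile f1 f2"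
proof -
  obtain x y c s where S: "soliton x y c s" "c 0 > 0" "\<And>t. y t > 0 \<and> s t < 0"
    using descending_separatrix by blast
  have "y 0 \<ge> 0" "s 0 \<le> 0" "y 0 \<noteq> 0 \<or> s 0 \<noteq> 0" using S(3)[of 0] by auto
  then obtain x' y' c' s' r where V: "vertical_soliton x' y' c' s'" "r < 0" "y' 0 > 0"
    "\<And>t. y' t = y (r - t)" "\<And>t. s' t = - s (r - t)"
    using soliton.backward_vertical[OF S(1,2)] by blast
  interpret vertical_soliton x' y' c' s' by (rule V)
  have "\<forall>t<0. y' t > 0 \<and> s' t > 0" using V(4,5) S(3) by simp
  then show ?thesis using profiles V(3) maximal by metis
qed

text \<open>The curve through the origin with unit tangent \<open>(3/5, -4/5)\<close>, a convenient rational direction.\<close>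

lemma crossing_exists:
  "\<exists>I Y f1 f2. maximal_solution I Y \<and> is_two_graphs I Y f1 f2 \<and> crossing_profile f1 f2 \<and> f1 0 > 0"
proof -
  obtain x y c s :: "real \<Rightarrow> real" where S: "soliton x y c s" "y 0 = 0" "c 0 = 3/5" "s 0 = -4/5"
    by (rule soliton_exists[of "3/5" "-4/5" 0 0]) (simp add: power2_eq_square, blast)
  then have "c 0 > 0" "y 0 \<ge> 0" "s 0 \<le> 0" "y 0 \<noteq> 0 \<or> s 0 \<noteq> 0" by simp_all
  then obtain x' y' c' s' r where V: "vertical_soliton x' y' c' s'" "r < 0" "y' 0 > 0"
    "\<And>t. y' t = y (r - t)" "\<And>t. s' t = - s (r - t)"
    using soliton.backward_vertical[OF S(1)] by blast
  interpret vertical_soliton x' y' c' s' by (rule V)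
  have "y' r = 0" using V(4)[of r] S by simp
  then show ?thesis using profiles V(2,3) maximal by metis
qed

lemma symmetric_crossing_exists:
  "\<exists>I Y f1 f2. maximal_solution I Y \<and> is_two_graphs I Y f1 f2 \<and> crossing_profile f1 f2 \<and> f1 0 = 0"
proof -
  obtain x y c s :: "real \<Rightarrow> real" where S: "soliton x y c s" "x 0 = 0" "y 0 = 0" "c 0 = 0" "s 0 = 1"
    by (rule soliton_exists[of 0 1 0 0]) (simp, blast)
  then interpret vertical_soliton x y c s by (simp add: vertical_soliton_def vertical_soliton_axioms_def)
  show ?thesis using profiles S(3) maximal by metis
qed

lemma entire_exists: "\<exists>I Y f. maximal_solution I Y \<and> is_graph I Y f \<and> entire_profile f"
proof -
  obtain x y c s where S: "soliton x y c s" "\<And>t. c t > 0 \<and> y t > 0 \<and> s t > 0"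
    using ascending_separatrix by blast
  then show ?thesis using soliton.entire_graph[OF S] soliton.maximal[OF S(1)] by metis
qed

theorem maximal_solution_standard:
  assumes "maximal_solution I Y"
  shows "\<exists>g\<in>motions. maximal_solution I (g \<circ> Y) \<and> standard_curve I (g \<circ> Y)"
proof -
  obtain x y c s \<phi> where S: "soliton x y c s" and \<phi>: "\<phi> ` I = UNIV" "inj_on \<phi> I" "\<forall>u\<in>I. Y u = plane_curve x y (\<phi> u)"
    using maximal_solution_reparametrized[OF assms] by blast
  obtain e a where e: "e \<in> {-1, 1}" "standard_curve UNIV (symmetry e a \<circ> plane_curve x y)"
    using soliton_standardizable[OF S] unfolding standardizable_def by blast
  have "standard_curve I (symmetry e a \<circ> Y)"
    by (rule standard_curve_reparametrized[OF e(2) \<phi>(1,2)]) (use \<phi>(3) in simp)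
  then show ?thesis using symmetry_maximal[OF e(1) assms] symmetry_motion[OF e(1)] by blast
qed

theorem theorem3p3:
  shows
    "(\<forall>I Y. maximal_solution I Y \<longrightarrow>
        (\<exists>g\<in>motions. maximal_solution I (g \<circ> Y) \<and>
           (is_graph I (g \<circ> Y) (\<lambda>x. 0) \<or>
            (\<exists>f1 f2. is_two_graphs I (g \<circ> Y) f1 f2 \<and> turning_profile f1 f2) \<or>
            (\<exists>f1 f2. is_two_graphs I (g \<circ> Y) f1 f2 \<and> asymptotic_profile f1 f2) \<or>
            (\<exists>f1 f2. is_two_graphs I (g \<circ> Y) f1 f2 \<and> crossing_profile f1 f2) \<or>
            (\<exists>f. is_graph I (g \<circ> Y) f \<and> entire_profile f)))) \<and>
     (\<exists>I Y. maximal_solution I Y \<and> is_graph I Y (\<lambda>x. 0)) \<and>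
     (\<exists>I Y f1 f2. maximal_solution I Y \<and> is_two_graphs I Y f1 f2 \<and> turning_profile f1 f2) \<and>
     (\<exists>I Y f1 f2. maximal_solution I Y \<and> is_two_graphs I Y f1 f2 \<and> asymptotic_profile f1 f2) \<and>
     (\<exists>I Y f1 f2. maximal_solution I Y \<and> is_two_graphs I Y f1 f2 \<and> crossing_profile f1 f2 \<and>
                  f1 0 > 0) \<and>
     (\<exists>I Y f1 f2. maximal_solution I Y \<and> is_two_graphs I Y f1 f2 \<and> crossing_profile f1 f2 \<and>
                  f1 0 = 0) \<and>
     (\<exists>I Y f. maximal_solution I Y \<and> is_graph I Y f \<and> entire_profile f)"
proof -
  have "\<forall>I Y. maximal_solution I Y \<longrightarrow>
      (\<exists>g\<in>motions. maximal_solution I (g \<circ> Y) \<and> standard_curve I (g \<circ> Y))"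
    using maximal_solution_standard by blast
  note classification = this[unfolded standard_curve_def]
  show ?thesis
    by (rule conjI[OF classification conjI[OF line_exists conjI[OF turning_exists
          conjI[OF asymptotic_exists conjI[OF crossing_exists
          conjI[OF symmetric_crossing_exists entire_exists]]]]]])
qed

end
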